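(* Let $\nu\in\mathscr G_\theta$ and let $\mu\in\mathcal P(\Omega)$ be translation-invariant with finite first moment, i.e. $\mu[N_\Lambda]<\infty$ for every bounded Borel $\Lambda\subset\mathbb R^d$. Let $t\ge0$. (1) There is a finite constant $C_t$ (depending on $t$) such that for all bounded Borel sets $\Lambda\subset\widehat\Lambda\subset\mathbb R^d$ and every bounded measurable $f:\Omega\to\mathbb R$ with $f(\cdot)=f(\cdot_\Lambda)$, $$\big|\mu T_t[f]-\mu T_t^{(\widehat\Lambda)}[f]\big|\ \le\ C_t\,|\Lambda|\,\|f\|_\infty\, e^{-\mathrm{dist}(\Lambda,\widehat\Lambda^c)} .$$ (2) Let $\{f_\Lambda:\Lambda\subset\mathbb R^d\text{ bounded Borel}\}$ be a family of measurable local functions, $f_\Lambda(\cdot)=f_\Lambda(\cdot_\Lambda)$, such that $|f_\Lambda|\le c\,N_\Lambda$ with $c<\infty$ independent of $\Lambda$. If $\Lambda\subset\widehat\Lambda$ run along sequences of bounded Borel sets with $\Lambda,\widehat\Lambda\uparrow\mathbb R^d$ in such a way that $\log(|\Lambda|)/\mathrm{dist}(\Lambda,\widehat\Lambda^c)$ stays bounded from above, then $$\frac1{|\Lambda|}\big|\mu T_t[f_\Lambda]-\mu T_t^{(\widehat\Lambda)}[f_\Lambda]\big|\longrightarrow 0\qquad\text{as }\Lambda\uparrow\mathbb R^d .$$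
   Context: Configurations. Let $d\ge 1$. $\Omega$ is the set of simple, locally finite point configurations $\eta=\sum_i\delta_{x_i}$ in $\mathbb R^d$, with the $\sigma$-algebra generated by the counting maps $N_\Lambda(\eta)=|\eta\cap\Lambda|$, $\Lambda$ bounded Borel. $\eta_\Lambda:=\eta\cap\Lambda$; $\Omega_\Lambda$ is the set of configurations in $\Lambda$; $\eta_\Lambda\omega_{\Lambda^c}$ denotes the union; $\mathcal P(\Omega)$ is the set of probability measures on $\Omega$; $\mu_\Lambda$ is the law of $\eta_\Lambda$ under $\mu$; $\mu[f]=\int f\,\mathrm d\mu$. $\Lambda_n:=[-n/2,n/2)^d$. Gibbs measures. Fix $R>0$. For finite $\eta$ let $H(\eta)=\big|\bigcup_{x\in\eta}B_R(x)\big|$ (Lebesgue measure), and for bounded Borel $\Lambda$ let $H_\Lambda(\eta):=\lim_{n\uparrow\infty}\big(H(\eta_{\Lambda_n})-H(\eta_{\Lambda_n\setminus\Lambda})\big)$. Let $\pi$ be the intensity-one homogeneous Poisson point process and $\nu^{(\omega)}_\Lambda(\mathrm d\eta_\Lambda)=Z_\Lambda(\omega)^{-1}e^{-H_\Lambda(\eta_\Lambda\omega_{\Lambda^c})}\pi_\Lambda(\mathrm d\eta_\Lambda)$. An infinite-volume Gibbs point process is a $\nu\in\mathcal P(\Omega)$ with $\int\nu(\mathrm d\omega)f(\omega)=\int\nu(\mathrm d\omega)\int\nu^{(\omega)}_\Lambda(\mathrm d\eta_\Lambda)f(\eta_\Lambda\omega_{\Lambda^c})$ for all bounded Borel $\Lambda$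 and measurable $f\ge0$. $\mathscr G_\theta$ is the set of translation-invariant ones. Dynamics. $h(x,\eta):=\lim_{n\uparrow\infty}(H(\eta_{\Lambda_n}+\delta_x)-H(\eta_{\Lambda_n}))$ and $b(x,\eta):=e^{-h(x,\eta)}$. The process $(X^{(\eta)}_t)_{t\ge0}$ started at $\eta=\sum_i\delta_{x_i}$ is the unique solution (known to exist) of $$X^{(\eta)}_t(B)=\int_{B\times[0,\infty)^2\times[0,t]}\mathcal N(\mathrm dx,\mathrm du,\mathrm dr,\mathrm ds)\,\mathbf 1_{[0,b(x,X^{(\eta)}_{s-})]}(u)\mathbf 1_{(t-s,\infty)}(r)+\int_{B\times[0,\infty)}\hat\eta(\mathrm dx,\mathrm dr)\mathbf 1_{(t,\infty)}(r)$$ for all Borel $B\subset\mathbb R^d$, where $\mathcal N$ is a Poisson random measure on $\mathbb R^d\times[0,\infty)^3$ with intensity $\mathrm dx\otimes\mathrm du\otimes e^{-r}\mathrm dr\otimes\mathrm ds$ and $\hat\eta=\sum_i\delta_{(x_i,\tau_i)}$ with i.i.d. unit exponential $\tau_i$ independent of $\mathcal N$. $(T_tf)(\eta)=\mathbb E[f(X^{(\eta)}_t)]$, and $\mu T_t$ is the law at time $t$ when started from $\mu$. Local dynamics. For $\nu\in\mathscr G_\theta$ and bounded Borel $\Lambda$, let $b^\nu_\Lambda(x,\eta_\Lambda):=\int\nu(\mathrm d\zeta_{\Lambda^c}|\eta_\Lambda)\,b(x,\eta_\Lambda\zeta_{\Lambda^c})$, where $\nu(\cdot|\eta_\Lambda)$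 is the conditional law of $\zeta_{\Lambda^c}$ given $\eta_\Lambda$. The process $(X^{(\Lambda,\eta)}_t)_{t\ge0}$ on $\Omega_\Lambda$, started from $\eta_\Lambda$, solves the same equation for Borel $B\subset\Lambda$ with $b$ replaced by $b^\nu_\Lambda$; i.e. it is the birth-and-death process in $\Lambda$ with birth rate $b^\nu_\Lambda$ and unit death rate. $(T^{(\Lambda)}_t)_{t\ge0}$ is its semigroup and $\mu T_t^{(\Lambda)}$ its law at time $t$ when started from $\mu_\Lambda$. *)

theory Defs
  imports "HOL-Probability.Probability"
begin

section \<open>Point configurations\<close>

text \<open>A simple point configuration is identified with its set of points, so that the number of
  points in a bounded set \<^term>\<open>\<Lambda>\<close> is \<^term>\<open>card (\<eta> \<inter> \<Lambda>)\<close>, the restriction to \<^term>\<open>\<Lambda>\<close>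
  is \<^term>\<open>\<eta> \<inter> \<Lambda>\<close> and the superposition of two configurations is their union.\<close>

definition locally_finite :: "'a::euclidean_space set \<Rightarrow> bool" where
  "locally_finite \<eta> \<longleftrightarrow> (\<forall>B. bounded B \<longrightarrow> finite (\<eta> \<inter> B))"

definition bounded_borel :: "'a::euclidean_space set \<Rightarrow> bool" where
  "bounded_borel \<Lambda> \<longleftrightarrow> bounded \<Lambda> \<and> \<Lambda> \<in> sets borel"

definition configs :: "'a::euclidean_space set measure" where
  "configs = sigma {\<eta>. locally_finite \<eta>}
     {{\<eta>. locally_finite \<eta> \<and> card (\<eta> \<inter> \<Lambda>) = k} | \<Lambda> k. bounded_borel \<Lambda>}"

definition configs_in :: "'a::euclidean_space set \<Rightarrow> 'a set measure" where
  "configs_in \<Lambda> = restrict_space configs {\<eta>. \<eta> \<subseteq> \<Lambda>}"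

definition centred_box :: "nat \<Rightarrow> 'a::euclidean_space set" where
  "centred_box n = {x. \<forall>i\<in>Basis. - real n / 2 \<le> x \<bullet> i \<and> x \<bullet> i < real n / 2}"

definition translation_invariant :: "'a::euclidean_space set measure \<Rightarrow> bool" where
  "translation_invariant \<mu> \<longleftrightarrow> (\<forall>v. distr \<mu> configs (\<lambda>\<eta>. (\<lambda>x. x + v) ` \<eta>) = \<mu>)"

definition finite_first_moment :: "'a::euclidean_space set measure \<Rightarrow> bool" where
  "finite_first_moment \<mu> \<longleftrightarrow>
     (\<forall>\<Lambda>. bounded_borel \<Lambda> \<longrightarrow> (\<integral>\<^sup>+\<eta>. ennreal (card (\<eta> \<inter> \<Lambda>)) \<partial>\<mu>) < \<infinity>)"

text \<open>\<^term>\<open>N\<close> is, on the probability space \<^term>\<open>M\<close>, a Poisson point process with intensity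
  measure \<^term>\<open>J\<close>; it is used with diffuse \<^term>\<open>J\<close> that are finite on bounded sets, for
  which a Poisson random measure is almost surely a simple locally finite configuration.\<close>

definition poisson_process ::
  "'w measure \<Rightarrow> ('w \<Rightarrow> 'b::euclidean_space set) \<Rightarrow> 'b measure \<Rightarrow> bool" where
  "poisson_process M N J \<longleftrightarrow>
     prob_space M \<and> N \<in> M \<rightarrow>\<^sub>M configs \<and>
     (\<forall>A k. bounded_borel A \<longrightarrow>
        measure M {\<omega> \<in> space M. card (N \<omega> \<inter> A) = k}
          = measure J A ^ k / fact k * exp (- measure J A)) \<and>
     (\<forall>(A :: nat \<Rightarrow> 'b set) I. finite I \<longrightarrow> (\<forall>i\<in>I. bounded_borel (A i)) \<longrightarrow> disjoint_family_on A I \<longrightarrow>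
        prob_space.indep_vars M (\<lambda>_. count_space UNIV) (\<lambda>i \<omega>. card (N \<omega> \<inter> A i)) I)"


section \<open>Gibbs measures of the area interaction\<close>

definition energy :: "real \<Rightarrow> 'a::euclidean_space set \<Rightarrow> real" where
  "energy R \<eta> = measure lborel (\<Union>x\<in>\<eta>. ball x R)"

definition energy_in :: "real \<Rightarrow> 'a::euclidean_space set \<Rightarrow> 'a set \<Rightarrow> real" where
  "energy_in R \<Lambda> \<eta> =
     lim (\<lambda>n. energy R (\<eta> \<inter> centred_box n) - energy R (\<eta> \<inter> (centred_box n - \<Lambda>)))"

definition partition_function ::
  "real \<Rightarrow> 'a::euclidean_space set measure \<Rightarrow> 'a set \<Rightarrow> 'a set \<Rightarrow> real" where
  "partition_function R \<pi> \<Lambda> \<omega> =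
     (\<integral>\<eta>. exp (- energy_in R \<Lambda> (\<eta> \<union> (\<omega> - \<Lambda>))) \<partial>distr \<pi> configs (\<lambda>\<eta>. \<eta> \<inter> \<Lambda>))"

definition gibbs_kernel ::
  "real \<Rightarrow> 'a::euclidean_space set measure \<Rightarrow> 'a set \<Rightarrow> 'a set \<Rightarrow> 'a set measure" where
  "gibbs_kernel R \<pi> \<Lambda> \<omega> = density (distr \<pi> configs (\<lambda>\<eta>. \<eta> \<inter> \<Lambda>))
     (\<lambda>\<eta>. ennreal (exp (- energy_in R \<Lambda> (\<eta> \<union> (\<omega> - \<Lambda>))) / partition_function R \<pi> \<Lambda> \<omega>))"

definition gibbs_process ::
  "real \<Rightarrow> 'a::euclidean_space set measure \<Rightarrow> 'a set measure \<Rightarrow> bool" where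
  "gibbs_process R \<pi> \<nu> \<longleftrightarrow> \<nu> \<in> space (prob_algebra configs) \<and>
     (\<forall>\<Lambda> f. bounded_borel \<Lambda> \<longrightarrow> f \<in> configs \<rightarrow>\<^sub>M (borel :: ennreal measure) \<longrightarrow>
        (\<integral>\<^sup>+\<omega>. f \<omega> \<partial>\<nu>)
          = (\<integral>\<^sup>+\<omega>. (\<integral>\<^sup>+\<eta>. f (\<eta> \<union> (\<omega> - \<Lambda>)) \<partial>gibbs_kernel R \<pi> \<Lambda> \<omega>) \<partial>\<nu>))"


section \<open>Birth-and-death dynamics\<close>

definition add_cost :: "real \<Rightarrow> 'a::euclidean_space \<Rightarrow> 'a set \<Rightarrow> real" where
  "add_cost R x \<eta> =
     lim (\<lambda>n. energy R (insert x (\<eta> \<inter> centred_box n)) - energy R (\<eta> \<inter> centred_box n))"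

definition birth_rate :: "real \<Rightarrow> 'a::euclidean_space \<Rightarrow> 'a set \<Rightarrow> real" where
  "birth_rate R x \<eta> = exp (- add_cost R x \<eta>)"

text \<open>\<^term>\<open>\<kappa>\<close> is a version of the regular conditional law of \<open>\<zeta> - \<Lambda>\<close> given \<open>\<zeta> \<inter> \<Lambda>\<close>
  under \<^term>\<open>\<nu>\<close>.\<close>

definition conditional_law ::
  "'a::euclidean_space set measure \<Rightarrow> 'a set \<Rightarrow> ('a set \<Rightarrow> 'a set measure) \<Rightarrow> bool" where
  "conditional_law \<nu> \<Lambda> \<kappa> \<longleftrightarrow>
     \<kappa> \<in> configs_in \<Lambda> \<rightarrow>\<^sub>M prob_algebra (configs_in (- \<Lambda>)) \<and>
     (\<forall>A\<in>sets (configs_in \<Lambda>). \<forall>B\<in>sets (configs_in (- \<Lambda>)).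
        emeasure \<nu> {\<zeta> \<in> space \<nu>. \<zeta> \<inter> \<Lambda> \<in> A \<and> \<zeta> - \<Lambda> \<in> B}
          = (\<integral>\<^sup>+\<zeta>. indicator A (\<zeta> \<inter> \<Lambda>) * emeasure (\<kappa> (\<zeta> \<inter> \<Lambda>)) B \<partial>\<nu>))"

definition local_birth_rate ::
  "real \<Rightarrow> ('a::euclidean_space set \<Rightarrow> 'a set measure) \<Rightarrow> 'a \<Rightarrow> 'a set \<Rightarrow> real" where
  "local_birth_rate R \<kappa> x \<eta> = (\<integral>\<zeta>. birth_rate R x (\<eta> \<union> \<zeta>) \<partial>\<kappa> \<eta>)"

definition unit_exponential :: "real measure" where
  "unit_exponential = density lborel (\<lambda>r. ennreal (exponential_density 1 r))"

text \<open>The intensity \<open>dx \<otimes> du \<otimes> e\<^sup>-\<^sup>r dr \<otimes> ds\<close> on \<open>\<real>\<^sup>d \<times> [0,\<infinity>)\<^sup>3\<close>, extended by zero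
  to negative \<open>u\<close>, \<open>r\<close>, \<open>s\<close>.\<close>

definition driving_intensity :: "('a::euclidean_space \<times> real \<times> real \<times> real) measure" where
  "driving_intensity =
     lborel \<Otimes>\<^sub>M density lborel (indicator {0..}) \<Otimes>\<^sub>M unit_exponential \<Otimes>\<^sub>M density lborel (indicator {0..})"

text \<open>The initial configuration is \<open>{x i | i < K}\<close>, with a random number \<^term>\<open>K\<close> (possibly
  infinite) of pairwise distinct points, and \<open>\<tau> i\<close> is the residual lifetime of \<open>x i\<close>.\<close>

definition initial_points :: "('w \<Rightarrow> enat) \<Rightarrow> (nat \<Rightarrow> 'w \<Rightarrow> 'a) \<Rightarrow> 'w \<Rightarrow> 'a set" where
  "initial_points K x \<omega> = {x i \<omega> | i. enat i < K \<omega>}"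

definition marked_points ::
  "('w \<Rightarrow> enat) \<Rightarrow> (nat \<Rightarrow> 'w \<Rightarrow> 'a) \<Rightarrow> (nat \<Rightarrow> 'w \<Rightarrow> real) \<Rightarrow> 'w \<Rightarrow> ('a \<times> real) set" where
  "marked_points K x \<tau> \<omega> = {(x i \<omega>, \<tau> i \<omega>) | i. enat i < K \<omega>}"

text \<open>The randomness driving the dynamics started from \<^term>\<open>\<mu>\<close>. The last clause says that
  the Poisson process \<^term>\<open>N\<close>, the enumerated initial configuration and the sequence
  \<^term>\<open>\<tau>\<close> are independent and that \<^term>\<open>\<tau>\<close> is i.i.d. with unit exponential law.\<close>

definition driving_noise ::
  "'w measure \<Rightarrow> ('w \<Rightarrow> ('a::euclidean_space \<times> real \<times> real \<times> real) set) \<Rightarrow>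
   ('w \<Rightarrow> enat) \<Rightarrow> (nat \<Rightarrow> 'w \<Rightarrow> 'a) \<Rightarrow> (nat \<Rightarrow> 'w \<Rightarrow> real) \<Rightarrow> 'a set measure \<Rightarrow> bool" where
  "driving_noise M N K x \<tau> \<mu> \<longleftrightarrow>
     poisson_process M N driving_intensity \<and>
     K \<in> M \<rightarrow>\<^sub>M count_space UNIV \<and> (\<forall>i. x i \<in> M \<rightarrow>\<^sub>M borel) \<and> (\<forall>i. \<tau> i \<in> M \<rightarrow>\<^sub>M borel) \<and>
     (\<forall>\<omega>\<in>space M. inj_on (\<lambda>i. x i \<omega>) {i. enat i < K \<omega>}) \<and>
     initial_points K x \<in> M \<rightarrow>\<^sub>M configs \<and> distr M configs (initial_points K x) = \<mu> \<and>
     distr M (configs \<Otimes>\<^sub>M (count_space UNIV \<Otimes>\<^sub>M (\<Pi>\<^sub>M i\<in>UNIV. borel)) \<Otimes>\<^sub>M (\<Pi>\<^sub>M i\<in>UNIV. borel))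
         (\<lambda>\<omega>. (N \<omega>, (K \<omega>, \<lambda>i. x i \<omega>), \<lambda>i. \<tau> i \<omega>))
       = distr M configs N
           \<Otimes>\<^sub>M distr M (count_space UNIV \<Otimes>\<^sub>M (\<Pi>\<^sub>M i\<in>UNIV. borel)) (\<lambda>\<omega>. (K \<omega>, \<lambda>i. x i \<omega>))
           \<Otimes>\<^sub>M (\<Pi>\<^sub>M i\<in>UNIV. unit_exponential)"

text \<open>The left limit \<open>X\<^sub>s\<^sub>-\<close> of a path of configurations. Births and deaths do not move points,
  so the existence of left limits means that inside every bounded set the path is constant
  on some interval \<open>(s - \<epsilon>, s)\<close>.\<close>

definition left_limit :: "(real \<Rightarrow> 'a set) \<Rightarrow> real \<Rightarrow> 'a set" where
  "left_limit \<xi> s = {x. eventually (\<lambda>r. x \<in> \<xi> r) (at_left s)}"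

definition has_left_limits :: "(real \<Rightarrow> 'a::euclidean_space set) \<Rightarrow> bool" where
  "has_left_limits \<xi> \<longleftrightarrow>
     (\<forall>s>0. \<forall>B. bounded B \<longrightarrow> eventually (\<lambda>r. \<xi> r \<inter> B = left_limit \<xi> s \<inter> B) (at_left s))"

text \<open>\<^term>\<open>X\<close> is a birth-and-death process in \<^term>\<open>\<Lambda>\<close> with birth rate \<^term>\<open>b\<close> and unit death
  rate, driven by the point sets \<^term>\<open>N\<close> and \<^term>\<open>\<eta>'\<close>; integrals with respect to the corresponding
  sums of Dirac measures are integrals over \<^term>\<open>count_space (N \<omega>)\<close> and \<^term>\<open>count_space (\<eta>' \<omega>)\<close>.
  Only the marked initial points lying in \<^term>\<open>\<Lambda>\<close> enter, so \<^term>\<open>X\<close> starts from the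
  restriction to \<^term>\<open>\<Lambda>\<close> of the initial configuration.\<close>

definition birth_death_process ::
  "'w measure \<Rightarrow> ('w \<Rightarrow> ('a::euclidean_space \<times> real \<times> real \<times> real) set) \<Rightarrow> ('w \<Rightarrow> ('a \<times> real) set) \<Rightarrow>
   'a set \<Rightarrow> ('a \<Rightarrow> 'a set \<Rightarrow> real) \<Rightarrow> (real \<Rightarrow> 'w \<Rightarrow> 'a set) \<Rightarrow> bool" where
  "birth_death_process M N \<eta>' \<Lambda> b X \<longleftrightarrow>
     (\<forall>t\<ge>0. X t \<in> M \<rightarrow>\<^sub>M configs_in \<Lambda>) \<and>
     (AE \<omega> in M. has_left_limits (\<lambda>s. X s \<omega>) \<and>
       (\<forall>t\<ge>0. \<forall>B\<in>sets borel. B \<subseteq> \<Lambda> \<longrightarrow>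
         emeasure (count_space UNIV) (X t \<omega> \<inter> B) =
           (\<integral>\<^sup>+(x, u, r, s). indicator (B \<times> {0..} \<times> {0..} \<times> {0..t}) (x, u, r, s)
               * indicator {0..b x (left_limit (\<lambda>s. X s \<omega>) s)} u
               * indicator {t - s<..} r \<partial>count_space (N \<omega>))
         + (\<integral>\<^sup>+(x, r). indicator (B \<times> {0..}) (x, r) * indicator {t<..} r
               \<partial>count_space (\<eta>' \<omega>))))"

end

theory Submission
  imports Defs
begin

text \<open>Both processes are driven by the same noise, and all birth rates are at most 1. The rate at \<open>x\<close>
  only depends on the configuration in the ball of radius \<open>2R\<close> around \<open>x\<close>, and the local rate agrees
  with the global one if that ball lies in the window \<open>\<Lambda>'\<close>. Hence a discrepancy at time \<open>t\<close> can be
  traced back along a chain of points of the driving Poisson process, with decreasing birth times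
  and steps shorter than \<open>2R\<close>, to a birth within distance \<open>2R\<close> of the complement of \<open>\<Lambda>'\<close>.
  Dividing the window into cells of diameter 1 and time into \<open>m\<close> slabs, the expected number of chains
  of occupied cells with strictly decreasing slab indices is bounded uniformly in \<open>m\<close>, and as \<open>m\<close>
  grows every actual chain eventually becomes such a chain of cells. This gives the bound
  \<open>C |\<Lambda>| exp (- \<theta> dist)\<close> for every rate \<open>\<theta>\<close>. The event of having such chains only depends on the Poisson
  process and is therefore independent of the initial configuration, so that in (2) a first moment of
  \<open>\<mu>\<close> suffices; there \<open>\<theta>\<close> is chosen larger than the bound on \<open>log |\<Lambda>| / dist\<close>.\<close>

section \<open>Configurations\<close>

text \<open>The Poisson hypothesis speaks only of counts in finitely many disjoint bounded sets, so
  chains of actual points cannot be summed over directly, whereas chains in a finite grid of boxes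
  can. Strict decrease of the slab indices makes the boxes of a chain distinct, and hence the
  probability that all are occupied is at most the product of their intensities. Lifetimes are
  unbounded, which forces a cutoff at \<open>m\<close> in the boxes as well; the lifetime law has
  mass one, so the estimates do not depend on that cutoff. Decay in the distance comes from an
  exponential weight: one step of a chain loses at most the factor
  \<open>exp (\<theta> * reach)\<close>, while the expected number of births reachable within one
  slab is of order \<open>t / m\<close>. Summing over chains gives
  \<open>(1 + t / m * growth) ^ m\<close>, which is at most \<open>exp (t * growth)\<close>. In (2)
  the remaining obstacle is that births are correlated with the exceptional event; their second
  moment, supplied by the Poisson process, controls this.\<close>

lemma space_configs: "space configs = {\<eta>. locally_finite \<eta>}"
  unfolding configs_def by (rule space_measure_of) auto

lemma space_configs_in: "space (configs_in \<Lambda>) = {\<eta>. locally_finite \<eta> \<and> \<eta> \<subseteq> \<Lambda>}"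
  by (auto simp: configs_in_def space_restrict_space space_configs)

lemma measurable_configs_in: "g \<in> M \<rightarrow>\<^sub>M configs_in \<Lambda> \<Longrightarrow> g \<in> M \<rightarrow>\<^sub>M configs"
  unfolding configs_in_def by (simp add: measurable_restrict_space2_iff)

lemma bounded_borel_Int: "bounded_borel A \<Longrightarrow> B \<in> sets borel \<Longrightarrow> bounded_borel (A \<inter> B)"
  unfolding bounded_borel_def by (auto intro: bounded_subset)

lemma card_eq_sets:
  assumes "bounded_borel A"
  shows "{\<eta> \<in> space configs. card (\<eta> \<inter> A) = k} \<in> sets configs"
proof -
  have "{\<eta>. locally_finite \<eta> \<and> card (\<eta> \<inter> A) = k} \<in> sets configs"
    unfolding configs_def using assms by (subst sets_measure_of) (auto intro!: sigma_sets.Basic)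
  then show ?thesis by (simp add: space_configs)
qed

lemma measurable_card:
  assumes "bounded_borel A"
  shows "(\<lambda>\<eta>. card (\<eta> \<inter> A)) \<in> configs \<rightarrow>\<^sub>M count_space UNIV"
proof (subst measurable_count_space_eq2_countable)
  show "(\<lambda>\<eta>. card (\<eta> \<inter> A)) \<in> space configs \<rightarrow> UNIV \<and>
    (\<forall>a\<in>UNIV. (\<lambda>\<eta>. card (\<eta> \<inter> A)) -` {a} \<inter> space configs \<in> sets configs)"
    using card_eq_sets[OF assms] by (auto simp: vimage_def Int_def conj_commute)
qed

lemma finite_config_Int:
  "\<eta> \<in> space configs \<Longrightarrow> bounded_borel A \<Longrightarrow> finite (\<eta> \<inter> A)"
  by (auto simp: space_configs locally_finite_def bounded_borel_def)

lemma hit_sets: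
  assumes "bounded_borel A"
  shows "{\<eta> \<in> space configs. \<eta> \<inter> A \<noteq> {}} \<in> sets configs"
proof -
  have "{\<eta> \<in> space configs. \<eta> \<inter> A \<noteq> {}} = space configs - {\<eta> \<in> space configs. card (\<eta> \<inter> A) = 0}"
    using finite_config_Int[OF _ assms] by auto
  then show ?thesis using card_eq_sets[OF assms, of 0] by auto
qed

lemma card_translate_Int:
  fixes v :: "'a::euclidean_space"
  shows "card ((\<lambda>x. x + v) ` \<eta> \<inter> A) = card (\<eta> \<inter> (\<lambda>x. x - v) ` A)"
proof -
  have "(\<lambda>x. x + v) ` \<eta> \<inter> A = (\<lambda>x. x + v) ` (\<eta> \<inter> (\<lambda>x. x - v) ` A)"
    by (force simp: image_iff)
  moreover have "inj_on (\<lambda>x. x + v) (\<eta> \<inter> (\<lambda>x. x - v) ` A)" by (simp add: inj_on_def)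
  ultimately show ?thesis by (simp add: card_image)
qed

lemma bounded_borel_translate:
  fixes v :: "'a::euclidean_space"
  assumes "bounded_borel A"
  shows "bounded_borel ((\<lambda>x. x - v) ` A)"
proof -
  have "(\<lambda>x. x - v) ` A = (\<lambda>x. x + v) -` A \<inter> space borel"
    by (force simp: image_iff)
  moreover have "(\<lambda>x. x + v) -` A \<inter> space borel \<in> sets borel"
    using assms by (intro measurable_sets) (auto simp: bounded_borel_def)
  moreover have "bounded ((\<lambda>x. x - v) ` A)"
    using bounded_translation[of A "- v"] assms by (simp add: bounded_borel_def)
  ultimately show ?thesis by (simp add: bounded_borel_def)
qed

lemma locally_finite_translate:
  fixes v :: "'a::euclidean_space"
  assumes "locally_finite \<eta>"
  shows "locally_finite ((\<lambda>x. x + v) ` \<eta>)"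
  unfolding locally_finite_def
proof (intro allI impI)
  fix B :: "'a set" assume "bounded B"
  then have "bounded ((\<lambda>x. x - v) ` B)"
    using bounded_translation[of B "- v"] by simp
  then have "finite (\<eta> \<inter> (\<lambda>x. x - v) ` B)" using assms by (simp add: locally_finite_def)
  moreover have "(\<lambda>x. x + v) ` \<eta> \<inter> B = (\<lambda>x. x + v) ` (\<eta> \<inter> (\<lambda>x. x - v) ` B)"
    by (force simp: image_iff)
  ultimately show "finite ((\<lambda>x. x + v) ` \<eta> \<inter> B)" by simp
qed

lemma measurable_translate:
  fixes v :: "'a::euclidean_space"
  shows "(\<lambda>\<eta>. (\<lambda>x. x + v) ` \<eta>) \<in> configs \<rightarrow>\<^sub>M configs"
proof -
  have "(\<lambda>\<eta>. (\<lambda>x. x + v) ` \<eta>) \<in> configs \<rightarrow>\<^sub>M sigma {\<eta>. locally_finite \<eta>}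
     {{\<eta>. locally_finite \<eta> \<and> card (\<eta> \<inter> \<Lambda>) = k} | \<Lambda> k. bounded_borel \<Lambda>}"
  proof (rule measurable_measure_of)
    show "(\<lambda>\<eta>. (\<lambda>x. x + v) ` \<eta>) \<in> space configs \<rightarrow> {\<eta>. locally_finite \<eta>}"
      by (auto simp: space_configs locally_finite_translate)
    fix Y :: "'a set set" assume "Y \<in> {{\<eta>. locally_finite \<eta> \<and> card (\<eta> \<inter> \<Lambda>) = k} | \<Lambda> k. bounded_borel \<Lambda>}"
    then obtain A k where A: "bounded_borel A" and Y: "Y = {\<eta>. locally_finite \<eta> \<and> card (\<eta> \<inter> A) = k}" by blast
    have "(\<lambda>\<eta>. (\<lambda>x. x + v) ` \<eta>) -` Y \<inter> space configs
        = {\<eta> \<in> space configs. card (\<eta> \<inter> (\<lambda>x. x - v) ` A) = k}"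
      by (auto simp: Y space_configs locally_finite_translate card_translate_Int)
    then show "(\<lambda>\<eta>. (\<lambda>x. x + v) ` \<eta>) -` Y \<inter> space configs \<in> sets configs"
      using card_eq_sets[OF bounded_borel_translate[OF A]] by simp
  qed auto
  then show ?thesis by (simp add: configs_def)
qed

section \<open>Range and size of the birth rates\<close>

lemma bounded_centred_box: "bounded (centred_box n)"
proof -
  have "centred_box n \<subseteq> cbox ((- (real n / 2)) *\<^sub>R One) ((real n / 2) *\<^sub>R One)"
    by (auto simp: centred_box_def mem_box) (metis less_imp_le)
  then show ?thesis using bounded_cbox bounded_subset by blast
qed

text \<open>A ball of radius \<open>R\<close> around \<open>y\<close> can meet
  \<open>ball x R\<close> only if \<open>y\<close> is within \<open>2 * R\<close> of
  \<open>x\<close>. The increment of the energy is the newly covered volume and sees only those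
  points.\<close>

lemma energy_insert:
  assumes "finite A"
  shows "energy R (insert x A) - energy R A
    = measure lborel (ball x R - (\<Union>y\<in>A \<inter> ball x (2 * R). ball y R))"
proof -
  let ?U = "\<Union>y\<in>A. ball y R"
  have U: "?U \<in> fmeasurable lborel"
    using assms by (intro fmeasurable.finite_UN) (auto simp: fmeasurable_def emeasure_lborel_ball_finite[unfolded infinity_ennreal_def])
  have B: "ball x R \<in> fmeasurable lborel" by (auto simp: fmeasurable_def emeasure_lborel_ball_finite[unfolded infinity_ennreal_def])
  have "ball x R - ?U = ball x R - (\<Union>y\<in>A \<inter> ball x (2 * R). ball y R)"
  proof -
    have "y \<in> ball x (2 * R)" if "z \<in> ball y R" "z \<in> ball x R" for y z
      using that dist_triangle[of x y z] by (simp add: dist_commute)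
    then show ?thesis by blast
  qed
  moreover have "measure lborel (?U \<union> ball x R) = measure lborel ?U + measure lborel (ball x R - ?U)"
    by (rule measure_Un2[OF U B])
  ultimately show ?thesis by (simp add: energy_def Un_commute)
qed

text \<open>The limit is attained: as soon as the box contains \<open>ball x (2 * R)\<close>,
  enlarging it no longer changes the increment. Both the finite range of the rates and the sign of
  the cost are read off from this formula.\<close>

lemma add_cost_eq:
  assumes "locally_finite \<eta>"
  shows "add_cost R x \<eta> = measure lborel (ball x R - (\<Union>y\<in>\<eta> \<inter> ball x (2 * R). ball y R))"
proof -
  have "\<forall>\<^sub>F n in sequentially. ball x (2 * R) \<subseteq> centred_box n"
  proof -
    obtain n0 :: nat where n0: "2 * (norm x + 2 * R) < real n0" using reals_Archimedean2 by blast
    have "ball x (2 * R) \<subseteq> centred_box n" if "n \<ge> n0" for n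
    proof
      fix y assume "y \<in> ball x (2 * R)"
      then have y: "dist x y < 2 * R" by simp
      have "norm y \<le> norm x + dist x y" by (metis dist_commute dist_norm norm_triangle_sub)
      then have ny: "norm y < real n / 2" using n0 that y of_nat_mono[OF that, where 'a = real] by simp
      show "y \<in> centred_box n" unfolding centred_box_def
      proof (intro CollectI ballI)
        fix i :: 'a assume "i \<in> Basis"
        then have "\<bar>y \<bullet> i\<bar> < real n / 2" using Basis_le_norm[of i y] ny by simp
        then show "- real n / 2 \<le> y \<bullet> i \<and> y \<bullet> i < real n / 2" by linarith
      qed
    qed
    then show ?thesis by (auto simp: eventually_sequentially)
  qed
  then have "\<forall>\<^sub>F n in sequentially. energy R (insert x (\<eta> \<inter> centred_box n)) - energy R (\<eta> \<inter> centred_box n)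
      = measure lborel (ball x R - (\<Union>y\<in>\<eta> \<inter> ball x (2 * R). ball y R))"
  proof eventually_elim
    case (elim n)
    have "finite (\<eta> \<inter> centred_box n)"
      using assms bounded_centred_box by (auto simp: locally_finite_def)
    moreover have "\<eta> \<inter> centred_box n \<inter> ball x (2 * R) = \<eta> \<inter> ball x (2 * R)" using elim by auto
    ultimately show ?case by (simp add: energy_insert)
  qed
  then show ?thesis unfolding add_cost_def by (intro limI tendsto_eventually)
qed

text \<open>The cost is a volume, hence nonnegative. This bound confines the acceptance marks
  \<open>u\<close> of possible births to \<open>{0..1}\<close>, a set of finite intensity.\<close>

lemma birth_rate_le_1: "locally_finite \<eta> \<Longrightarrow> birth_rate R x \<eta> \<le> 1"
  by (simp add: birth_rate_def add_cost_eq)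

lemma birth_rate_local:
  assumes "locally_finite \<eta>" "locally_finite \<xi>" "\<eta> \<inter> ball x (2 * R) = \<xi> \<inter> ball x (2 * R)"
  shows "birth_rate R x \<eta> = birth_rate R x \<xi>"
  using assms by (simp add: birth_rate_def add_cost_eq)

lemma locally_finite_Un: "locally_finite \<eta> \<Longrightarrow> locally_finite \<xi> \<Longrightarrow> locally_finite (\<eta> \<union> \<xi>)"
  by (simp add: locally_finite_def Int_Un_distrib2)

context
  fixes \<nu> :: "'a::euclidean_space set measure" and \<Lambda> \<kappa> \<eta>
  assumes \<kappa>: "conditional_law \<nu> \<Lambda> \<kappa>" and \<eta>: "locally_finite \<eta>" "\<eta> \<subseteq> \<Lambda>"
begin

lemma conditional_law_prob_space: "prob_space (\<kappa> \<eta>)"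
  and space_conditional_law: "space (\<kappa> \<eta>) = {\<zeta>. locally_finite \<zeta> \<and> \<zeta> \<subseteq> - \<Lambda>}"
proof -
  have "\<kappa> \<eta> \<in> space (prob_algebra (configs_in (- \<Lambda>)))"
    using \<kappa> \<eta> by (auto simp: conditional_law_def space_configs_in dest: measurable_space)
  then have "prob_space (\<kappa> \<eta>)" "sets (\<kappa> \<eta>) = sets (configs_in (- \<Lambda>))"
    by (auto simp: space_prob_algebra)
  then show "prob_space (\<kappa> \<eta>)" "space (\<kappa> \<eta>) = {\<zeta>. locally_finite \<zeta> \<and> \<zeta> \<subseteq> - \<Lambda>}"
    by (auto simp: space_configs_in dest!: sets_eq_imp_space_eq)
qed

lemma local_birth_rate_le_1: "local_birth_rate R \<kappa> x \<eta> \<le> 1"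
\<comment> \<open>The split avoids a measurability proof for the integrand: a Bochner integral that
  does not exist has the value 0, which is at most 1.\<close>
proof (cases "integrable (\<kappa> \<eta>) (\<lambda>\<zeta>. birth_rate R x (\<eta> \<union> \<zeta>))")
  case True
  interpret prob_space "\<kappa> \<eta>" by (rule conditional_law_prob_space)
  show ?thesis unfolding local_birth_rate_def
    using True \<eta> by (intro integral_le_const)
      (auto intro!: AE_I2 birth_rate_le_1 locally_finite_Un simp: space_conditional_law)
qed (simp add: local_birth_rate_def not_integrable_integral_eq)

text \<open>The conditional law only adds points outside \<Lambda>, and these are out of range of
  \<open>x\<close>; the integrand is therefore constant under a probability measure.\<close>

lemma local_birth_rate_eq:
  assumes "ball x (2 * R) \<subseteq> \<Lambda>"
  shows "local_birth_rate R \<kappa> x \<eta> = birth_rate R x \<eta>"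
proof -
  interpret prob_space "\<kappa> \<eta>" by (rule conditional_law_prob_space)
  have "local_birth_rate R \<kappa> x \<eta> = (\<integral>\<zeta>. birth_rate R x \<eta> \<partial>\<kappa> \<eta>)"
    unfolding local_birth_rate_def
  proof (intro Bochner_Integration.integral_cong refl)
    fix \<zeta> assume "\<zeta> \<in> space (\<kappa> \<eta>)"
    then show "birth_rate R x (\<eta> \<union> \<zeta>) = birth_rate R x \<eta>"
      using assms \<eta> by (intro birth_rate_local locally_finite_Un) (auto simp: space_conditional_law)
  qed
  then show ?thesis by (simp add: prob_space)
qed

end

section \<open>Poisson processes\<close>

text \<open>The void probability is \<open>exp (- l)\<close> with \<open>l\<close> the intensity of
  \<open>A\<close>, and \<open>1 - exp (- l)\<close> is at most \<open>l\<close>.\<close>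

lemma poisson_process_prob_hit:
  assumes "poisson_process M N J" "bounded_borel A"
  shows "measure M {\<omega> \<in> space M. N \<omega> \<inter> A \<noteq> {}} \<le> measure J A"
proof -
  interpret prob_space M using assms by (simp add: poisson_process_def)
  have N[measurable]: "N \<in> M \<rightarrow>\<^sub>M configs" using assms by (simp add: poisson_process_def)
  have ev: "{\<omega> \<in> space M. card (N \<omega> \<inter> A) = 0} \<in> sets M"
    using measurable_compose[OF N measurable_card[OF assms(2)]] by measurable
  have "{\<omega> \<in> space M. N \<omega> \<inter> A \<noteq> {}} = space M - {\<omega> \<in> space M. card (N \<omega> \<inter> A) = 0}"
    using finite_config_Int[OF _ assms(2)] measurable_space[OF N] by auto
  then have "measure M {\<omega> \<in> space M. N \<omega> \<inter> A \<noteq> {}} = 1 - measure M {\<omega> \<in> space M. card (N \<omega> \<inter> A) = 0}"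
    using prob_compl[OF ev] by simp
  also have "\<dots> = 1 - exp (- measure J A)"
    using assms by (simp add: poisson_process_def)
  also have "\<dots> \<le> measure J A" using exp_ge_add_one_self[of "- measure J A"] by simp
  finally show ?thesis .
qed

lemma poisson_process_prob_all_hit:
  fixes S :: "'v::countable \<Rightarrow> 'b::euclidean_space set"
  assumes P: "poisson_process M N J" and "finite V"
    and S: "\<And>v. v \<in> V \<Longrightarrow> bounded_borel (S v)" and "disjoint_family_on S V"
  shows "measure M {\<omega> \<in> space M. \<forall>v\<in>V. N \<omega> \<inter> S v \<noteq> {}} \<le> (\<Prod>v\<in>V. measure J (S v))"
\<comment> \<open>The product formula for independent variables requires a nonempty index set; for
  empty \<open>V\<close> both sides are 1.\<close>
proof (cases "V = {}")
  case True
  interpret prob_space M using P by (simp add: poisson_process_def)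
  show ?thesis using True by (simp add: prob_space)
next
  case False
  interpret prob_space M using P by (simp add: poisson_process_def)
  have N: "N \<in> M \<rightarrow>\<^sub>M configs" using P by (simp add: poisson_process_def)
  \<comment> \<open>\<open>poisson_process\<close> states independence for families indexed by
    natural numbers, so the countable index type is transported along \<open>to_nat\<close>.\<close>
  let ?A = "\<lambda>n. S (from_nat n)" and ?I = "to_nat ` V"
  let ?X = "\<lambda>i \<omega>. card (N \<omega> \<inter> ?A i)"
  have "disjoint_family_on ?A ?I"
    using assms(4) by (auto simp: disjoint_family_on_def)
  then have ind: "indep_vars (\<lambda>_. count_space UNIV) ?X ?I"
    using P S \<open>finite V\<close> unfolding poisson_process_def by auto
  have hit: "?X (to_nat v) -` (- {0}) \<inter> space M = {\<omega> \<in> space M. N \<omega> \<inter> S v \<noteq> {}}" if "v \<in> V" for v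
    using finite_config_Int[OF _ S[OF that]] measurable_space[OF N] by auto
  have "{\<omega> \<in> space M. \<forall>v\<in>V. N \<omega> \<inter> S v \<noteq> {}} = (\<Inter>i\<in>?I. ?X i -` (- {0}) \<inter> space M)"
  proof -
    have "(\<Inter>i\<in>?I. ?X i -` (- {0}) \<inter> space M) = (\<Inter>v\<in>V. ?X (to_nat v) -` (- {0}) \<inter> space M)"
      by (simp only: INF_image o_def)
    also have "\<dots> = (\<Inter>v\<in>V. {\<omega> \<in> space M. N \<omega> \<inter> S v \<noteq> {}})"
      by (intro INF_cong refl hit)
    finally show ?thesis using False by auto
  qed
  then have "measure M {\<omega> \<in> space M. \<forall>v\<in>V. N \<omega> \<inter> S v \<noteq> {}} = (\<Prod>i\<in>?I. prob (?X i -` (- {0}) \<inter> space M))"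
    using indep_varsD_finite[OF ind, of "\<lambda>_. - {0}"] False \<open>finite V\<close> by simp
  also have "\<dots> = (\<Prod>v\<in>V. prob {\<omega> \<in> space M. N \<omega> \<inter> S v \<noteq> {}})"
    using hit by (subst prod.reindex) auto
  also have "\<dots> \<le> (\<Prod>v\<in>V. measure J (S v))"
    using poisson_process_prob_hit[OF P S] by (intro prod_mono) auto
  finally show ?thesis .
qed

text \<open>Cancelling one factor \<open>k\<close> against the factorial and shifting the index
  gives \<open>l * exp l\<close> for the series weighted by \<open>k\<close>; the same shift once
  more, with \<open>(k + 1)\<close> split into \<open>k\<close> and \<open>1\<close>, gives the
  series weighted by the square.\<close>

lemma poisson_second_moment_sums:
  fixes l :: real
  shows "(\<lambda>k. (real k)\<^sup>2 * (l ^ k / fact k * exp (- l))) sums (l + l\<^sup>2)"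
proof -
  have e: "(\<lambda>k. l ^ k / fact k) sums exp l"
    using exp_converges[of l] by (simp add: field_simps)
  have shift: "real (Suc k) * (l ^ Suc k / fact (Suc k)) = l * (l ^ k / fact k)" for k
    by (simp add: fact_Suc del: of_nat_Suc)
  have "(\<lambda>k. real (Suc k) * (l ^ Suc k / fact (Suc k))) sums (l * exp l)"
    using sums_mult[OF e, of l] by (simp only: shift)
  then have f: "(\<lambda>k. real k * (l ^ k / fact k)) sums (l * exp l)"
    using sums_Suc[of "\<lambda>k. real k * (l ^ k / fact k)"] by simp
  have "(\<lambda>k. (real (Suc k))\<^sup>2 * (l ^ Suc k / fact (Suc k))) sums (l * (l * exp l + exp l))"
  proof -
    have gen: "(1 + real k) * (l * z) = l * (real k * z + z)" for k z by (simp add: algebra_simps)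
    have "(real (Suc k))\<^sup>2 * (l ^ Suc k / fact (Suc k)) = l * (real k * (l ^ k / fact k) + l ^ k / fact k)" for k
      unfolding power2_eq_square mult.assoc shift by (simp only: of_nat_Suc gen)
    then show ?thesis using sums_mult[OF sums_add[OF f e], of l] by (simp only:)
  qed
  then have "(\<lambda>k. (real k)\<^sup>2 * (l ^ k / fact k)) sums (l * (l * exp l + exp l))"
    using sums_Suc[of "\<lambda>k. (real k)\<^sup>2 * (l ^ k / fact k)"] by simp
  from sums_mult2[OF this, of "exp (- l)"] show ?thesis
    by (simp add: field_simps power2_eq_square flip: exp_add)
qed

lemma poisson_process_second_moment:
  assumes P: "poisson_process M N J" and A: "bounded_borel A"
  shows "(\<integral>\<^sup>+\<omega>. (of_nat (card (N \<omega> \<inter> A)))\<^sup>2 \<partial>M) = ennreal (measure J A + (measure J A)\<^sup>2)"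
proof -
  interpret prob_space M using P by (simp add: poisson_process_def)
  have N: "N \<in> M \<rightarrow>\<^sub>M configs" using P by (simp add: poisson_process_def)
  let ?E = "\<lambda>k. {\<omega> \<in> space M. card (N \<omega> \<inter> A) = k}" and ?l = "measure J A"
  have E: "?E k \<in> sets M" for k
    using measurable_compose[OF N measurable_card[OF A]] by measurable
  have "(\<integral>\<^sup>+\<omega>. (of_nat (card (N \<omega> \<inter> A)))\<^sup>2 \<partial>M) = (\<integral>\<^sup>+\<omega>. (\<Sum>k. (of_nat k)\<^sup>2 * indicator (?E k) \<omega>) \<partial>M)"
  proof (rule nn_integral_cong)
    fix \<omega> assume "\<omega> \<in> space M"
    then have "(\<lambda>k. (of_nat k)\<^sup>2 * indicator (?E k) \<omega> :: ennreal)
        = (\<lambda>k. if k = card (N \<omega> \<inter> A) then (of_nat k)\<^sup>2 else 0)" by (auto simp: indicator_def)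
    moreover have "(\<lambda>k. if k = card (N \<omega> \<inter> A) then (of_nat k)\<^sup>2 else 0 :: ennreal) sums (of_nat (card (N \<omega> \<inter> A)))\<^sup>2"
      using sums_single[of "card (N \<omega> \<inter> A)" "\<lambda>k. (of_nat k)\<^sup>2 :: ennreal"] by simp
    ultimately show "(of_nat (card (N \<omega> \<inter> A)))\<^sup>2 = (\<Sum>k. (of_nat k)\<^sup>2 * indicator (?E k) \<omega> :: ennreal)"
      by (metis sums_unique)
  qed
  also have "\<dots> = (\<Sum>k. (of_nat k)\<^sup>2 * emeasure M (?E k))"
    using E by (subst nn_integral_suminf) (auto simp: nn_integral_cmult_indicator)
  also have "\<dots> = (\<Sum>k. ennreal ((real k)\<^sup>2 * (?l ^ k / fact k * exp (- ?l))))"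
  proof (rule suminf_cong)
    fix k
    have "emeasure M (?E k) = ennreal (?l ^ k / fact k * exp (- ?l))"
      using P A by (simp add: emeasure_eq_measure poisson_process_def)
    moreover have "(of_nat k :: ennreal)\<^sup>2 = ennreal ((real k)\<^sup>2)"
      by (simp add: ennreal_of_nat_eq_real_of_nat ennreal_power)
    ultimately show "(of_nat k)\<^sup>2 * emeasure M (?E k) = ennreal ((real k)\<^sup>2 * (?l ^ k / fact k * exp (- ?l)))"
      by (simp only: ennreal_mult'[symmetric] zero_le_power2)
  qed
  also have "\<dots> = ennreal (?l + ?l\<^sup>2)"
    by (rule suminf_ennreal_eq[OF _ poisson_second_moment_sums]) simp
  finally show ?thesis .
qed

section \<open>Intensity of the driving noise and the number of possible births\<close>

lemma sigma_finite_half_line: "sigma_finite_measure (density lborel (indicator {0::real..}))"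
  by (subst sigma_finite_measure.sigma_finite_iff_density_finite'[OF sigma_finite_lborel]) (auto simp: indicator_def)

lemma prob_space_unit_exponential: "prob_space unit_exponential"
  unfolding unit_exponential_def by (rule prob_space_exponential_density) simp

lemma emeasure_driving_intensity:
  fixes B :: "'a::euclidean_space set"
  assumes [measurable]: "B \<in> sets borel" "U \<in> sets borel" "E \<in> sets borel" "T \<in> sets borel"
  shows "emeasure driving_intensity (B \<times> U \<times> E \<times> T)
    = emeasure lborel B * (emeasure lborel ({0..} \<inter> U) * (emeasure unit_exponential E * emeasure lborel ({0..} \<inter> T)))"
proof -
  let ?h = "density lborel (indicator {0::real..})"
  interpret e: prob_space unit_exponential by (rule prob_space_unit_exponential)
  interpret h: sigma_finite_measure ?h by (rule sigma_finite_half_line)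
  interpret eh: pair_sigma_finite unit_exponential ?h ..
  have 1: "sigma_finite_measure (unit_exponential \<Otimes>\<^sub>M ?h)"
    by (rule sigma_finite_pair_measure) unfold_locales
  have 2: "sigma_finite_measure (?h \<Otimes>\<^sub>M unit_exponential \<Otimes>\<^sub>M ?h)"
    by (rule sigma_finite_pair_measure[OF _ 1]) unfold_locales
  have [simp]: "E \<in> sets unit_exponential" by (simp add: unit_exponential_def assms)
  have h: "emeasure ?h Y = emeasure lborel ({0..} \<inter> Y)" if "Y \<in> sets borel" for Y
    using that by (simp add: emeasure_density nn_integral_indicator flip: indicator_inter_arith)
  show ?thesis unfolding driving_intensity_def
    using assms h 1 2
    by (simp add: sigma_finite_measure.emeasure_pair_measure_Times h.emeasure_pair_measure_Times)
qed

lemma bounded_borel_box: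
  fixes B :: "'a::euclidean_space set"
  assumes "bounded_borel B" "bounded_borel U" "bounded_borel E" "bounded_borel T"
  shows "bounded_borel (B \<times> U \<times> E \<times> T)"
  using assms by (auto simp: bounded_borel_def intro!: bounded_Times borel_Times)

lemma bounded_borel_interval [simp]:
  "bounded_borel {a..b::real}" "bounded_borel {a<..b::real}"
  by (auto simp: bounded_borel_def bounded_closed_interval intro: bounded_subset[OF bounded_closed_interval[of a b]])

lemma emeasure_lborel_bounded_borel:
  "bounded_borel B \<Longrightarrow> emeasure lborel B = ennreal (measure lborel B)"
  using emeasure_bounded_finite[of B] by (intro emeasure_eq_ennreal_measure) (auto simp: bounded_borel_def)

text \<open>The acceptance factor has length 1 and the lifetime factor is a probability, so only
  volume times duration remains. The bound does not involve \<open>E\<close>, and any truncation of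
  lifetimes is free.\<close>

lemma measure_driving_intensity_le:
  fixes B :: "'a::euclidean_space set"
  assumes B: "bounded_borel B" and E: "E \<in> sets borel" and T: "T \<in> sets borel"
    and l: "emeasure lborel ({0..} \<inter> T) \<le> ennreal l" and "0 \<le> l"
  shows "measure driving_intensity (B \<times> {0..1} \<times> E \<times> T) \<le> measure lborel B * l"
proof -
  interpret e: prob_space unit_exponential by (rule prob_space_unit_exponential)
  have "{0..} \<inter> {0..1::real} = {0..1}" by auto
  then have "emeasure driving_intensity (B \<times> {0..1} \<times> E \<times> T)
      = emeasure lborel B * (emeasure unit_exponential E * emeasure lborel ({0..} \<inter> T))"
    using B E T by (subst emeasure_driving_intensity) (auto simp: bounded_borel_def)
  also have "\<dots> \<le> emeasure lborel B * (1 * ennreal l)"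
    using l e.emeasure_le_1[of E] by (intro mult_left_mono mult_mono) auto
  also have "\<dots> = ennreal (measure lborel B * l)"
    using \<open>0 \<le> l\<close> by (simp add: emeasure_lborel_bounded_borel[OF B] ennreal_mult)
  finally show ?thesis
    unfolding measure_def using \<open>0 \<le> l\<close> by (intro enn2real_leI) auto
qed

text \<open>All points of the noise that can cause a birth in \<open>B\<close> up to time
  \<open>t\<close> when the rates are at most 1.\<close>

definition birth_window :: "'a::euclidean_space set \<Rightarrow> real \<Rightarrow> ('a \<times> real \<times> real \<times> real) set" where
  "birth_window B t = B \<times> {0..1::real} \<times> {0..} \<times> {0..t}"

text \<open>The value is extended because \<open>birth_window\<close> is unbounded in the lifetime
  coordinate: a locally finite configuration may have infinitely many points there, and finiteness
  holds only almost surely.\<close>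

definition birth_count :: "'a::euclidean_space set \<Rightarrow> real \<Rightarrow> ('a \<times> real \<times> real \<times> real) set \<Rightarrow> ennreal" where
  "birth_count B t P = emeasure (count_space UNIV) (P \<inter> birth_window B t)"

text \<open>Truncating the lifetimes at \<open>n\<close> gives bounded boxes, on which counts are
  finite and measurable. If the whole count is finite, the lifetimes that occur are bounded and some
  truncation already captures everything.\<close>

lemma birth_count_eq_SUP:
  assumes B: "bounded_borel B" and P: "P \<in> space configs"
  shows "birth_count B t P = (SUP n. of_nat (card (P \<inter> (B \<times> {0..1::real} \<times> {0..real n} \<times> {0..t}))))"
    and "birth_count B t P < \<infinity> \<Longrightarrow> \<exists>n. P \<inter> birth_window B t = P \<inter> (B \<times> {0..1::real} \<times> {0..real n} \<times> {0..t})"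
proof -
  let ?S = "\<lambda>n. P \<inter> (B \<times> {0..1::real} \<times> {0..real n} \<times> {0..t})"
  have U: "P \<inter> birth_window B t = (\<Union>n. ?S n)"
  proof -
    have "\<exists>n. r \<le> real n" for r by (rule real_arch_simple)
    then show ?thesis by (fastforce simp: birth_window_def)
  qed
  have inc: "incseq ?S" by (fastforce simp: incseq_def)
  have fin: "finite (?S n)" for n
    by (rule finite_config_Int[OF P]) (intro bounded_borel_box B bounded_borel_interval)
  have "birth_count B t P = (SUP n. emeasure (count_space UNIV) (?S n))"
    unfolding birth_count_def U by (rule SUP_emeasure_incseq[symmetric]) (auto simp: inc)
  then show "birth_count B t P = (SUP n. of_nat (card (?S n)))"
    using fin by simp
  assume "birth_count B t P < \<infinity>"
  then have "finite (\<Union>n. ?S n)" by (simp add: birth_count_def U emeasure_count_space less_top split: if_splits)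
  then have "bdd_above ((\<lambda>p. fst (snd (snd p))) ` (\<Union>n. ?S n))" by simp
  then obtain c where c: "fst (snd (snd p)) \<le> c" if "p \<in> (\<Union>n. ?S n)" for p
    unfolding bdd_above_def by (metis imageI)
  obtain n where "c \<le> real n" using real_arch_simple by blast
  with c have "(\<Union>n. ?S n) \<subseteq> ?S n" by fastforce
  then show "\<exists>n. P \<inter> birth_window B t = ?S n" unfolding U by blast
qed

lemma measurable_birth_count:
  assumes B: "bounded_borel B"
  shows "birth_count B t \<in> borel_measurable configs"
proof -
  have "(\<lambda>P. SUP n. of_nat (card (P \<inter> (B \<times> {0..1::real} \<times> {0..real n} \<times> {0..t}))) :: ennreal) \<in> borel_measurable configs"
    by (intro borel_measurable_SUP measurable_compose[OF measurable_card, of _ of_nat] bounded_borel_box B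
        bounded_borel_interval) auto
  then show ?thesis
    by (rule measurable_cong[THEN iffD1, rotated]) (simp add: birth_count_eq_SUP[OF B])
qed

text \<open>For each lifetime truncation the count is Poisson with a parameter at most
  \<open>measure lborel B * t\<close>, uniformly in \<open>n\<close>; monotone convergence removes
  the truncation.\<close>

lemma birth_count_second_moment:
  assumes N: "poisson_process M N driving_intensity" and B: "bounded_borel B" and "0 \<le> t"
  shows "(\<integral>\<^sup>+\<omega>. (birth_count B t (N \<omega>))\<^sup>2 \<partial>M) \<le> ennreal (measure lborel B * t + (measure lborel B * t)\<^sup>2)"
proof -
  let ?S = "\<lambda>n. B \<times> {0..1::real} \<times> {0..real n} \<times> {0..t}"
  let ?f = "\<lambda>n \<omega>. (of_nat (card (N \<omega> \<inter> ?S n)))\<^sup>2 :: ennreal"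
  have bb: "bounded_borel (?S n)" for n by (intro bounded_borel_box B bounded_borel_interval)
  have meas: "N \<in> M \<rightarrow>\<^sub>M configs" using N by (simp add: poisson_process_def)
  have conf: "N \<omega> \<in> space configs" if "\<omega> \<in> space M" for \<omega> using measurable_space[OF meas that] .
  have le: "(birth_count B t (N \<omega>))\<^sup>2 \<le> (SUP n. ?f n \<omega>)" if \<omega>: "\<omega> \<in> space M" for \<omega>
  proof (cases "birth_count B t (N \<omega>) < \<infinity>")
    case True
    then obtain n where n: "N \<omega> \<inter> birth_window B t = N \<omega> \<inter> ?S n"
      using birth_count_eq_SUP(2)[OF B conf[OF \<omega>]] by blast
    have "finite (N \<omega> \<inter> ?S n)" by (rule finite_config_Int[OF conf[OF \<omega>] bb])
    then have "(birth_count B t (N \<omega>))\<^sup>2 = ?f n \<omega>" by (simp add: birth_count_def n)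
    moreover have "?f n \<omega> \<le> (SUP n. ?f n \<omega>)" by (rule SUP_upper) simp
    ultimately show ?thesis by (simp only:)
  next
    case False
    \<comment> \<open>For an infinite count the supremum of the squares is infinite too, because a
      natural number is at most its square.\<close>
    have "birth_count B t (N \<omega>) \<le> (SUP n. ?f n \<omega>)"
      unfolding birth_count_eq_SUP(1)[OF B conf[OF \<omega>]]
    proof (rule SUP_mono)
      fix n
      have "card (N \<omega> \<inter> ?S n) \<le> (card (N \<omega> \<inter> ?S n))\<^sup>2" by (simp add: power2_eq_square)
      then have "(of_nat (card (N \<omega> \<inter> ?S n)) :: ennreal) \<le> of_nat ((card (N \<omega> \<inter> ?S n))\<^sup>2)"
        by (rule of_nat_mono)
      then show "\<exists>m\<in>UNIV. (of_nat (card (N \<omega> \<inter> ?S n)) :: ennreal) \<le> ?f m \<omega>"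
        by auto
    qed
    then show ?thesis using False by (simp add: not_less top_unique)
  qed
  have "(\<integral>\<^sup>+\<omega>. (birth_count B t (N \<omega>))\<^sup>2 \<partial>M) \<le> (\<integral>\<^sup>+\<omega>. (SUP n. ?f n \<omega>) \<partial>M)"
    by (intro nn_integral_mono le)
  also have "\<dots> = (SUP n. \<integral>\<^sup>+\<omega>. ?f n \<omega> \<partial>M)"
  proof (rule nn_integral_monotone_convergence_SUP_AE)
    show "AE \<omega> in M. ?f n \<omega> \<le> ?f (Suc n) \<omega>" for n
    proof (rule AE_I2)
      fix \<omega> assume "\<omega> \<in> space M"
      then have "card (N \<omega> \<inter> ?S n) \<le> card (N \<omega> \<inter> ?S (Suc n))"
        by (intro card_mono finite_config_Int[OF conf bb]) auto
      then have "(of_nat (card (N \<omega> \<inter> ?S n)) :: ennreal) \<le> of_nat (card (N \<omega> \<inter> ?S (Suc n)))"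
        by (rule of_nat_mono)
      then show "?f n \<omega> \<le> ?f (Suc n) \<omega>" by (intro power_mono) auto
    qed
    show "?f n \<in> borel_measurable M" for n
      by (intro measurable_compose[OF measurable_compose[OF meas measurable_card[OF bb]]]) simp
  qed
  also have "\<dots> \<le> ennreal (measure lborel B * t + (measure lborel B * t)\<^sup>2)"
  proof (rule SUP_least)
    fix n
    have "{0..} \<inter> {0..t} = {0..t}" by auto
    then have l: "measure driving_intensity (?S n) \<le> measure lborel B * t"
      using \<open>0 \<le> t\<close> by (intro measure_driving_intensity_le B) auto
    show "(\<integral>\<^sup>+\<omega>. ?f n \<omega> \<partial>M) \<le> ennreal (measure lborel B * t + (measure lborel B * t)\<^sup>2)"
      unfolding poisson_process_second_moment[OF N bb]
      by (intro ennreal_leI add_mono power_mono l) auto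
  qed
  finally show ?thesis .
qed

lemma AE_birth_count_finite:
  assumes N: "poisson_process M N driving_intensity" and B: "bounded_borel B" and t: "0 \<le> t"
  shows "AE \<omega> in M. birth_count B t (N \<omega>) < \<infinity>"
proof -
  have meas: "N \<in> M \<rightarrow>\<^sub>M configs" using N by (simp add: poisson_process_def)
  have [measurable]: "(\<lambda>\<omega>. birth_count B t (N \<omega>)) \<in> borel_measurable M"
    by (rule measurable_compose[OF meas measurable_birth_count[OF B]])
  have "(\<integral>\<^sup>+\<omega>. (birth_count B t (N \<omega>))\<^sup>2 \<partial>M) \<noteq> \<infinity>"
    using birth_count_second_moment[OF assms] by (metis ennreal_less_top infinity_ennreal_def leD)
  then have "AE \<omega> in M. (birth_count B t (N \<omega>))\<^sup>2 \<noteq> \<infinity>"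
    by (intro nn_integral_PInf_AE) auto
  then show ?thesis
    by eventually_elim (auto simp: power_eq_top_ennreal less_top[symmetric])
qed

text \<open>The left limit at time 0 looks at negative times, where the processes are unconstrained,
  so nothing is known about the rates there. The time slice at 0 has intensity zero, hence almost
  surely no such birth occurs; marks \<open>u\<close> and \<open>r\<close> are exhausted by bounded
  boxes.\<close>

lemma AE_no_birth_at_0:
  fixes N :: "'w \<Rightarrow> ('a::euclidean_space \<times> real \<times> real \<times> real) set"
  assumes N: "poisson_process M N driving_intensity" and B: "bounded_borel B"
  shows "AE \<omega> in M. \<forall>y\<in>B. \<forall>u\<ge>0. \<forall>r\<ge>0. (y, u, r, 0) \<notin> N \<omega>"
proof -
  interpret prob_space M using N by (simp add: poisson_process_def)
  have meas: "N \<in> M \<rightarrow>\<^sub>M configs" using N by (simp add: poisson_process_def)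
  let ?S = "\<lambda>n. B \<times> {0..real n} \<times> {0..real n} \<times> {0..0::real}"
  have bb: "bounded_borel (?S n)" for n by (intro bounded_borel_box B bounded_borel_interval)
  have "AE \<omega> in M. N \<omega> \<inter> ?S n = {}" for n
  proof -
    have "emeasure driving_intensity (?S n) = 0"
      using B by (subst emeasure_driving_intensity) (auto simp: bounded_borel_def Int_absorb1)
    then have "measure driving_intensity (?S n) = 0" by (simp add: measure_def)
    then have "measure M {\<omega> \<in> space M. N \<omega> \<inter> ?S n \<noteq> {}} = 0"
      using poisson_process_prob_hit[OF N bb[of n]] measure_nonneg[of M] by (simp add: order_antisym)
    moreover have "{\<omega> \<in> space M. N \<omega> \<inter> ?S n \<noteq> {}} \<in> sets M"
      using measurable_sets[OF meas hit_sets[OF bb[of n]]] measurable_space[OF meas]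
      by (simp add: vimage_def Int_def conj_commute cong: conj_cong)
    ultimately show ?thesis
      by (intro AE_I[of _ _ "{\<omega> \<in> space M. N \<omega> \<inter> ?S n \<noteq> {}}"]) (auto simp: emeasure_eq_measure)
  qed
  then have "AE \<omega> in M. \<forall>n. N \<omega> \<inter> ?S n = {}" by (simp add: AE_all_countable)
  then show ?thesis
  proof eventually_elim
    case (elim \<omega>)
    show ?case
    proof (intro ballI allI impI notI)
      fix u r :: real assume "0 \<le> u" "0 \<le> r"
      fix y assume *: "y \<in> B" "(y, u, r, 0) \<in> N \<omega>"
      obtain n where "max u r \<le> real n" using real_arch_simple by blast
      with * \<open>0 \<le> u\<close> \<open>0 \<le> r\<close> have "(y, u, r, 0) \<in> N \<omega> \<inter> ?S n" by auto
      then show False using elim by blast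
    qed
  qed
qed

section \<open>Percolation in discretised space-time\<close>

text \<open>In \<open>infected occ bd nb j i\<close>, \<open>j\<close> is a time slab and
  \<open>i\<close> a spatial cell. A derivation is a chain of occupied boxes going back in time to a
  cell satisfying \<open>bd\<close>; since \<open>j'\<close> is strictly below \<open>j\<close>, no
  box occurs twice in it.\<close>

inductive infected :: "(nat \<Rightarrow> 'c \<Rightarrow> bool) \<Rightarrow> ('c \<Rightarrow> bool) \<Rightarrow> ('c \<Rightarrow> 'c \<Rightarrow> bool) \<Rightarrow> nat \<Rightarrow> 'c \<Rightarrow> bool"
  for occ bd nb where
  source: "occ j i \<Longrightarrow> bd i \<Longrightarrow> infected occ bd nb j i"
| spread: "occ j i \<Longrightarrow> infected occ bd nb j' i' \<Longrightarrow> j' < j \<Longrightarrow> nb i i' \<Longrightarrow> infected occ bd nb j i"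

lemma infected_iff:
  "infected occ bd nb j i \<longleftrightarrow> occ j i \<and> (bd i \<or> (\<exists>j'<j. \<exists>i'. nb i i' \<and> infected occ bd nb j' i'))"
  by (subst infected.simps) blast

lemma infected_occ: "infected occ bd nb j i \<Longrightarrow> occ j i"
  by (auto elim: infected.cases)

text \<open>Whether a box is infected is determined by its own occupation and by infections in
  earlier slabs, so induction on the slab writes the event as a countable union.\<close>

lemma infected_sets:
  fixes occ :: "'w \<Rightarrow> nat \<Rightarrow> 'c::countable \<Rightarrow> bool"
  assumes occ_sets: "\<And>j i. {\<omega> \<in> space M. occ \<omega> j i} \<in> sets M"
  shows "{\<omega> \<in> space M. infected (occ \<omega>) bd nb j i} \<in> sets M"
proof (induction j arbitrary: i rule: less_induct)
  case (less j)
  have "{\<omega> \<in> space M. infected (occ \<omega>) bd nb j i} = {\<omega> \<in> space M. occ \<omega> j i} \<inter>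
      ({\<omega> \<in> space M. bd i} \<union> (\<Union>j'<j. \<Union>i'\<in>{i'. nb i i'}. {\<omega> \<in> space M. infected (occ \<omega>) bd nb j' i'}))"
    by (subst infected_iff) auto
  also have "\<dots> \<in> sets M"
    using less by (intro sets.Int sets.Un occ_sets sets.countable_UN'') auto
  finally show ?case .
qed

text \<open>\<open>p i\<close> bounds the probability that cell \<open>i\<close> is occupied in any
  one slab. The function \<phi> plays the role of a Lyapunov function: at least 1 on the sources
  and, by \<open>phi_nb\<close>, expanded at most by the factor \<open>w\<close> under one step of
  the chain. It carries the spatial decay, while \<open>w\<close> measures the branching per
  slab.\<close>

locale percolation = prob_space M for M :: "'w measure" +
  fixes q :: nat and occ :: "'w \<Rightarrow> nat \<Rightarrow> nat \<Rightarrow> bool" and p \<phi> :: "nat \<Rightarrow> real" and w :: real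
    and bd :: "nat \<Rightarrow> bool" and nb :: "nat \<Rightarrow> nat \<Rightarrow> bool"
  assumes occ_sets: "{\<omega> \<in> space M. occ \<omega> j i} \<in> sets M"
    and occ_less: "occ \<omega> j i \<Longrightarrow> i < q"
    and occ_prob: "finite V \<Longrightarrow> V \<subseteq> UNIV \<times> {..<q} \<Longrightarrow>
      prob {\<omega> \<in> space M. \<forall>(j, i)\<in>V. occ \<omega> j i} \<le> (\<Prod>(j, i)\<in>V. p i)"
    and p_nonneg: "0 \<le> p i" and w_nonneg: "0 \<le> w" and phi_nonneg: "0 \<le> \<phi> i"
    and phi_bd: "bd i \<Longrightarrow> 1 \<le> \<phi> i"
    and phi_nb: "i < q \<Longrightarrow> (\<Sum>i' | i' < q \<and> nb i i'. p i' * \<phi> i') \<le> w * \<phi> i"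
begin

abbreviation inf :: "'w \<Rightarrow> nat \<Rightarrow> nat \<Rightarrow> bool" where
  "inf \<omega> \<equiv> infected (occ \<omega>) bd nb"

lemma inf_sets: "{\<omega> \<in> space M. inf \<omega> j i} \<in> sets M"
  by (rule infected_sets[OF occ_sets])

lemma occ_all_sets: "finite V \<Longrightarrow> {\<omega> \<in> space M. \<forall>(j, i)\<in>V. occ \<omega> j i} \<in> sets M"
  using occ_sets by (intro sets.sets_Collect_finite_All) auto

text \<open>Infection of an earlier box and occupation of the present one are not treated as
  independent events. Instead \<open>V\<close> records the later boxes already required to be
  occupied; each step back adds one more box to it, and \<open>occ_prob\<close> is applied only when
  a source is reached. Since all of \<open>V\<close> lies strictly after slab \<open>j\<close>, the
  added box is new and contributes its own factor \<open>p i\<close>.\<close>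

lemma prob_occ_infected_le:
  assumes "finite V" "V \<subseteq> {j<..} \<times> {..<q}" "i < q"
  shows "prob {\<omega> \<in> space M. (\<forall>(j, i)\<in>V. occ \<omega> j i) \<and> inf \<omega> j i}
    \<le> (\<Prod>(j, i)\<in>V. p i) * (p i * (\<phi> i * (1 + w) ^ j))"
  using assms
proof (induction j arbitrary: i V rule: less_induct)
  case (less j)
  let ?V = "insert (j, i) V" and ?P = "\<Prod>(j, i)\<in>V. p i"
  have ins: "(\<Prod>(j, i)\<in>?V. p i) = ?P * p i"
    using less.prems by (subst prod.insert) auto
  have P0: "0 \<le> ?P" by (intro prod_nonneg) (auto simp: p_nonneg)
  have pow: "1 \<le> (1 + w) ^ j" using w_nonneg by simp
  show ?case
  proof (cases "bd i")
    case True
    \<comment> \<open>At a source the chain may stop: the product over the enlarged \<open>V\<close>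
      suffices, because both \<phi> at \<open>i\<close> and the power of \<open>1 + w\<close> are at
      least 1.\<close>
    have "prob {\<omega> \<in> space M. (\<forall>(j, i)\<in>V. occ \<omega> j i) \<and> inf \<omega> j i}
        \<le> prob {\<omega> \<in> space M. \<forall>(j, i)\<in>?V. occ \<omega> j i}"
      using less.prems by (intro finite_measure_mono occ_all_sets) (auto dest: infected_occ)
    also have "\<dots> \<le> ?P * (p i * (1 * 1))"
      using occ_prob[of ?V] less.prems unfolding ins by auto
    also have "\<dots> \<le> ?P * (p i * (\<phi> i * (1 + w) ^ j))"
      using P0 pow phi_bd[OF True] p_nonneg[of i] by (intro mult_left_mono mult_mono) auto
    finally show ?thesis .
  next
    case False
    let ?I = "{i'. i' < q \<and> nb i i'}"
    let ?E = "\<lambda>j' i'. {\<omega> \<in> space M. (\<forall>(j, i)\<in>?V. occ \<omega> j i) \<and> inf \<omega> j' i'}"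
    have E: "?E j' i' \<in> sets M" for j' i'
      using sets.Int[OF occ_all_sets[of ?V] inf_sets[of j' i']] less.prems(1)
      by (simp add: Int_def conj_ac)
    have "prob {\<omega> \<in> space M. (\<forall>(j, i)\<in>V. occ \<omega> j i) \<and> inf \<omega> j i} \<le> prob (\<Union>(j', i')\<in>{..<j} \<times> ?I. ?E j' i')"
    proof (rule finite_measure_mono)
      show "{\<omega> \<in> space M. (\<forall>(j, i)\<in>V. occ \<omega> j i) \<and> inf \<omega> j i} \<subseteq> (\<Union>(j', i')\<in>{..<j} \<times> ?I. ?E j' i')"
      proof safe
        fix \<omega> assume \<omega>: "\<omega> \<in> space M" "\<forall>(j, i)\<in>V. occ \<omega> j i" "inf \<omega> j i"
        then obtain j' i' where "j' < j" "nb i i'" "inf \<omega> j' i'" "occ \<omega> j i"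
          using False by (subst (asm) infected_iff) blast
        moreover from this have "i' < q" using infected_occ occ_less by metis
        ultimately show "\<omega> \<in> (\<Union>(j', i')\<in>{..<j} \<times> ?I. ?E j' i')" using \<omega> by auto
      qed
    qed (use E in auto)
    also have "\<dots> \<le> (\<Sum>(j', i')\<in>{..<j} \<times> ?I. prob (?E j' i'))"
      using E by (intro order_trans[OF finite_measure_subadditive_finite]) (auto simp: split_def)
    also have "\<dots> \<le> (\<Sum>(j', i')\<in>{..<j} \<times> ?I. (?P * p i) * (p i' * (\<phi> i' * (1 + w) ^ j')))"
    proof -
      have "prob (?E j' i') \<le> (?P * p i) * (p i' * (\<phi> i' * (1 + w) ^ j'))"
        if "j' < j" "i' < q" for j' i'
      proof -
        have "?V \<subseteq> {j'<..} \<times> {..<q}" using less.prems that by fastforce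
        then show ?thesis
          using less.IH[of j' ?V i'] that less.prems(1) unfolding ins by blast
      qed
      then show ?thesis by (intro sum_mono) auto
    qed
    also have "\<dots> = (?P * p i) * (\<Sum>j'<j. (1 + w) ^ j' * (\<Sum>i'\<in>?I. p i' * \<phi> i'))"
      by (simp add: sum.cartesian_product[symmetric] sum_distrib_left mult_ac)
    also have "\<dots> \<le> (?P * p i) * (\<Sum>j'<j. (1 + w) ^ j' * (w * \<phi> i))"
      using phi_nb less.prems(3) P0 p_nonneg[of i] w_nonneg by (intro mult_left_mono sum_mono) auto
    also have "(\<Sum>j'<j. (1 + w) ^ j' * (w * \<phi> i)) = ((1 + w) ^ j - 1) * \<phi> i"
    proof -
      \<comment> \<open>The geometric sum over all earlier slabs is what makes
        \<open>(1 + w) ^ j\<close> the right growth factor: it reproduces itself up to the discarded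
        \<open>- 1\<close>.\<close>
      have "(1 + w) ^ j - 1 = w * (\<Sum>j'<j. (1 + w) ^ j')"
        using power_diff_1_eq[of "1 + w" j] by simp
      then show ?thesis by (simp add: sum_distrib_right mult_ac sum_distrib_left)
    qed
    also have "(?P * p i) * (((1 + w) ^ j - 1) * \<phi> i) \<le> ?P * (p i * (\<phi> i * (1 + w) ^ j))"
      unfolding mult.assoc using P0 p_nonneg[of i] phi_nonneg[of i]
      by (intro mult_left_mono) (auto simp: algebra_simps)
    finally show ?thesis .
  qed
qed

text \<open>A union bound over the slab and cell at which the chain ends. The factor
  \<open>m\<close> is harmless, since later each \<open>p i\<close> is proportional to
  \<open>t / m\<close>.\<close>

lemma prob_infected_le:
  assumes "I \<subseteq> {..<q}"
  shows "prob {\<omega> \<in> space M. \<exists>j<m. \<exists>i\<in>I. inf \<omega> j i} \<le> real m * (1 + w) ^ m * (\<Sum>i\<in>I. p i * \<phi> i)"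
proof -
  have fin: "finite I" using assms finite_subset by blast
  have "{\<omega> \<in> space M. \<exists>j<m. \<exists>i\<in>I. inf \<omega> j i} = (\<Union>(j, i)\<in>{..<m} \<times> I. {\<omega> \<in> space M. inf \<omega> j i})"
    by auto
  then have "prob {\<omega> \<in> space M. \<exists>j<m. \<exists>i\<in>I. inf \<omega> j i} \<le> (\<Sum>(j, i)\<in>{..<m} \<times> I. prob {\<omega> \<in> space M. inf \<omega> j i})"
    using inf_sets fin by (auto intro!: order_trans[OF finite_measure_subadditive_finite] simp: split_def)
  also have "\<dots> \<le> (\<Sum>(j, i)\<in>{..<m} \<times> I. (1 + w) ^ m * (p i * \<phi> i))"
  proof -
    have "prob {\<omega> \<in> space M. inf \<omega> j i} \<le> (1 + w) ^ m * (p i * \<phi> i)" if "j < m" "i \<in> I" for j i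
    proof -
      have "prob {\<omega> \<in> space M. inf \<omega> j i} \<le> p i * (\<phi> i * (1 + w) ^ j)"
        using prob_occ_infected_le[of "{}" j i] that assms by auto
      also have "\<dots> \<le> p i * (\<phi> i * (1 + w) ^ m)"
        using that p_nonneg phi_nonneg w_nonneg by (intro mult_left_mono power_increasing) auto
      finally show ?thesis by (simp add: mult_ac)
    qed
    then show ?thesis by (intro sum_mono) auto
  qed
  also have "\<dots> = real m * (1 + w) ^ m * (\<Sum>i\<in>I. p i * \<phi> i)"
    by (simp add: sum.cartesian_product[symmetric] sum_distrib_left mult_ac)
  finally show ?thesis .
qed

end

text \<open>Compactness of the closure gives finitely many balls of radius 1/2, hence pieces of
  diameter at most 1; making them disjoint in sequence keeps this. Compatibility with \<Lambda> is
  built in so that the cells inside \<Lambda> add up to at most its volume, with no boundary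
  layer.\<close>

lemma finite_small_partition:
  fixes \<Lambda> \<Lambda>' :: "'a::euclidean_space set"
  assumes "bounded_borel \<Lambda>'" "\<Lambda> \<in> sets borel"
  shows "\<exists>(c :: nat \<Rightarrow> 'a set) q. disjoint_family c \<and> (\<Union>i<q. c i) = \<Lambda>' \<and> (\<forall>i\<ge>q. c i = {}) \<and>
    (\<forall>i. bounded_borel (c i)) \<and> (\<forall>i. \<forall>x\<in>c i. \<forall>y\<in>c i. dist x y \<le> 1) \<and>
    (\<forall>i. c i \<subseteq> \<Lambda> \<or> c i \<inter> \<Lambda> = {})"
proof -
  have cpt: "compact (closure \<Lambda>')" using assms by (simp add: bounded_borel_def compact_closure)
  have op: "open (ball x (1/2))" if "x \<in> closure \<Lambda>'" for x :: 'a by simp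
  have cov: "closure \<Lambda>' \<subseteq> (\<Union>x\<in>closure \<Lambda>'. ball x (1/2))" by force
  obtain k where k: "finite k" "closure \<Lambda>' \<subseteq> (\<Union>x\<in>k. ball x (1/2))"
    using compactE_image[OF cpt op cov] by metis
  obtain xs where xs: "set xs = k" using finite_list[OF k(1)] by blast
  \<comment> \<open>Each ball is listed twice: the even index takes its part inside \<Lambda>, the
    odd index its part outside.\<close>
  define q where "q = 2 * length xs"
  define B where "B n = (if n < q then ball (xs ! (n div 2)) (1/2) \<inter> (if even n then \<Lambda> else - \<Lambda>) \<inter> \<Lambda>' else {})" for n
  let ?c = "disjointed B"
  have sub: "?c i \<subseteq> B i" for i by (rule disjointed_subset)
  have "(\<Union>i. ?c i) = \<Lambda>'"
  proof -
    have "\<exists>n. y \<in> B n" if y: "y \<in> \<Lambda>'" for y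
    proof -
      from y k(2) closure_subset[of \<Lambda>'] obtain x where "x \<in> set xs" "y \<in> ball x (1/2)" unfolding xs by blast
      then obtain i where i: "i < length xs" "y \<in> ball (xs ! i) (1/2)" by (auto simp: in_set_conv_nth)
      have "y \<in> B (2 * i) \<or> y \<in> B (2 * i + 1)"
        using i y by (auto simp: B_def q_def)
      then show ?thesis by blast
    qed
    moreover have "B n \<subseteq> \<Lambda>'" for n by (simp add: B_def)
    ultimately show ?thesis unfolding UN_disjointed_eq by blast
  qed
  moreover have e: "?c i = {}" if "i \<ge> q" for i using sub[of i] that by (simp add: B_def)
  moreover have "i < q" if "y \<in> ?c i" for y i using e[of i] that by (cases "i < q") auto
  ultimately have U: "(\<Union>i<q. ?c i) = \<Lambda>'" by blast
  have "B i \<in> sets borel" for i using assms by (auto simp: B_def bounded_borel_def)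
  then have cs: "?c i \<in> sets borel" for i unfolding disjointed_def by auto
  have "?c i \<subseteq> \<Lambda>'" for i using sub[of i] by (auto simp: B_def split: if_splits)
  then have bb: "bounded_borel (?c i)" for i
    using cs assms by (auto simp: bounded_borel_def intro: bounded_subset)
  have d: "dist x y \<le> 1" if "x \<in> ?c i" "y \<in> ?c i" for i x y
  proof -
    have "dist (xs ! (i div 2)) x < 1/2" "dist (xs ! (i div 2)) y < 1/2"
      using that sub[of i] by (auto simp: B_def split: if_splits)
    then show ?thesis using dist_triangle[of x y "xs ! (i div 2)"] by (simp add: dist_commute)
  qed
  have s: "?c i \<subseteq> \<Lambda> \<or> ?c i \<inter> \<Lambda> = {}" for i using sub[of i] by (auto simp: B_def split: if_splits)
  show ?thesis using disjoint_family_disjointed[of B] U e bb d s by (intro exI[of _ ?c] exI[of _ q]) simp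
qed

section \<open>Tracing discrepancies back in time\<close>

text \<open>The evolution equation for one fixed outcome. It separates the tracing of discrepancies,
  which is deterministic, from all probability.\<close>

definition graphical_solution ::
  "('a::euclidean_space \<times> real \<times> real \<times> real) set \<Rightarrow> ('a \<times> real) set \<Rightarrow> 'a set \<Rightarrow>
   ('a \<Rightarrow> 'a set \<Rightarrow> real) \<Rightarrow> (real \<Rightarrow> 'a set) \<Rightarrow> bool" where
  "graphical_solution P H \<Lambda> b \<xi> \<longleftrightarrow>
     has_left_limits \<xi> \<and>
       (\<forall>t\<ge>0. \<forall>B\<in>sets borel. B \<subseteq> \<Lambda> \<longrightarrow>
         emeasure (count_space UNIV) (\<xi> t \<inter> B) =
           (\<integral>\<^sup>+(x, u, r, s). indicator (B \<times> {0..} \<times> {0..} \<times> {0..t}) (x, u, r, s)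
               * indicator {0..b x (left_limit \<xi> s)} u
               * indicator {t - s<..} r \<partial>count_space P)
         + (\<integral>\<^sup>+(x, r). indicator (B \<times> {0..}) (x, r) * indicator {t<..} r \<partial>count_space H))"

lemma birth_death_process_graphical:
  assumes "birth_death_process M N \<eta>' \<Lambda> b X"
  shows "AE \<omega> in M. graphical_solution (N \<omega>) (\<eta>' \<omega>) \<Lambda> b (\<lambda>s. X s \<omega>)"
  using assms by (simp add: birth_death_process_def graphical_solution_def)

lemma nn_integral_count_space_eq_0_iff:
  "(\<integral>\<^sup>+p. f p \<partial>count_space A) = 0 \<longleftrightarrow> (\<forall>p\<in>A. f p = 0)"
  by (subst nn_integral_0_iff_AE) (auto simp: AE_count_space)

text \<open>Testing the equation with \<open>B = {y}\<close> turns it into a statement about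
  membership: a nonnegative integral over a counting measure is nonzero exactly when some point of
  the set has a nonzero integrand.\<close>

lemma graphical_solution_mem_iff:
  assumes "graphical_solution P H \<Lambda> b \<xi>" "y \<in> \<Lambda>" "0 \<le> t"
  shows "y \<in> \<xi> t \<longleftrightarrow>
    (\<exists>u r s. (y, u, r, s) \<in> P \<and> 0 \<le> u \<and> 0 \<le> r \<and> 0 \<le> s \<and> s \<le> t \<and> u \<le> b y (left_limit \<xi> s) \<and> t - s < r)
    \<or> (\<exists>r. (y, r) \<in> H \<and> 0 \<le> r \<and> t < r)"
proof -
  let ?N = "\<integral>\<^sup>+(x, u, r, s). indicator ({y} \<times> {0..} \<times> {0..} \<times> {0..t}) (x, u, r, s)
               * indicator {0..b x (left_limit \<xi> s)} u * indicator {t - s<..} r \<partial>count_space P"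
    and ?H = "\<integral>\<^sup>+(x, r). indicator ({y} \<times> {0..}) (x, r) * indicator {t<..} r \<partial>count_space H"
  have eq: "\<forall>t\<ge>0. \<forall>B\<in>sets borel. B \<subseteq> \<Lambda> \<longrightarrow> emeasure (count_space UNIV) (\<xi> t \<inter> B) =
           (\<integral>\<^sup>+(x, u, r, s). indicator (B \<times> {0..} \<times> {0..} \<times> {0..t}) (x, u, r, s)
               * indicator {0..b x (left_limit \<xi> s)} u
               * indicator {t - s<..} r \<partial>count_space P)
         + (\<integral>\<^sup>+(x, r). indicator (B \<times> {0..}) (x, r) * indicator {t<..} r \<partial>count_space H)"
    using assms(1) unfolding graphical_solution_def by blast
  have "emeasure (count_space UNIV) (\<xi> t \<inter> {y}) = ?N + ?H"
    by (rule eq[rule_format]) (use assms(2,3) in auto)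
  moreover have "y \<in> \<xi> t \<longleftrightarrow> emeasure (count_space UNIV) (\<xi> t \<inter> {y}) \<noteq> 0"
    by (simp add: emeasure_count_space_eq_0)
  ultimately have mem: "y \<in> \<xi> t \<longleftrightarrow> ?N \<noteq> 0 \<or> ?H \<noteq> 0"
    by (simp only: add_eq_0_iff_both_eq_0 de_Morgan_conj)
  have N: "?N \<noteq> 0 \<longleftrightarrow> (\<exists>u r s. (y, u, r, s) \<in> P \<and> 0 \<le> u \<and> 0 \<le> r \<and> 0 \<le> s \<and> s \<le> t
      \<and> u \<le> b y (left_limit \<xi> s) \<and> t - s < r)"
    unfolding nn_integral_count_space_eq_0_iff Ball_def split_paired_All prod.case mult_eq_0_iff
      indicator_eq_0_iff mem_Sigma_iff singleton_iff atLeast_iff atLeastAtMost_iff greaterThan_iff by blast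
  have H: "?H \<noteq> 0 \<longleftrightarrow> (\<exists>r. (y, r) \<in> H \<and> 0 \<le> r \<and> t < r)"
    unfolding nn_integral_count_space_eq_0_iff Ball_def split_paired_All prod.case mult_eq_0_iff
      indicator_eq_0_iff mem_Sigma_iff singleton_iff atLeast_iff atLeastAtMost_iff greaterThan_iff by blast
  show ?thesis unfolding mem N H ..
qed

lemma nn_integral_count_space_indicator_Int:
  "(\<integral>\<^sup>+p. indicator S p \<partial>count_space A) = emeasure (count_space UNIV) (A \<inter> S)"
proof -
  have "(\<integral>\<^sup>+p. indicator S p \<partial>count_space A) = (\<integral>\<^sup>+p. indicator (A \<inter> S) p \<partial>count_space A)"
    by (intro nn_integral_cong) (auto simp: indicator_def)
  also have "\<dots> = emeasure (count_space A) (A \<inter> S)" by simp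
  also have "\<dots> = emeasure (count_space UNIV) (A \<inter> S)" by (simp add: emeasure_count_space)
  finally show ?thesis .
qed

text \<open>Drop the survival conditions and replace the acceptance condition by
  \<open>u \<le> 1\<close>. What remains depends on the noise and the initial points alone, not on
  the solution.\<close>

lemma graphical_solution_count_le:
  assumes sol: "graphical_solution P H \<Lambda> b \<xi>" and B: "B \<in> sets borel" "B \<subseteq> \<Lambda>" "0 \<le> t"
    and b: "\<And>y s. y \<in> B \<Longrightarrow> 0 < s \<Longrightarrow> b y (left_limit \<xi> s) \<le> 1"
    and no0: "\<And>y u r. y \<in> B \<Longrightarrow> 0 \<le> u \<Longrightarrow> 0 \<le> r \<Longrightarrow> (y, u, r, 0) \<notin> P"
  shows "emeasure (count_space UNIV) (\<xi> t \<inter> B)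
    \<le> birth_count B t P + emeasure (count_space UNIV) (H \<inter> B \<times> UNIV)"
proof -
  have eq: "\<forall>t\<ge>0. \<forall>B\<in>sets borel. B \<subseteq> \<Lambda> \<longrightarrow> emeasure (count_space UNIV) (\<xi> t \<inter> B) =
           (\<integral>\<^sup>+(x, u, r, s). indicator (B \<times> {0..} \<times> {0..} \<times> {0..t}) (x, u, r, s)
               * indicator {0..b x (left_limit \<xi> s)} u
               * indicator {t - s<..} r \<partial>count_space P)
         + (\<integral>\<^sup>+(x, r). indicator (B \<times> {0..}) (x, r) * indicator {t<..} r \<partial>count_space H)"
    using sol unfolding graphical_solution_def by blast
  from eq[rule_format, OF B(3,1,2)] have "emeasure (count_space UNIV) (\<xi> t \<inter> B) =
           (\<integral>\<^sup>+(x, u, r, s). indicator (B \<times> {0..} \<times> {0..} \<times> {0..t}) (x, u, r, s)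
               * indicator {0..b x (left_limit \<xi> s)} u
               * indicator {t - s<..} r \<partial>count_space P)
         + (\<integral>\<^sup>+(x, r). indicator (B \<times> {0..}) (x, r) * indicator {t<..} r \<partial>count_space H)" .
  also have "\<dots> \<le> (\<integral>\<^sup>+p. indicator (birth_window B t) p \<partial>count_space P)
      + (\<integral>\<^sup>+p. indicator (B \<times> UNIV) p \<partial>count_space H)"
  proof (rule add_mono)
    have "indicator (B \<times> {0..} \<times> {0..} \<times> {0..t}) (y, u, r, s)
               * indicator {0..b y (left_limit \<xi> s)} u
               * indicator {t - s<..} r \<le> (indicator (birth_window B t) (y, u, r, s) :: ennreal)"
      if "(y, u, r, s) \<in> P" for y u r s
    proof -
      have "u \<le> 1" if *: "y \<in> B" "0 \<le> u" "0 \<le> r" "0 \<le> s" "u \<le> b y (left_limit \<xi> s)"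
      proof -
        have "s \<noteq> 0" using no0[OF *(1-3)] \<open>(y, u, r, s) \<in> P\<close> by blast
        then show ?thesis using b[of y s] * by linarith
      qed
      then show ?thesis by (simp add: indicator_def birth_window_def)
    qed
    then show "(\<integral>\<^sup>+(x, u, r, s). indicator (B \<times> {0..} \<times> {0..} \<times> {0..t}) (x, u, r, s)
               * indicator {0..b x (left_limit \<xi> s)} u
               * indicator {t - s<..} r \<partial>count_space P) \<le> (\<integral>\<^sup>+p. indicator (birth_window B t) p \<partial>count_space P)"
      by (intro nn_integral_mono) (simp only: space_count_space split_paired_all prod.case)
    show "(\<integral>\<^sup>+(x, r). indicator (B \<times> {0..}) (x, r) * indicator {t<..} r \<partial>count_space H)
      \<le> (\<integral>\<^sup>+p. indicator (B \<times> UNIV) p \<partial>count_space H)"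
      by (intro nn_integral_mono) (auto simp: indicator_def)
  qed
  also have "\<dots> = birth_count B t P + emeasure (count_space UNIV) (H \<inter> B \<times> UNIV)"
    by (simp add: birth_count_def nn_integral_count_space_indicator_Int)
  finally show ?thesis .
qed

text \<open>The pathwise facts that hold for almost every outcome. The rate conditions are stated
  along the two paths and only at positive times, where left limits are controlled;
  \<open>rate_eq\<close> is the only relation between the two rates.\<close>

locale coupled_solutions =
  fixes P :: "('a::euclidean_space \<times> real \<times> real \<times> real) set" and H \<Lambda>' b b' \<xi> \<zeta> R t
  assumes sol: "graphical_solution P H UNIV b \<xi>" "graphical_solution P H \<Lambda>' b' \<zeta>"
    and R: "0 < R"
    and rate_le: "\<And>y s. 0 < s \<Longrightarrow> b y (left_limit \<xi> s) \<le> 1" "\<And>y s. 0 < s \<Longrightarrow> b' y (left_limit \<zeta> s) \<le> 1"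
    and rate_eq: "\<And>y s. 0 < s \<Longrightarrow> ball y (2 * R) \<subseteq> \<Lambda>' \<Longrightarrow>
        left_limit \<xi> s \<inter> ball y (2 * R) = left_limit \<zeta> s \<inter> ball y (2 * R) \<Longrightarrow>
        b y (left_limit \<xi> s) = b' y (left_limit \<zeta> s)"
    and no_birth_at_0: "\<And>y u r. y \<in> \<Lambda>' \<Longrightarrow> 0 \<le> u \<Longrightarrow> 0 \<le> r \<Longrightarrow> (y, u, r, 0) \<notin> P"
    and finite_births: "finite (P \<inter> birth_window \<Lambda>' t)"
begin

definition discrepant :: "'a \<Rightarrow> real \<Rightarrow> bool" where
  "discrepant y r \<longleftrightarrow> y \<in> \<Lambda>' \<and> 0 \<le> r \<and> (y \<in> \<xi> r) \<noteq> (y \<in> \<zeta> r)"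

text \<open>Both solutions use the same initial points with the same lifetimes, so membership of
  \<open>y\<close> can differ only through a birth accepted by one rate and rejected by the other.
  By \<open>rate_eq\<close> either the range of \<open>y\<close> leaves the window or the
  configurations just before that birth already differ within this range.\<close>

lemma discrepancy_source:
  assumes d: "discrepant y r" and "r \<le> t"
  obtains u v s where "(y, u, v, s) \<in> P \<inter> birth_window \<Lambda>' t" "0 < s" "s \<le> r"
    "\<not> ball y (2 * R) \<subseteq> \<Lambda>' \<or> (\<exists>z r'. discrepant z r' \<and> r' < s \<and> dist y z < 2 * R)"
proof -
  have y: "y \<in> \<Lambda>'" "0 \<le> r" "(y \<in> \<xi> r) \<noteq> (y \<in> \<zeta> r)" using d by (auto simp: discrepant_def)
  have mem: "y \<in> \<xi> r \<longleftrightarrow>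
      (\<exists>u v s. (y, u, v, s) \<in> P \<and> 0 \<le> u \<and> 0 \<le> v \<and> 0 \<le> s \<and> s \<le> r \<and> u \<le> b y (left_limit \<xi> s) \<and> r - s < v)
      \<or> (\<exists>v. (y, v) \<in> H \<and> 0 \<le> v \<and> r < v)"
    "y \<in> \<zeta> r \<longleftrightarrow>
      (\<exists>u v s. (y, u, v, s) \<in> P \<and> 0 \<le> u \<and> 0 \<le> v \<and> 0 \<le> s \<and> s \<le> r \<and> u \<le> b' y (left_limit \<zeta> s) \<and> r - s < v)
      \<or> (\<exists>v. (y, v) \<in> H \<and> 0 \<le> v \<and> r < v)"
    by (rule graphical_solution_mem_iff[OF sol(1) UNIV_I y(2)])
      (rule graphical_solution_mem_iff[OF sol(2) y(1,2)])
  have "\<exists>u v s. (y, u, v, s) \<in> P \<and> 0 \<le> u \<and> 0 \<le> v \<and> 0 \<le> s \<and> s \<le> r \<and>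
    (u \<le> b y (left_limit \<xi> s)) \<noteq> (u \<le> b' y (left_limit \<zeta> s))"
  proof (rule ccontr)
    assume *: "\<not> ?thesis"
    have "(u \<le> b y (left_limit \<xi> s)) = (u \<le> b' y (left_limit \<zeta> s))"
      if "(y, u, v, s) \<in> P" "0 \<le> u" "0 \<le> v" "0 \<le> s" "s \<le> r" for u v s
      using that * by blast
    then have "(\<exists>u v s. (y, u, v, s) \<in> P \<and> 0 \<le> u \<and> 0 \<le> v \<and> 0 \<le> s \<and> s \<le> r \<and> u \<le> b y (left_limit \<xi> s) \<and> r - s < v)
      = (\<exists>u v s. (y, u, v, s) \<in> P \<and> 0 \<le> u \<and> 0 \<le> v \<and> 0 \<le> s \<and> s \<le> r \<and> u \<le> b' y (left_limit \<zeta> s) \<and> r - s < v)"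
      by blast
    then show False using y(3) unfolding mem by simp
  qed
  then obtain u v s where p: "(y, u, v, s) \<in> P" "0 \<le> u" "0 \<le> v" "0 \<le> s" "s \<le> r"
    and acc: "(u \<le> b y (left_limit \<xi> s)) \<noteq> (u \<le> b' y (left_limit \<zeta> s))" by blast
  have "s \<noteq> 0" using no_birth_at_0[of y u v] p y by metis
  with p have s: "0 < s" by simp
  have "u \<le> 1" using acc rate_le[OF s, of y] by linarith
  then have mem: "(y, u, v, s) \<in> P \<inter> birth_window \<Lambda>' t"
    using p y \<open>r \<le> t\<close> by (auto simp: birth_window_def)
  have "\<exists>z r'. discrepant z r' \<and> r' < s \<and> dist y z < 2 * R" if ball: "ball y (2 * R) \<subseteq> \<Lambda>'"
  proof -
    have neq: "left_limit \<xi> s \<inter> ball y (2 * R) \<noteq> left_limit \<zeta> s \<inter> ball y (2 * R)"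
      using rate_eq[OF s ball] acc by auto
    \<comment> \<open>Left limits that differ on the ball must be turned into an actual time of
      disagreement. Since \<open>s\<close> is positive, this time can be chosen in
      \<open>(0, s)\<close>, as \<open>discrepant\<close> requires nonnegative times.\<close>
    have "has_left_limits \<xi>" "has_left_limits \<zeta>"
      using sol unfolding graphical_solution_def by blast+
    then have ev: "\<forall>\<^sub>F r' in at_left s. \<xi> r' \<inter> ball y (2 * R) = left_limit \<xi> s \<inter> ball y (2 * R)"
      "\<forall>\<^sub>F r' in at_left s. \<zeta> r' \<inter> ball y (2 * R) = left_limit \<zeta> s \<inter> ball y (2 * R)"
      using s bounded_ball[of y "2 * R"] unfolding has_left_limits_def by blast+
    have "\<forall>\<^sub>F r' in at_left s. r' \<in> {0<..<s}"
      using s by (rule eventually_at_leftI[where a = 0, rotated]) auto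
    with ev have "\<forall>\<^sub>F r' in at_left s. 0 < r' \<and> r' < s \<and> \<xi> r' \<inter> ball y (2 * R) \<noteq> \<zeta> r' \<inter> ball y (2 * R)"
    proof eventually_elim
      case (elim r')
      show ?case using elim(3) neq unfolding elim(1,2) by simp
    qed
    then obtain r' where r': "0 < r'" "r' < s" "\<xi> r' \<inter> ball y (2 * R) \<noteq> \<zeta> r' \<inter> ball y (2 * R)"
      using eventually_happens'[OF trivial_limit_at_left_real] by blast
    then obtain z where "z \<in> ball y (2 * R)" "(z \<in> \<xi> r') \<noteq> (z \<in> \<zeta> r')" by blast
    with r' ball show ?thesis by (intro exI[of _ z] exI[of _ r']) (auto simp: discrepant_def)
  qed
  then show ?thesis using that[OF mem s p(5)] by blast
qed

text \<open>Each discrepancy is traced back in time to a birth near the complement of the window;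
  the recursion ends because only finitely many births are available.\<close>

lemma discrepancy_infected:
  assumes "discrepant y r" "r \<le> t"
    and source: "\<And>y u v s. (y, u, v, s) \<in> P \<inter> birth_window \<Lambda>' t \<Longrightarrow> 0 < s \<Longrightarrow> \<not> ball y (2 * R) \<subseteq> \<Lambda>' \<Longrightarrow> I (y, u, v, s)"
    and spread: "\<And>y u v s z u' v' s'. (y, u, v, s) \<in> P \<inter> birth_window \<Lambda>' t \<Longrightarrow> (z, u', v', s') \<in> P \<inter> birth_window \<Lambda>' t \<Longrightarrow>
      0 < s' \<Longrightarrow> s' < s \<Longrightarrow> dist y z < 2 * R \<Longrightarrow> I (z, u', v', s') \<Longrightarrow> I (y, u, v, s)"
  shows "\<exists>u v s. (y, u, v, s) \<in> P \<inter> birth_window \<Lambda>' t \<and> 0 < s \<and> s \<le> r \<and> I (y, u, v, s)"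
  using assms(1,2)
proof (induction "card {p \<in> P \<inter> birth_window \<Lambda>' t. snd (snd (snd p)) \<le> r}" arbitrary: y r rule: less_induct)
  case less
  obtain u v s where p: "(y, u, v, s) \<in> P \<inter> birth_window \<Lambda>' t" "0 < s" "s \<le> r"
    and or: "\<not> ball y (2 * R) \<subseteq> \<Lambda>' \<or> (\<exists>z r'. discrepant z r' \<and> r' < s \<and> dist y z < 2 * R)"
    using discrepancy_source[OF less.prems] by metis
  from or have "I (y, u, v, s)"
  proof
    assume "\<not> ball y (2 * R) \<subseteq> \<Lambda>'"
    then show ?thesis by (rule source[OF p(1,2)])
  next
    assume "\<exists>z r'. discrepant z r' \<and> r' < s \<and> dist y z < 2 * R"
    then obtain z r' where z: "discrepant z r'" "r' < s" "dist y z < 2 * R" by blast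
    have "card {p \<in> P \<inter> birth_window \<Lambda>' t. snd (snd (snd p)) \<le> r'} < card {p \<in> P \<inter> birth_window \<Lambda>' t. snd (snd (snd p)) \<le> r}"
    proof (rule psubset_card_mono)
      show "finite {p \<in> P \<inter> birth_window \<Lambda>' t. snd (snd (snd p)) \<le> r}"
        using finite_births by (rule rev_finite_subset) blast
      have "(y, u, v, s) \<in> {p \<in> P \<inter> birth_window \<Lambda>' t. snd (snd (snd p)) \<le> r} - {p \<in> P \<inter> birth_window \<Lambda>' t. snd (snd (snd p)) \<le> r'}"
        using p z by simp
      moreover have "r' \<le> r" using z p by simp
      then have "{p \<in> P \<inter> birth_window \<Lambda>' t. snd (snd (snd p)) \<le> r'} \<subseteq> {p \<in> P \<inter> birth_window \<Lambda>' t. snd (snd (snd p)) \<le> r}"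
        by (intro Collect_mono) linarith
      ultimately show "{p \<in> P \<inter> birth_window \<Lambda>' t. snd (snd (snd p)) \<le> r'} \<subset> {p \<in> P \<inter> birth_window \<Lambda>' t. snd (snd (snd p)) \<le> r}"
        by blast
    qed
    from less.hyps[OF this z(1)] obtain u' v' s' where
      "(z, u', v', s') \<in> P \<inter> birth_window \<Lambda>' t" "0 < s'" "s' \<le> r'" "I (z, u', v', s')"
      using z p less.prems by auto
    moreover from this z(2) have "s' < s" by simp
    ultimately show ?thesis using spread[OF p(1) _ _ _ z(3)] by blast
  qed
  with p show ?case by blast
qed

end

section \<open>Cells and time slabs\<close>

lemma eventually_sets:
  fixes A :: "nat \<Rightarrow> 'a set"
  assumes "\<And>m. A m \<in> sets M"
  shows "{x \<in> space M. \<forall>m\<ge>n. x \<in> A m} \<in> sets M" (is "?B n \<in> _")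
    and "{x \<in> space M. \<exists>m0::nat. \<forall>m\<ge>m0. x \<in> A m} \<in> sets M"
proof -
  have B: "?B n \<in> sets M" for n
  proof -
    have "?B n = space M \<inter> (\<Inter>m\<in>{n..}. A m)" by blast
    moreover have "(\<Inter>m\<in>{n..}. A m) \<in> sets M" by (rule sets.countable_INT') (use assms in blast)+
    ultimately show ?thesis by (metis sets.Int sets.top)
  qed
  then show "?B n \<in> sets M" .
  have "{x \<in> space M. \<exists>m0. \<forall>m\<ge>m0. x \<in> A m} = (\<Union>n. ?B n)" by blast
  also have "\<dots> \<in> sets M" by (rule sets.countable_UN) (use B in blast)
  finally show "{x \<in> space M. \<exists>m0. \<forall>m\<ge>m0. x \<in> A m} \<in> sets M" .
qed

text \<open>The event is the increasing union of the events that all \<open>A m\<close> with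
  \<open>m \<ge> n\<close> occur, and each of these is contained in a single \<open>A n\<close>. A
  bound uniform in the mesh thus survives the passage to the limit, with no monotonicity of
  \<open>A\<close> in \<open>m\<close>.\<close>

lemma (in prob_space) prob_eventually_le:
  fixes A :: "nat \<Rightarrow> 'a set"
  assumes A: "\<And>m. A m \<in> events" and le: "\<And>m. 0 < m \<Longrightarrow> prob (A m) \<le> \<beta>"
  shows "prob {\<omega> \<in> space M. \<exists>m0. \<forall>m\<ge>m0. \<omega> \<in> A m} \<le> \<beta>"
proof -
  let ?B = "\<lambda>n. {\<omega> \<in> space M. \<forall>m\<ge>n. \<omega> \<in> A m}"
  have B: "?B n \<in> events" for n
    using eventually_sets(1)[where A = A and M = M and n = n, OF A] .
  have lim: "(\<lambda>n. prob (?B n)) \<longlonglongrightarrow> prob (\<Union>n. ?B n)"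
  proof (rule finite_Lim_measure_incseq)
    show "range ?B \<subseteq> events" using B by blast
    show "incseq ?B" by (rule incseq_SucI) (use Suc_leD in blast)
  qed
  have le': "prob (?B n) \<le> \<beta>" if "1 \<le> n" for n
  proof -
    have "prob (?B n) \<le> prob (A n)" by (rule finite_measure_mono) (use A in blast)+
    also have "\<dots> \<le> \<beta>" using le that by simp
    finally show ?thesis .
  qed
  have "\<exists>N. \<forall>n\<ge>N. prob (?B n) \<le> \<beta>" using le' by blast
  with lim have "prob (\<Union>n. ?B n) \<le> \<beta>" by (rule LIMSEQ_le_const2)
  moreover have "(\<Union>n. ?B n) = {\<omega> \<in> space M. \<exists>m0. \<forall>m\<ge>m0. \<omega> \<in> A m}" by blast
  ultimately show ?thesis by (simp only:)
qed

text \<open>Slabs are open on the left and closed on the right, so those with indices below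
  \<open>m\<close> cover exactly the times in \<open>(0, t]\<close>, including \<open>t\<close>
  itself. For \<open>s > 0\<close> the ceiling is at least 1 and \<open>nat\<close> loses
  nothing.\<close>

definition slab_index :: "real \<Rightarrow> nat \<Rightarrow> real \<Rightarrow> nat" where
  "slab_index t m s = nat (\<lceil>s * m / t\<rceil> - 1)"

definition slab :: "real \<Rightarrow> nat \<Rightarrow> nat \<Rightarrow> real set" where
  "slab t m j = {real j * t / real m <.. real (Suc j) * t / real m}"

lemma slab_index_mem:
  assumes "0 < t" "0 < m" "0 < s"
  shows "s \<in> slab t m (slab_index t m s)"
proof -
  have pos: "0 < s * m / t" using assms by simp
  then have "0 < \<lceil>s * m / t\<rceil>" by simp
  then have r: "real (slab_index t m s) = of_int \<lceil>s * m / t\<rceil> - 1"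
    by (simp add: slab_index_def)
  have "real (slab_index t m s) < s * m / t" "s * m / t \<le> real (Suc (slab_index t m s))"
    using ceiling_correct[of "s * m / t"] by (simp_all add: r)
  then show ?thesis using assms by (simp add: slab_def field_simps)
qed

lemma slab_index_less:
  assumes "0 < t" "0 < m" "0 < s" "s \<le> t"
  shows "slab_index t m s < m"
proof -
  have "s * m / t \<le> real m" using assms by (simp add: field_simps)
  then have "\<lceil>s * m / t\<rceil> \<le> int m" by (simp add: ceiling_le_iff)
  then show ?thesis using assms by (simp add: slab_index_def)
qed

text \<open>A gap of at least one slab length becomes a gap of at least 1 after rescaling, which
  separates the ceilings.\<close>

lemma slab_index_strict_mono:
  assumes "0 < t" "0 < s" "s < s'" "t / (s' - s) \<le> real m"
  shows "slab_index t m s < slab_index t m s'"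
proof -
  have "0 < t / (s' - s)" using assms by simp
  then have "0 < real m" using assms by linarith
  have "t \<le> real m * (s' - s)" using assms by (simp add: field_simps)
  then have "(s * m + t) / t \<le> s' * m / t"
    using assms by (intro divide_right_mono) (auto simp: algebra_simps)
  then have "s * m / t + 1 \<le> s' * m / t" using assms by (simp add: add_divide_distrib)
  moreover have "0 < s * m / t" using assms \<open>0 < real m\<close> by simp
  ultimately show ?thesis unfolding slab_index_def by linarith
qed

lemma slab_disjoint: "j \<noteq> j' \<Longrightarrow> 0 \<le> t \<Longrightarrow> slab t m j \<inter> slab t m j' = {}"
proof (induction j j' rule: linorder_wlog)
  case (le j j')
  then have "real (Suc j) * t / real m \<le> real j' * t / real m"
    by (intro divide_right_mono mult_right_mono) auto
  then show ?case by (auto simp: slab_def)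
qed (simp add: Int_commute)

lemma separating_mesh:
  fixes Q :: "('a \<times> real \<times> real \<times> real) set"
  assumes "finite Q" "0 < t" and pos: "\<And>y u v s. (y, u, v, s) \<in> Q \<Longrightarrow> 0 < s"
  shows "\<exists>m0. (\<forall>m\<ge>m0. \<forall>y u v s. (y, u, v, s) \<in> Q \<longrightarrow> v \<le> real m) \<and>
    (\<forall>m\<ge>m0. \<forall>y u v s y' u' v' s'. (y, u, v, s) \<in> Q \<longrightarrow> (y', u', v', s') \<in> Q \<longrightarrow> s < s' \<longrightarrow>
      slab_index t m s < slab_index t m s')"
proof -
  have ev: "\<forall>\<^sub>F m in sequentially. a \<le> real m" for a :: real
    using filterlim_real_sequentially unfolding filterlim_at_top by blast
  let ?r = "\<lambda>p :: 'a \<times> real \<times> real \<times> real. fst (snd (snd p))" and ?s = "\<lambda>p :: 'a \<times> real \<times> real \<times> real. snd (snd (snd p))"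
  have "\<forall>\<^sub>F m in sequentially. \<forall>p\<in>Q. ?r p \<le> real m"
    using \<open>finite Q\<close> by (intro eventually_ball_finite ballI ev)
  \<comment> \<open>The condition is imposed on all ordered pairs. For times in the wrong order the
    quotient is negative, and for equal times it is 0 by the convention on division, so only pairs
    with \<open>s < s'\<close> constrain \<open>m\<close>.\<close>
  moreover have "\<forall>\<^sub>F m in sequentially. \<forall>p\<in>Q. \<forall>p'\<in>Q. t / (?s p' - ?s p) \<le> real m"
    using \<open>finite Q\<close> by (intro eventually_ball_finite ballI ev)
  ultimately have "\<forall>\<^sub>F m in sequentially. (\<forall>p\<in>Q. ?r p \<le> real m) \<and> (\<forall>p\<in>Q. \<forall>p'\<in>Q. t / (?s p' - ?s p) \<le> real m)"
    by (rule eventually_conj)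
  then obtain m0 where "\<forall>m\<ge>m0. (\<forall>p\<in>Q. ?r p \<le> real m) \<and> (\<forall>p\<in>Q. \<forall>p'\<in>Q. t / (?s p' - ?s p) \<le> real m)"
    unfolding eventually_sequentially by (elim exE)
  then have m0: "?r p \<le> real m" "p' \<in> Q \<Longrightarrow> t / (?s p' - ?s p) \<le> real m" if "m0 \<le> m" "p \<in> Q" for m p p'
    using that by simp_all
  show ?thesis
  proof (rule exI[of _ m0], rule conjI; intro allI impI)
    fix m y u v s assume "m0 \<le> m" "(y, u, v, s) \<in> Q"
    from m0(1)[OF this] show "v \<le> real m" by simp
  next
    fix m y u v s y' u' v' s' assume *: "m0 \<le> m" "(y, u, v, s) \<in> Q" "(y', u', v', s') \<in> Q" "s < s'"
    have "t / (s' - s) \<le> real m" using m0(2)[OF *(1,2,3)] by simp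
    then show "slab_index t m s < slab_index t m s'"
      by (rule slab_index_strict_mono[OF \<open>0 < t\<close> pos[OF *(2)] *(4)])
  qed
qed

section \<open>Chains of cells and their exponential weights\<close>

locale cell_partition =
  fixes c :: "nat \<Rightarrow> 'a::euclidean_space set" and q :: nat and \<Lambda> \<Lambda>' :: "'a set" and R \<theta> t :: real
  assumes disj: "disjoint_family c" and cover: "(\<Union>i<q. c i) = \<Lambda>'" and empty: "\<And>i. i \<ge> q \<Longrightarrow> c i = {}"
    and cell: "\<And>i. bounded_borel (c i)" and diam: "\<And>i x y. x \<in> c i \<Longrightarrow> y \<in> c i \<Longrightarrow> dist x y \<le> 1"
    and split: "\<And>i. c i \<subseteq> \<Lambda> \<or> c i \<inter> \<Lambda> = {}"
    and window: "bounded_borel \<Lambda>" "bounded_borel \<Lambda>'" "\<Lambda> \<subseteq> \<Lambda>'"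
    and pos: "0 < R" "0 < \<theta>" "0 < t"
begin

definition node :: "nat \<Rightarrow> 'a" where "node i = (SOME x. x \<in> c i)"

definition depth :: "nat \<Rightarrow> real" where "depth i = infdist (node i) (- \<Lambda>')"

text \<open>The interaction range \<open>2 * R\<close> plus one cell diameter for each replacement
  of a point by its node: nodes of neighbouring cells are at most \<open>2 * R + 2\<close> apart,
  and every point of the neighbouring cell is then within \<open>2 * R + 3\<close>. The same
  constant serves at the boundary, where \<open>2 * R + 1\<close> would do.\<close>

definition reach :: real where "reach = 2 * R + 3"

definition near_boundary :: "nat \<Rightarrow> bool" where
  "near_boundary i \<longleftrightarrow> c i \<noteq> {} \<and> depth i \<le> reach"

definition neighbours :: "nat \<Rightarrow> nat \<Rightarrow> bool" where
  "neighbours i i' \<longleftrightarrow> c i \<noteq> {} \<and> c i' \<noteq> {} \<and> dist (node i) (node i') \<le> 2 * R + 2"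

text \<open>The lifetime is cut at \<open>m\<close> to make the box bounded, as the Poisson
  hypothesis demands. Using the mesh parameter for the cutoff lets one limit remove both
  discretisations.\<close>

definition spacetime_cell :: "nat \<Rightarrow> nat \<Rightarrow> nat \<Rightarrow> ('a \<times> real \<times> real \<times> real) set" where
  "spacetime_cell m j i = c i \<times> {0..1} \<times> {0..real m} \<times> slab t m j"

definition occupied :: "nat \<Rightarrow> ('a \<times> real \<times> real \<times> real) set \<Rightarrow> nat \<Rightarrow> nat \<Rightarrow> bool" where
  "occupied m P j i \<longleftrightarrow> P \<inter> spacetime_cell m j i \<noteq> {}"

abbreviation infected_cell :: "nat \<Rightarrow> ('a \<times> real \<times> real \<times> real) set \<Rightarrow> nat \<Rightarrow> nat \<Rightarrow> bool" where
  "infected_cell m P \<equiv> infected (occupied m P) near_boundary neighbours"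

definition inner_cells :: "nat set" where "inner_cells = {i. c i \<noteq> {} \<and> c i \<subseteq> \<Lambda>}"

text \<open>This is the exponential of \<theta> times \<open>reach - depth i\<close>: at least 1 on
  \<open>near_boundary\<close> cells, and decaying at rate \<theta> into the window.\<close>

definition weight :: "nat \<Rightarrow> real" where "weight i = exp (\<theta> * reach) * exp (- \<theta> * depth i)"

text \<open>The volume of a ball of radius \<open>reach\<close>, which bounds the rate of births
  near a cell, times the largest factor by which \<open>weight\<close> can change between
  neighbours.\<close>

definition growth :: real where
  "growth = exp (\<theta> * reach) * (unit_ball_vol (real DIM('a)) * reach ^ DIM('a))"

text \<open>A set of noise configurations rather than an event of the probability space, so that the
  independence clause of \<open>driving_noise\<close> can be applied to it.\<close>

definition bad :: "nat \<Rightarrow> ('a \<times> real \<times> real \<times> real) set set" where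
  "bad m = {P \<in> space configs. \<exists>j<m. \<exists>i\<in>inner_cells. infected_cell m P j i}"

lemma node_mem: "c i \<noteq> {} \<Longrightarrow> node i \<in> c i"
  unfolding node_def by (rule someI_ex) blast

lemma nonempty_less: "c i \<noteq> {} \<Longrightarrow> i < q"
  using empty[of i] by (cases "i < q") auto

lemma bounded_borel_spacetime_cell: "bounded_borel (spacetime_cell m j i)"
  unfolding spacetime_cell_def slab_def by (intro bounded_borel_box cell bounded_borel_interval)

lemma occupied_sets: "{P \<in> space configs. occupied m P j i} \<in> sets configs"
  unfolding occupied_def by (rule hit_sets[OF bounded_borel_spacetime_cell])

lemma bad_sets: "bad m \<in> sets configs"
proof -
  have "bad m = (\<Union>j<m. \<Union>i\<in>inner_cells. {P \<in> space configs. infected_cell m P j i})"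
    by (auto simp: bad_def)
  then show ?thesis
    using infected_sets[OF occupied_sets] by (auto intro!: sets.countable_UN'')
qed

lemma depth_near_boundary:
  assumes "y \<in> c i" "\<not> ball y (2 * R) \<subseteq> \<Lambda>'"
  shows "near_boundary i"
proof -
  obtain x where "x \<in> ball y (2 * R)" "x \<notin> \<Lambda>'" using assms(2) by blast
  then have x: "dist y x < 2 * R" "x \<in> - \<Lambda>'" by simp_all
  have "depth i \<le> dist (node i) x" unfolding depth_def by (rule infdist_le[OF x(2)])
  also have "\<dots> \<le> dist (node i) y + dist y x" by (rule dist_triangle)
  also have "\<dots> \<le> reach"
  proof -
    have "dist (node i) y \<le> 1" using diam node_mem assms(1) by blast
    then show ?thesis using x by (simp add: reach_def)
  qed
  finally show ?thesis using assms(1) by (auto simp: near_boundary_def)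
qed

lemma neighboursI:
  assumes "y \<in> c i" "z \<in> c i'" "dist y z < 2 * R"
  shows "neighbours i i'"
proof -
  have "dist (node i) (node i') \<le> dist (node i) y + dist y z + dist z (node i')"
    using dist_triangle[of "node i" "node i'" y] dist_triangle[of y "node i'" z] by linarith
  then show ?thesis
    using assms diam[of "node i" i y] diam[of z i' "node i'"] node_mem[of i] node_mem[of i']
    by (force simp: neighbours_def)
qed

text \<open>The depth is 1-Lipschitz in the node, so a neighbour has at most
  \<open>exp (\<theta> * reach)\<close> times the weight. The neighbouring cells are disjoint and
  lie in one ball of radius \<open>reach\<close>, so their total volume is bounded however many they
  are.\<close>

lemma sum_neighbours_le:
  assumes "0 \<le> \<delta>"
  shows "(\<Sum>i' | i' < q \<and> neighbours i i'. \<delta> * measure lborel (c i') * weight i') \<le> \<delta> * growth * weight i"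
proof -
  let ?I = "{i'. i' < q \<and> neighbours i i'}"
  have w: "weight i' \<le> exp (\<theta> * reach) * weight i" if "i' \<in> ?I" for i'
  proof -
    have "depth i \<le> depth i' + dist (node i) (node i')"
      unfolding depth_def by (rule infdist_triangle)
    then have "depth i \<le> depth i' + reach" using that by (simp add: neighbours_def reach_def)
    then have "\<theta> * depth i \<le> \<theta> * (depth i' + reach)" using pos by (intro mult_left_mono) auto
    then have "exp (\<theta> * reach + - \<theta> * depth i') \<le> exp (\<theta> * reach + (\<theta> * reach + - \<theta> * depth i))"
      by (simp add: algebra_simps)
    then show ?thesis by (simp only: weight_def exp_add)
  qed
  have "(\<Sum>i'\<in>?I. measure lborel (c i')) = measure lborel (\<Union>i'\<in>?I. c i')"
  proof (rule measure_finite_Union[symmetric])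
    show "disjoint_family_on c ?I" using disj by (auto simp: disjoint_family_on_def)
    show "emeasure lborel (c i') \<noteq> \<infinity>" for i' using emeasure_lborel_bounded_borel[OF cell] by simp
  qed (use cell in \<open>auto simp: bounded_borel_def\<close>)
  also have "\<dots> \<le> measure lborel (cball (node i) reach)"
  proof (rule measure_mono_fmeasurable)
    show "(\<Union>i'\<in>?I. c i') \<subseteq> cball (node i) reach"
    proof safe
      fix i' y assume "i' < q" "neighbours i i'" "y \<in> c i'"
      then show "y \<in> cball (node i) reach"
        using dist_triangle[of "node i" y "node i'"] diam[of "node i'" i' y] node_mem[of i']
        by (force simp: neighbours_def reach_def)
    qed
    show "(\<Union>i'\<in>?I. c i') \<in> sets lborel" using cell by (auto simp: bounded_borel_def)
    show "cball (node i) reach \<in> fmeasurable lborel"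
      by (auto simp: fmeasurable_def emeasure_bounded_finite[unfolded infinity_ennreal_def])
  qed
  also have "\<dots> = unit_ball_vol (real DIM('a)) * reach ^ DIM('a)"
    using pos by (simp add: content_cball reach_def)
  finally have vol: "(\<Sum>i'\<in>?I. measure lborel (c i')) \<le> unit_ball_vol (real DIM('a)) * reach ^ DIM('a)" .
  have "(\<Sum>i'\<in>?I. \<delta> * measure lborel (c i') * weight i') \<le> (\<Sum>i'\<in>?I. \<delta> * measure lborel (c i') * (exp (\<theta> * reach) * weight i))"
    using w assms by (intro sum_mono mult_left_mono) auto
  also have "\<dots> = \<delta> * (exp (\<theta> * reach) * weight i) * (\<Sum>i'\<in>?I. measure lborel (c i'))"
    unfolding sum_distrib_left by (intro sum.cong refl) (simp add: mult_ac)
  also have "\<dots> \<le> \<delta> * (exp (\<theta> * reach) * weight i) * (unit_ball_vol (real DIM('a)) * reach ^ DIM('a))"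
    using vol assms by (intro mult_left_mono) (auto simp: weight_def)
  finally show ?thesis by (simp add: growth_def mult_ac)
qed

lemma growth_nonneg: "0 \<le> growth"
  using pos by (simp add: growth_def reach_def)

text \<open>Two different boxes differ in the cell or in the slab, hence are disjoint, and each has
  intensity at most the cell volume times the slab length \<open>t / m\<close>.\<close>

lemma percolation:
  assumes N: "poisson_process M N (driving_intensity :: ('a \<times> real \<times> real \<times> real) measure)" and m: "0 < m"
  shows "percolation M q (\<lambda>\<omega>. occupied m (N \<omega>)) (\<lambda>i. t / m * measure lborel (c i)) weight (t / m * growth)
    near_boundary neighbours"
proof -
  interpret prob_space M using N by (simp add: poisson_process_def)
  have meas: "N \<in> M \<rightarrow>\<^sub>M configs" using N by (simp add: poisson_process_def)
  show ?thesis
  proof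
    show "{\<omega> \<in> space M. occupied m (N \<omega>) j i} \<in> sets M" for j i
      using measurable_sets[OF meas occupied_sets[of m j i]] measurable_space[OF meas]
      by (simp add: vimage_def Int_def conj_commute cong: conj_cong)
    show "i < q" if "occupied m (N \<omega>) j i" for \<omega> j i
      using that nonempty_less[of i] by (auto simp: occupied_def spacetime_cell_def)
    show "prob {\<omega> \<in> space M. \<forall>(j, i)\<in>V. occupied m (N \<omega>) j i} \<le> (\<Prod>(j, i)\<in>V. t / m * measure lborel (c i))"
      if V: "finite V" for V :: "(nat \<times> nat) set"
    proof -
      let ?S = "\<lambda>(j, i). spacetime_cell m j i"
      have dj: "spacetime_cell m j i \<inter> spacetime_cell m j' i' = {}" if "(j, i) \<noteq> (j', i')" for j i j' i'
      proof (cases "i = i'")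
        case True
        then show ?thesis using that slab_disjoint[of j j' t m] pos by (auto simp: spacetime_cell_def)
      next
        case False
        then show ?thesis using disj by (auto simp: spacetime_cell_def disjoint_family_on_def)
      qed
      have djV: "disjoint_family_on ?S V"
        unfolding disjoint_family_on_def
      proof (intro ballI impI)
        fix v v' :: "nat \<times> nat" assume "v \<noteq> v'"
        then show "?S v \<inter> ?S v' = {}"
          using dj[of "fst v" "snd v" "fst v'" "snd v'"] by (simp add: split_beta prod_eq_iff)
      qed
      have "prob {\<omega> \<in> space M. \<forall>v\<in>V. N \<omega> \<inter> ?S v \<noteq> {}} \<le> (\<Prod>v\<in>V. measure driving_intensity (?S v))"
        by (rule poisson_process_prob_all_hit[OF N V]) (clarsimp simp: bounded_borel_spacetime_cell, rule djV)
      also have "\<dots> \<le> (\<Prod>(j, i)\<in>V. t / m * measure lborel (c i))"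
      proof (rule prod_mono, clarify)
        fix j i
        have "{0..} \<inter> slab t m j = slab t m j"
        proof -
          have "0 \<le> real j * t / real m" using pos by simp
          moreover have "{0..} \<inter> {a<..b} = {a<..b}" if "0 \<le> a" for a b :: real using that by auto
          ultimately show ?thesis unfolding slab_def by blast
        qed
        moreover have "real (Suc j) * t / real m - real j * t / real m = t / m"
          by (simp add: diff_divide_distrib[symmetric] algebra_simps)
        ultimately have "emeasure lborel ({0..} \<inter> slab t m j) = ennreal (t / m)"
          using pos by (simp add: slab_def divide_right_mono)
        then have "measure driving_intensity (spacetime_cell m j i) \<le> measure lborel (c i) * (t / m)"
          unfolding spacetime_cell_def using pos
          by (intro measure_driving_intensity_le cell) (auto simp: slab_def)
        then show "0 \<le> measure driving_intensity (spacetime_cell m j i) \<and>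
          measure driving_intensity (spacetime_cell m j i) \<le> t / m * measure lborel (c i)"
          by (simp add: mult.commute)
      qed
      finally show ?thesis by (simp add: occupied_def split_beta)
    qed
    show "1 \<le> weight i" if "near_boundary i" for i
    proof -
      have "\<theta> * depth i \<le> \<theta> * reach" using that pos by (auto simp: near_boundary_def)
      then show ?thesis unfolding weight_def by (simp flip: exp_add)
    qed
    show "(\<Sum>i' | i' < q \<and> neighbours i i'. t / m * measure lborel (c i') * weight i') \<le> t / m * growth * weight i" for i
      using sum_neighbours_le[of "t / m" i] pos by simp
  qed (use pos growth_nonneg in \<open>auto simp: weight_def\<close>)
qed

text \<open>The number \<open>m\<close> of final slabs cancels against the slab length, and the
  compounded growth is at most \<open>exp (t * growth)\<close>; the result does not depend on
  \<open>m\<close>. Cells inside \<Lambda> have depth at least the distance from \<Lambda> to the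
  complement of the window, which fixes the exponential.\<close>

lemma prob_bad_le:
  assumes N: "poisson_process M N (driving_intensity :: ('a \<times> real \<times> real \<times> real) measure)" and m: "0 < m"
  shows "measure M {\<omega> \<in> space M. N \<omega> \<in> bad m}
    \<le> t * exp (t * growth) * exp (\<theta> * reach) * measure lborel \<Lambda> * exp (- \<theta> * setdist \<Lambda> (- \<Lambda>'))"
proof -
  interpret percolation M q "\<lambda>\<omega>. occupied m (N \<omega>)" "\<lambda>i. t / m * measure lborel (c i)" weight "t / m * growth"
    near_boundary neighbours
    by (rule percolation[OF N m])
  have meas: "N \<in> M \<rightarrow>\<^sub>M configs" using N by (simp add: poisson_process_def)
  have I: "inner_cells \<subseteq> {..<q}" using nonempty_less by (auto simp: inner_cells_def)
  have fin: "finite inner_cells" using I finite_subset by blast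
  have "(\<Sum>i\<in>inner_cells. t / m * measure lborel (c i) * weight i)
    \<le> (\<Sum>i\<in>inner_cells. t / m * measure lborel (c i) * (exp (\<theta> * reach) * exp (- \<theta> * setdist \<Lambda> (- \<Lambda>'))))"
  proof (intro sum_mono mult_left_mono)
    fix i assume i: "i \<in> inner_cells"
    then have "node i \<in> \<Lambda>" using node_mem[of i] by (auto simp: inner_cells_def)
    then have "setdist \<Lambda> (- \<Lambda>') \<le> depth i"
      unfolding depth_def infdist_eq_setdist by (intro setdist_subset_left) auto
    then show "weight i \<le> exp (\<theta> * reach) * exp (- \<theta> * setdist \<Lambda> (- \<Lambda>'))"
      using pos by (simp add: weight_def)
  qed (use pos in auto)
  also have "\<dots> = t / m * (exp (\<theta> * reach) * exp (- \<theta> * setdist \<Lambda> (- \<Lambda>'))) * (\<Sum>i\<in>inner_cells. measure lborel (c i))"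
    unfolding sum_distrib_left by (intro sum.cong refl) (simp add: mult_ac)
  also have "(\<Sum>i\<in>inner_cells. measure lborel (c i)) = measure lborel (\<Union>i\<in>inner_cells. c i)"
  proof (rule measure_finite_Union[OF fin, symmetric])
    show "disjoint_family_on c inner_cells" using disj by (auto simp: disjoint_family_on_def)
    show "emeasure lborel (c i) \<noteq> \<infinity>" for i using emeasure_lborel_bounded_borel[OF cell] by simp
  qed (use cell in \<open>auto simp: bounded_borel_def\<close>)
  also have "t / m * (exp (\<theta> * reach) * exp (- \<theta> * setdist \<Lambda> (- \<Lambda>'))) * \<dots>
      \<le> t / m * (exp (\<theta> * reach) * exp (- \<theta> * setdist \<Lambda> (- \<Lambda>'))) * measure lborel \<Lambda>"
  proof (intro mult_left_mono measure_mono_fmeasurable)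
    show "\<Lambda> \<in> fmeasurable lborel" using window(1) emeasure_lborel_bounded_borel[OF window(1)]
      by (auto simp: fmeasurable_def bounded_borel_def)
    show "(\<Union>i\<in>inner_cells. c i) \<in> sets lborel" using cell by (auto simp: bounded_borel_def)
  qed (use pos in \<open>auto simp: inner_cells_def\<close>)
  finally have sum: "(\<Sum>i\<in>inner_cells. t / m * measure lborel (c i) * weight i)
    \<le> t / m * (exp (\<theta> * reach) * exp (- \<theta> * setdist \<Lambda> (- \<Lambda>'))) * measure lborel \<Lambda>" .
  have pow: "(1 + t / m * growth) ^ m \<le> exp (t * growth)"
  proof -
    have "(1 + t / m * growth) ^ m \<le> exp (t / m * growth) ^ m"
      using pos growth_nonneg by (intro power_mono exp_ge_add_one_self) auto
    also have "\<dots> = exp (t * growth)" using m by (simp flip: exp_of_nat_mult)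
    finally show ?thesis .
  qed
  have "{\<omega> \<in> space M. N \<omega> \<in> bad m} = {\<omega> \<in> space M. \<exists>j<m. \<exists>i\<in>inner_cells. infected_cell m (N \<omega>) j i}"
    using measurable_space[OF meas] by (auto simp: bad_def)
  then have "measure M {\<omega> \<in> space M. N \<omega> \<in> bad m}
      \<le> real m * (1 + t / m * growth) ^ m * (\<Sum>i\<in>inner_cells. t / m * measure lborel (c i) * weight i)"
    using prob_infected_le[OF I, of m] by simp
  also have "\<dots> \<le> real m * exp (t * growth) * (t / m * (exp (\<theta> * reach) * exp (- \<theta> * setdist \<Lambda> (- \<Lambda>'))) * measure lborel \<Lambda>)"
    using pow sum pos growth_nonneg
    by (intro mult_mono sum_nonneg mult_nonneg_nonneg) (auto simp: weight_def)
  also have "\<dots> = t * exp (t * growth) * exp (\<theta> * reach) * measure lborel \<Lambda> * exp (- \<theta> * setdist \<Lambda> (- \<Lambda>'))"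
    using m by simp
  finally show ?thesis .
qed

text \<open>Once the mesh separates the finitely many birth times and exceeds all lifetimes
  involved, every traced birth occupies a box and the order of the births becomes strict order of
  the slabs. The required mesh depends on \<open>P\<close>, so membership can be claimed only for
  all large \<open>m\<close>.\<close>

lemma discrepancy_bad:
  assumes "coupled_solutions P H \<Lambda>' b b' \<xi> \<zeta> R t" and P: "P \<in> space configs"
    and neq: "\<xi> t \<inter> \<Lambda> \<noteq> \<zeta> t \<inter> \<Lambda>"
  shows "\<exists>m0. \<forall>m\<ge>m0. P \<in> bad m"
proof -
  interpret coupled_solutions P H \<Lambda>' b b' \<xi> \<zeta> R t by fact
  let ?Q = "P \<inter> birth_window \<Lambda>' t"
  obtain y where y: "y \<in> \<Lambda>" "(y \<in> \<xi> t) \<noteq> (y \<in> \<zeta> t)" using neq by blast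
  have d: "discrepant y t" using y window pos by (auto simp: discrepant_def)
  have Qpos: "0 < s" if "(y, u, v, s) \<in> ?Q" for y u v s
    using that no_birth_at_0[of y u v] by (cases "s = 0") (auto simp: birth_window_def)
  have "\<exists>m0. (\<forall>m\<ge>m0. \<forall>y u v s. (y, u, v, s) \<in> ?Q \<longrightarrow> v \<le> real m) \<and>
    (\<forall>m\<ge>m0. \<forall>y u v s y' u' v' s'. (y, u, v, s) \<in> ?Q \<longrightarrow> (y', u', v', s') \<in> ?Q \<longrightarrow> s < s' \<longrightarrow>
      slab_index t m s < slab_index t m s')"
    by (rule separating_mesh[OF finite_births pos(3) Qpos])
  then obtain m0 where "\<forall>m\<ge>m0. \<forall>y u v s. (y, u, v, s) \<in> ?Q \<longrightarrow> v \<le> real m"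
    "\<forall>m\<ge>m0. \<forall>y u v s y' u' v' s'. (y, u, v, s) \<in> ?Q \<longrightarrow> (y', u', v', s') \<in> ?Q \<longrightarrow> s < s' \<longrightarrow>
      slab_index t m s < slab_index t m s'" by (elim exE conjE)
  note m0 = this[rule_format]
  define k where "k y = (SOME i. y \<in> c i)" for y
  have k: "y \<in> c (k y)" if "y \<in> \<Lambda>'" for y
    using that cover unfolding k_def by (intro someI_ex[of "\<lambda>i. y \<in> c i"]) auto
  have "P \<in> bad m" if "m \<ge> max m0 1" for m
  proof -
    have m: "m \<ge> m0" "0 < m" using that by auto
    have occ: "occupied m P (slab_index t m s) (k y)" if Q: "(y, u, v, s) \<in> ?Q" for y u v s
    proof -
      have "(y, u, v, s) \<in> spacetime_cell m (slab_index t m s) (k y)"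
        using Q k[of y] m0(1)[OF m(1) Q] slab_index_mem[OF pos(3) m(2) Qpos[OF Q]]
        by (auto simp: spacetime_cell_def birth_window_def)
      then show ?thesis using Q by (auto simp: occupied_def)
    qed
    have L: "y \<in> \<Lambda>'" "s \<le> t" if "(y, u, v, s) \<in> ?Q" for y u v s
      using that by (auto simp: birth_window_def)
    have "\<exists>u v s. (y, u, v, s) \<in> ?Q \<and> 0 < s \<and> s \<le> t \<and> infected_cell m P (slab_index t m s) (k y)"
    proof (rule discrepancy_infected[OF d order_refl,
          where I = "\<lambda>(y, u, v, s). infected_cell m P (slab_index t m s) (k y)", unfolded prod.case])
      fix y u v s assume *: "(y, u, v, s) \<in> ?Q" "\<not> ball y (2 * R) \<subseteq> \<Lambda>'"
      show "infected_cell m P (slab_index t m s) (k y)"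
        by (intro infected.source) (rule occ[OF *(1)], rule depth_near_boundary[OF k[OF L(1)[OF *(1)]] *(2)])
    next
      fix y u v s z u' v' s'
      assume *: "(y, u, v, s) \<in> ?Q" "(z, u', v', s') \<in> ?Q" "s' < s" "dist y z < 2 * R"
        "infected_cell m P (slab_index t m s') (k z)"
      show "infected_cell m P (slab_index t m s) (k y)"
        by (rule infected.spread[where i' = "k z", OF _ *(5)])
          (rule occ[OF *(1)], rule m0(2)[OF m(1) *(2,1,3)],
            rule neighboursI[OF k[OF L(1)[OF *(1)]] k[OF L(1)[OF *(2)]] *(4)])
    qed
    then obtain u v s where s: "0 < s" "s \<le> t" "infected_cell m P (slab_index t m s) (k y)"
      by blast
    \<comment> \<open>The cell contains a point of \<Lambda> and therefore lies in \<Lambda>,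
      because the partition was made compatible with it.\<close>
    have "y \<in> c (k y)" using k y window by blast
    then have "k y \<in> inner_cells"
      using y(1) split[of "k y"] unfolding inner_cells_def by blast
    moreover have "slab_index t m s < m" by (rule slab_index_less[OF pos(3) m(2) s(1,2)])
    ultimately show ?thesis
      using s(3) P unfolding bad_def by blast
  qed
  then show ?thesis by blast
qed

end

text \<open>The constant is fixed before the windows, and \<open>D\<close> before any solution: it
  concerns the noise alone and serves every pair of coupled solutions. The case \<open>t = 0\<close>
  is separate because slabs degenerate; there a discrepancy would need a birth at a time both
  positive and at most 0.\<close>

lemma coupling_bound:
  fixes N :: "'w \<Rightarrow> ('a::euclidean_space \<times> real \<times> real \<times> real) set"
  assumes N: "poisson_process M N driving_intensity" and R: "0 < R" and \<theta>: "0 < \<theta>" and t: "0 \<le> t"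
  obtains C where "0 < C"
    "\<And>\<Lambda> \<Lambda>'. bounded_borel \<Lambda> \<Longrightarrow> bounded_borel \<Lambda>' \<Longrightarrow> \<Lambda> \<subseteq> \<Lambda>' \<Longrightarrow>
      \<exists>D\<in>sets configs. measure M {\<omega> \<in> space M. N \<omega> \<in> D} \<le> C * measure lborel \<Lambda> * exp (- \<theta> * setdist \<Lambda> (- \<Lambda>')) \<and>
        (\<forall>P H b b' \<xi> \<zeta>. P \<in> space configs \<longrightarrow> coupled_solutions P H \<Lambda>' b b' \<xi> \<zeta> R t \<longrightarrow> P \<notin> D \<longrightarrow>
          \<xi> t \<inter> \<Lambda> = \<zeta> t \<inter> \<Lambda>)"
proof (cases "t = 0")
  case True
  show ?thesis
  proof (rule that[of 1])
    fix \<Lambda> \<Lambda>' :: "'a set" assume "\<Lambda> \<subseteq> \<Lambda>'"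
    have "\<xi> t \<inter> \<Lambda> = \<zeta> t \<inter> \<Lambda>" if "coupled_solutions P H \<Lambda>' b b' \<xi> \<zeta> R t" for P H b b' and \<xi> \<zeta> :: "real \<Rightarrow> 'a set"
    proof (rule ccontr)
      interpret coupled_solutions P H \<Lambda>' b b' \<xi> \<zeta> R t by fact
      assume "\<xi> t \<inter> \<Lambda> \<noteq> \<zeta> t \<inter> \<Lambda>"
      then obtain y where d: "discrepant y t" using \<open>\<Lambda> \<subseteq> \<Lambda>'\<close> t by (auto simp: discrepant_def)
      obtain s where "0 < s" "s \<le> t" by (rule discrepancy_source[OF d order_refl])
      then show False using True by simp
    qed
    then show "\<exists>D\<in>sets configs. measure M {\<omega> \<in> space M. N \<omega> \<in> D} \<le> 1 * measure lborel \<Lambda> * exp (- \<theta> * setdist \<Lambda> (- \<Lambda>')) \<and>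
        (\<forall>P H b b' \<xi> \<zeta>. P \<in> space configs \<longrightarrow> coupled_solutions P H \<Lambda>' b b' \<xi> \<zeta> R t \<longrightarrow> P \<notin> D \<longrightarrow>
          \<xi> t \<inter> \<Lambda> = \<zeta> t \<inter> \<Lambda>)"
      by (intro bexI[of _ "{}"]) auto
  qed simp
next
  case False
  with t have t: "0 < t" by simp
  interpret prob_space M using N by (simp add: poisson_process_def)
  have meas: "N \<in> M \<rightarrow>\<^sub>M configs" using N by (simp add: poisson_process_def)
  \<comment> \<open>\<open>reach\<close> and \<open>growth\<close> written out before a partition is
    chosen, which exhibits the constant as independent of the windows.\<close>
  let ?r = "2 * R + 3"
  let ?g = "exp (\<theta> * ?r) * (unit_ball_vol (real DIM('a)) * ?r ^ DIM('a))"
  let ?C = "t * exp (t * ?g) * exp (\<theta> * ?r)"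
  show ?thesis
  proof (rule that[of ?C])
    fix \<Lambda> \<Lambda>' :: "'a set" assume L: "bounded_borel \<Lambda>" "bounded_borel \<Lambda>'" "\<Lambda> \<subseteq> \<Lambda>'"
    then have "\<Lambda> \<in> sets borel" by (simp add: bounded_borel_def)
    from finite_small_partition[OF L(2) this] obtain c q where c: "disjoint_family (c :: nat \<Rightarrow> 'a set)"
      "(\<Union>i<q. c i) = \<Lambda>'" "\<forall>i\<ge>q. c i = {}" "\<forall>i. bounded_borel (c i)"
      "\<forall>i. \<forall>x\<in>c i. \<forall>y\<in>c i. dist x y \<le> 1" "\<forall>i. c i \<subseteq> \<Lambda> \<or> c i \<inter> \<Lambda> = {}" by (elim exE conjE)
    interpret cell_partition c q \<Lambda> \<Lambda>' R \<theta> t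
      by unfold_locales (use c L R \<theta> t in auto)
    let ?D = "{P \<in> space configs. \<exists>m0. \<forall>m\<ge>m0. P \<in> bad m}"
    show "\<exists>D\<in>sets configs. measure M {\<omega> \<in> space M. N \<omega> \<in> D} \<le> ?C * measure lborel \<Lambda> * exp (- \<theta> * setdist \<Lambda> (- \<Lambda>')) \<and>
        (\<forall>P H b b' \<xi> \<zeta>. P \<in> space configs \<longrightarrow> coupled_solutions P H \<Lambda>' b b' \<xi> \<zeta> R t \<longrightarrow> P \<notin> D \<longrightarrow>
          \<xi> t \<inter> \<Lambda> = \<zeta> t \<inter> \<Lambda>)"
    proof (intro bexI[of _ ?D] conjI allI impI)
      have "{\<omega> \<in> space M. N \<omega> \<in> bad m} \<in> events" for m
        using measurable_sets[OF meas bad_sets[of m]] by (simp add: vimage_def Int_def conj_commute)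
      then have "prob {\<omega> \<in> space M. \<exists>m0. \<forall>m\<ge>m0. \<omega> \<in> {\<omega> \<in> space M. N \<omega> \<in> bad m}}
          \<le> t * exp (t * growth) * exp (\<theta> * reach) * measure lborel \<Lambda> * exp (- \<theta> * setdist \<Lambda> (- \<Lambda>'))"
        by (rule prob_eventually_le) (rule prob_bad_le[OF N])
      moreover have "{\<omega> \<in> space M. \<exists>m0. \<forall>m\<ge>m0. \<omega> \<in> {\<omega> \<in> space M. N \<omega> \<in> bad m}} = {\<omega> \<in> space M. N \<omega> \<in> ?D}"
        using measurable_space[OF meas] by auto
      ultimately show "prob {\<omega> \<in> space M. N \<omega> \<in> ?D} \<le> ?C * measure lborel \<Lambda> * exp (- \<theta> * setdist \<Lambda> (- \<Lambda>'))"
        by (simp add: growth_def reach_def)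
      show "\<xi> t \<inter> \<Lambda> = \<zeta> t \<inter> \<Lambda>" if "P \<in> space configs" "coupled_solutions P H \<Lambda>' b b' \<xi> \<zeta> R t" "P \<notin> ?D" for P H b b' \<xi> \<zeta>
        using discrepancy_bad[OF that(2,1)] that(1,3) by blast
      show "?D \<in> sets configs" by (rule eventually_sets(2)[OF bad_sets])
    qed
  qed (use t in simp)
qed

section \<open>The initial configuration\<close>

text \<open>Counting indices instead of points gives a series of indicators of \<open>K\<close> and
  \<open>x i\<close>, the variables for which measurability and independence are available. Tonelli
  and the factorisation are then applied term by term.\<close>

definition initial_count :: "('w \<Rightarrow> enat) \<Rightarrow> (nat \<Rightarrow> 'w \<Rightarrow> 'a) \<Rightarrow> 'a set \<Rightarrow> 'w \<Rightarrow> ennreal" where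
  "initial_count K x B \<omega> = emeasure (count_space UNIV) {i. enat i < K \<omega> \<and> x i \<omega> \<in> B}"

lemma initial_count_eq_suminf:
  "initial_count K x B \<omega> = (\<Sum>i. indicator {enat i<..} (K \<omega>) * indicator B (x i \<omega>))"
proof -
  have "initial_count K x B \<omega> = (\<integral>\<^sup>+i. indicator {i. enat i < K \<omega> \<and> x i \<omega> \<in> B} i \<partial>count_space UNIV)"
    unfolding initial_count_def by (rule nn_integral_indicator[symmetric]) simp
  also have "\<dots> = (\<Sum>i. indicator {i. enat i < K \<omega> \<and> x i \<omega> \<in> B} i)"
    by (rule nn_integral_count_space_nat)
  also have "\<dots> = (\<Sum>i. indicator {enat i<..} (K \<omega>) * indicator B (x i \<omega>))"
    by (intro suminf_cong) (simp add: indicator_def)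
  finally show ?thesis .
qed

lemma emeasure_count_space_image_le:
  "emeasure (count_space UNIV) (f ` A) \<le> emeasure (count_space UNIV) A"
proof (cases "finite A")
  case True
  then show ?thesis by (simp add: card_image_le)
qed (simp add: emeasure_count_space)

lemma marked_points_count_le:
  "emeasure (count_space UNIV) (marked_points K x \<tau> \<omega> \<inter> B \<times> UNIV) \<le> initial_count K x B \<omega>"
proof -
  have "marked_points K x \<tau> \<omega> \<inter> B \<times> UNIV
      = (\<lambda>i. (x i \<omega>, \<tau> i \<omega>)) ` {i. enat i < K \<omega> \<and> x i \<omega> \<in> B}"
    unfolding marked_points_def by blast
  then show ?thesis unfolding initial_count_def by (simp only: emeasure_count_space_image_le)
qed

locale driven =
  fixes M :: "'w measure" and N :: "'w \<Rightarrow> ('a::euclidean_space \<times> real \<times> real \<times> real) set"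
    and K :: "'w \<Rightarrow> enat" and x :: "nat \<Rightarrow> 'w \<Rightarrow> 'a" and \<tau> :: "nat \<Rightarrow> 'w \<Rightarrow> real" and \<mu> :: "'a set measure"
  assumes noise: "driving_noise M N K x \<tau> \<mu>"
    and invariant: "translation_invariant \<mu>" and moment: "finite_first_moment \<mu>"
begin

lemma poisson: "poisson_process M N driving_intensity"
  using noise by (simp add: driving_noise_def)

sublocale prob_space M
  using poisson by (simp add: poisson_process_def)

lemma measurable_noise [measurable]:
  "N \<in> M \<rightarrow>\<^sub>M configs" "K \<in> M \<rightarrow>\<^sub>M count_space UNIV" "x i \<in> M \<rightarrow>\<^sub>M borel" "\<tau> i \<in> M \<rightarrow>\<^sub>M borel"
  using noise by (auto simp: driving_noise_def poisson_process_def)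

lemma measurable_initial_count:
  assumes [measurable]: "B \<in> sets borel"
  shows "initial_count K x B \<in> borel_measurable M"
proof -
  have "(\<lambda>\<omega>. \<Sum>i. indicator {enat i<..} (K \<omega>) * indicator B (x i \<omega>) :: ennreal) \<in> borel_measurable M"
    by (intro borel_measurable_suminf_order borel_measurable_times_ennreal
        measurable_compose[OF measurable_noise(2)] measurable_compose[OF measurable_noise(3)]) auto
  then show ?thesis by (simp add: initial_count_eq_suminf[abs_def])
qed

text \<open>Evaluate the product law on a rectangle that leaves the lifetimes free; their factor is
  the total mass 1.\<close>

lemma noise_indep:
  assumes D: "D \<in> sets configs" and U: "U \<in> sets (count_space UNIV)" and B: "B \<in> sets borel"
  shows "emeasure M {\<omega> \<in> space M. N \<omega> \<in> D \<and> K \<omega> \<in> U \<and> x i \<omega> \<in> B}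
    = emeasure M {\<omega> \<in> space M. N \<omega> \<in> D} * emeasure M {\<omega> \<in> space M. K \<omega> \<in> U \<and> x i \<omega> \<in> B}"
proof -
  let ?P = "\<Pi>\<^sub>M i\<in>(UNIV :: nat set). (borel :: 'a measure)" and ?T = "\<Pi>\<^sub>M i\<in>(UNIV :: nat set). (borel :: real measure)"
  let ?C = "count_space (UNIV :: enat set) \<Otimes>\<^sub>M ?P"
  let ?F = "U \<times> ((\<lambda>y. y i) -` B \<inter> space ?P)"
  have F: "?F \<in> sets ?C"
    by (intro pair_measureI U measurable_sets[OF _ B]) simp
  have g: "(\<lambda>\<omega>. (K \<omega>, \<lambda>i. x i \<omega>)) \<in> M \<rightarrow>\<^sub>M ?C"
    by (intro measurable_Pair measurable_noise measurable_PiM_single') auto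
  have h: "(\<lambda>\<omega> i. \<tau> i \<omega>) \<in> M \<rightarrow>\<^sub>M ?T"
    by (intro measurable_PiM_single' measurable_noise) auto
  interpret e: prob_space "\<Pi>\<^sub>M i\<in>(UNIV :: nat set). unit_exponential"
    by (intro prob_space_PiM prob_space_unit_exponential)
  interpret c: prob_space "distr M ?C (\<lambda>\<omega>. (K \<omega>, \<lambda>i. x i \<omega>))"
    by (rule prob_space_distr[OF g])
  interpret ce: pair_prob_space "distr M ?C (\<lambda>\<omega>. (K \<omega>, \<lambda>i. x i \<omega>))" "\<Pi>\<^sub>M i\<in>(UNIV :: nat set). unit_exponential" ..
  have sT: "sets (\<Pi>\<^sub>M i\<in>(UNIV :: nat set). unit_exponential) = sets ?T"
    by (intro sets_PiM_cong refl) (simp add: unit_exponential_def)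
  have spT: "space ?T = space (\<Pi>\<^sub>M i\<in>(UNIV :: nat set). unit_exponential)"
    by (rule sets_eq_imp_space_eq[OF sT, symmetric])
  have "emeasure (distr M (configs \<Otimes>\<^sub>M ?C \<Otimes>\<^sub>M ?T) (\<lambda>\<omega>. (N \<omega>, (K \<omega>, \<lambda>i. x i \<omega>), \<lambda>i. \<tau> i \<omega>))) (D \<times> ?F \<times> space ?T)
      = emeasure (distr M configs N) D * (emeasure (distr M ?C (\<lambda>\<omega>. (K \<omega>, \<lambda>i. x i \<omega>))) ?F * 1)"
  proof -
    have "distr M (configs \<Otimes>\<^sub>M ?C \<Otimes>\<^sub>M ?T) (\<lambda>\<omega>. (N \<omega>, (K \<omega>, \<lambda>i. x i \<omega>), \<lambda>i. \<tau> i \<omega>))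
       = distr M configs N \<Otimes>\<^sub>M distr M ?C (\<lambda>\<omega>. (K \<omega>, \<lambda>i. x i \<omega>)) \<Otimes>\<^sub>M (\<Pi>\<^sub>M i\<in>UNIV. unit_exponential)"
      using noise unfolding driving_noise_def by blast
    then show ?thesis
      using D F by (simp only: spT) (subst ce.emeasure_pair_measure_Times e.emeasure_pair_measure_Times,
        auto simp: e.emeasure_space_1 intro!: pair_measureI)+
  qed
  moreover have "emeasure (distr M (configs \<Otimes>\<^sub>M ?C \<Otimes>\<^sub>M ?T) (\<lambda>\<omega>. (N \<omega>, (K \<omega>, \<lambda>i. x i \<omega>), \<lambda>i. \<tau> i \<omega>))) (D \<times> ?F \<times> space ?T)
      = emeasure M {\<omega> \<in> space M. N \<omega> \<in> D \<and> K \<omega> \<in> U \<and> x i \<omega> \<in> B}"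
  proof -
    have S: "D \<times> ?F \<times> space ?T \<in> sets (configs \<Otimes>\<^sub>M ?C \<Otimes>\<^sub>M ?T)"
      by (intro pair_measureI D F sets.top)
    have G: "(\<lambda>\<omega>. (N \<omega>, (K \<omega>, \<lambda>i. x i \<omega>), \<lambda>i. \<tau> i \<omega>)) \<in> M \<rightarrow>\<^sub>M configs \<Otimes>\<^sub>M ?C \<Otimes>\<^sub>M ?T"
      by (intro measurable_Pair measurable_noise(1) g h)
    show ?thesis
      by (subst emeasure_distr[OF G S]) (auto intro!: arg_cong[where f = "emeasure M"] simp: space_PiM)
  qed
  moreover have "emeasure (distr M configs N) D = emeasure M {\<omega> \<in> space M. N \<omega> \<in> D}"
    using D by (subst emeasure_distr) (auto intro!: arg_cong[where f = "emeasure M"])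
  moreover have "emeasure (distr M ?C (\<lambda>\<omega>. (K \<omega>, \<lambda>i. x i \<omega>))) ?F = emeasure M {\<omega> \<in> space M. K \<omega> \<in> U \<and> x i \<omega> \<in> B}"
    using F g by (subst emeasure_distr) (auto intro!: arg_cong[where f = "emeasure M"] simp: space_PiM)
  ultimately show ?thesis by simp
qed

lemma initial_count_indep:
  assumes D: "D \<in> sets configs" and B: "B \<in> sets borel"
  shows "(\<integral>\<^sup>+\<omega>. initial_count K x B \<omega> * indicator D (N \<omega>) \<partial>M)
    = emeasure M {\<omega> \<in> space M. N \<omega> \<in> D} * (\<integral>\<^sup>+\<omega>. initial_count K x B \<omega> \<partial>M)"
proof -
  let ?E = "\<lambda>i. {\<omega> \<in> space M. K \<omega> \<in> {enat i<..} \<and> x i \<omega> \<in> B}"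
  let ?F = "\<lambda>i. {\<omega> \<in> space M. N \<omega> \<in> D \<and> K \<omega> \<in> {enat i<..} \<and> x i \<omega> \<in> B}"
  have E: "?E i \<in> sets M" and F: "?F i \<in> sets M" for i
  proof -
    have N: "N -` D \<inter> space M \<in> sets M" by (rule measurable_sets[OF measurable_noise(1) D])
    have X: "x i -` B \<inter> space M \<in> sets M" by (rule measurable_sets[OF measurable_noise(3) B])
    have U: "K -` {enat i<..} \<inter> space M \<in> sets M" by (rule measurable_sets[OF measurable_noise(2)]) simp
    have "?E i = (K -` {enat i<..} \<inter> space M) \<inter> (x i -` B \<inter> space M)"
      "?F i = (N -` D \<inter> space M) \<inter> ((K -` {enat i<..} \<inter> space M) \<inter> (x i -` B \<inter> space M))" by blast+
    then show "?E i \<in> sets M" "?F i \<in> sets M" using N X U by simp_all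
  qed
  have "(\<integral>\<^sup>+\<omega>. initial_count K x B \<omega> * indicator D (N \<omega>) \<partial>M) = (\<integral>\<^sup>+\<omega>. (\<Sum>i. indicator (?F i) \<omega>) \<partial>M)"
    unfolding initial_count_eq_suminf ennreal_suminf_multc[symmetric]
    by (intro nn_integral_cong suminf_cong) (auto simp: indicator_def)
  also have "\<dots> = (\<Sum>i. \<integral>\<^sup>+\<omega>. indicator (?F i) \<omega> \<partial>M)"
    by (rule nn_integral_suminf) (rule borel_measurable_indicator[OF F])
  also have "\<dots> = (\<Sum>i. emeasure M (?F i))"
    by (rule suminf_cong) (rule nn_integral_indicator[OF F])
  also have "\<dots> = (\<Sum>i. emeasure M {\<omega> \<in> space M. N \<omega> \<in> D} * emeasure M (?E i))"
    by (rule suminf_cong) (rule noise_indep[OF D _ B], simp)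
  also have "\<dots> = emeasure M {\<omega> \<in> space M. N \<omega> \<in> D} * (\<Sum>i. emeasure M (?E i))" by simp
  also have "(\<Sum>i. emeasure M (?E i)) = (\<Sum>i. \<integral>\<^sup>+\<omega>. indicator (?E i) \<omega> \<partial>M)"
    by (rule suminf_cong) (rule nn_integral_indicator[OF E, symmetric])
  also have "\<dots> = (\<integral>\<^sup>+\<omega>. (\<Sum>i. indicator (?E i) \<omega>) \<partial>M)"
    by (rule nn_integral_suminf[symmetric]) (rule borel_measurable_indicator[OF E])
  also have "\<dots> = (\<integral>\<^sup>+\<omega>. initial_count K x B \<omega> \<partial>M)"
    unfolding initial_count_eq_suminf
    by (intro nn_integral_cong suminf_cong) (auto simp: indicator_def)
  finally show ?thesis .
qed

section \<open>The intensity of the initial configuration\<close>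

definition mean_count :: "'a set \<Rightarrow> ennreal" where
  "mean_count B = (\<integral>\<^sup>+\<omega>. initial_count K x B \<omega> \<partial>M)"

text \<open>The enumeration is injective, so indices and points have equal counts. This makes the
  mean a functional of \<mu> alone, to which translation invariance and the moment hypothesis
  apply.\<close>

lemma mean_count_eq:
  assumes B: "bounded_borel B"
  shows "mean_count B = (\<integral>\<^sup>+\<eta>. of_nat (card (\<eta> \<inter> B)) \<partial>\<mu>)"
proof -
  have init: "initial_points K x \<in> M \<rightarrow>\<^sub>M configs" "distr M configs (initial_points K x) = \<mu>"
    and inj: "\<And>\<omega>. \<omega> \<in> space M \<Longrightarrow> inj_on (\<lambda>i. x i \<omega>) {i. enat i < K \<omega>}"
    using noise by (auto simp: driving_noise_def)
  have "mean_count B = (\<integral>\<^sup>+\<omega>. of_nat (card (initial_points K x \<omega> \<inter> B)) \<partial>M)"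
    unfolding mean_count_def
  proof (rule nn_integral_cong)
    fix \<omega> assume \<omega>: "\<omega> \<in> space M"
    let ?I = "{i. enat i < K \<omega> \<and> x i \<omega> \<in> B}"
    have eq: "initial_points K x \<omega> \<inter> B = (\<lambda>i. x i \<omega>) ` ?I" unfolding initial_points_def by blast
    have inj': "inj_on (\<lambda>i. x i \<omega>) ?I" by (rule inj_on_subset[OF inj[OF \<omega>]]) blast
    have "finite (initial_points K x \<omega> \<inter> B)"
      by (rule finite_config_Int[OF measurable_space[OF init(1) \<omega>] B])
    then have "finite ?I" unfolding eq by (rule finite_imageD[OF _ inj'])
    then show "initial_count K x B \<omega> = of_nat (card (initial_points K x \<omega> \<inter> B))"
      unfolding eq initial_count_def using card_image[OF inj'] by simp
  qed
  also have "\<dots> = (\<integral>\<^sup>+\<eta>. of_nat (card (\<eta> \<inter> B)) \<partial>distr M configs (initial_points K x))"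
    by (rule nn_integral_distr[symmetric, OF init(1)])
      (simp, rule measurable_compose[OF measurable_card[OF B]], simp)
  finally show ?thesis unfolding init(2) .
qed

lemma mean_count_translate:
  assumes B: "bounded_borel B"
  shows "mean_count ((\<lambda>z. z - v) ` B) = mean_count B"
proof -
  have sets_mu: "sets \<mu> = sets configs"
    using noise by (auto simp: driving_noise_def)
  have "(\<integral>\<^sup>+\<eta>. of_nat (card (\<eta> \<inter> B)) \<partial>\<mu>) = (\<integral>\<^sup>+\<eta>. of_nat (card (\<eta> \<inter> B)) \<partial>distr \<mu> configs (\<lambda>\<eta>. (\<lambda>z. z + v) ` \<eta>))"
    using invariant by (simp add: translation_invariant_def)
  also have "\<dots> = (\<integral>\<^sup>+\<eta>. of_nat (card ((\<lambda>z. z + v) ` \<eta> \<inter> B)) \<partial>\<mu>)"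
  proof (rule nn_integral_distr)
    show "(\<lambda>\<eta>. (\<lambda>z. z + v) ` \<eta>) \<in> \<mu> \<rightarrow>\<^sub>M configs"
      using measurable_translate[of v] by (simp cong: measurable_cong_sets add: sets_mu)
    show "(\<lambda>\<eta>. of_nat (card (\<eta> \<inter> B))) \<in> borel_measurable (distr \<mu> configs (\<lambda>\<eta>. (\<lambda>z. z + v) ` \<eta>))"
      by (simp, rule measurable_compose[OF measurable_card[OF B]], simp)
  qed
  finally show ?thesis
    by (simp add: mean_count_eq[OF B] mean_count_eq[OF bounded_borel_translate[OF B]] card_translate_Int)
qed

lemma mean_count_finite:
  assumes "bounded_borel B"
  shows "mean_count B < \<infinity>"
  using moment assms
  by (simp add: mean_count_eq finite_first_moment_def ennreal_of_nat_eq_real_of_nat)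

text \<open>Uniqueness of Lebesgue measure: both sides are the integral over \<open>y\<close> of the mean number of
  points \<open>z\<close> with \<open>z \<in> A\<close> and \<open>z + y \<in> B\<close>.\<close>

lemma mean_count_symmetric:
  assumes A: "bounded_borel A" and B: "bounded_borel B"
  shows "mean_count A * emeasure lborel B = mean_count B * emeasure lborel A"
proof -
  have [measurable]: "A \<in> sets borel" "B \<in> sets borel" using A B by (auto simp: bounded_borel_def)
  \<comment> \<open>Tonelli, with the integral over \<open>y\<close> carried out first: it gives the
    same \<open>c\<close> for every point \<open>z\<close>. It is used with \<open>z + y\<close> and
    with \<open>z - y\<close>.\<close>
  have swap: "(\<integral>\<^sup>+y. mean_count {z. z \<in> S \<and> f z y \<in> T} \<partial>lborel)
      = mean_count S * c"
    if [measurable]: "S \<in> sets borel" "T \<in> sets borel" and f[measurable]: "(\<lambda>(z, y). f z y) \<in> borel \<Otimes>\<^sub>M borel \<rightarrow>\<^sub>M borel"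
      and c: "\<And>z. (\<integral>\<^sup>+y. indicator T (f z y) \<partial>lborel) = c"
    for S T and f :: "'a \<Rightarrow> 'a \<Rightarrow> 'a" and c
  proof -
    interpret pair_sigma_finite M lborel ..
    have fx[measurable]: "(\<lambda>(\<omega>, y). f (x i \<omega>) y) \<in> M \<Otimes>\<^sub>M lborel \<rightarrow>\<^sub>M borel" for i
      using measurable_compose[OF _ f, of "\<lambda>(\<omega>, y). (x i \<omega>, y)" "M \<Otimes>\<^sub>M lborel"] by (simp add: split_beta')
    let ?g = "\<lambda>\<omega> y. \<Sum>i. indicator {enat i<..} (K \<omega>) * indicator S (x i \<omega>) * indicator T (f (x i \<omega>) y) :: ennreal"
    have ind[measurable]: "(\<lambda>\<omega>. indicator {enat i<..} (K \<omega>) :: ennreal) \<in> borel_measurable M" for i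
      by (rule measurable_compose[OF measurable_noise(2)]) simp
    have "(\<integral>\<^sup>+y. mean_count {z. z \<in> S \<and> f z y \<in> T} \<partial>lborel) = (\<integral>\<^sup>+y. (\<integral>\<^sup>+\<omega>. ?g \<omega> y \<partial>M) \<partial>lborel)"
      unfolding mean_count_def initial_count_eq_suminf
      by (intro nn_integral_cong suminf_cong) (simp add: indicator_def)
    also have "\<dots> = (\<integral>\<^sup>+\<omega>. (\<integral>\<^sup>+y. ?g \<omega> y \<partial>lborel) \<partial>M)"
      by (rule Fubini') measurable
    also have "\<dots> = (\<integral>\<^sup>+\<omega>. initial_count K x S \<omega> * c \<partial>M)"
    proof (rule nn_integral_cong)
      fix \<omega> assume "\<omega> \<in> space M"
      have fz: "(\<lambda>y. f z y) \<in> borel \<rightarrow>\<^sub>M borel" for z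
        using measurable_compose[OF measurable_Pair1'[of z] f] by simp
      have [measurable]: "(\<lambda>y. indicator T (f z y) :: ennreal) \<in> borel_measurable lborel" for z
        using measurable_compose[OF fz, of "indicator T"] by simp
      have "(\<integral>\<^sup>+y. ?g \<omega> y \<partial>lborel) = (\<Sum>i. indicator {enat i<..} (K \<omega>) * indicator S (x i \<omega>) * c)"
        by (subst nn_integral_suminf) (auto simp: nn_integral_cmult c)
      then show "(\<integral>\<^sup>+y. ?g \<omega> y \<partial>lborel) = initial_count K x S \<omega> * c"
        by (simp add: initial_count_eq_suminf)
    qed
    also have "\<dots> = mean_count S * c"
      unfolding mean_count_def by (rule nn_integral_multc) (rule measurable_initial_count, fact)
    finally show ?thesis .
  qed
  have shift: "(\<integral>\<^sup>+y. indicator T (z + y) \<partial>lborel) = emeasure lborel T" if "T \<in> sets borel" for z :: 'a and T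
  proof -
    have "emeasure lborel T = (\<integral>\<^sup>+y. indicator T y \<partial>distr lborel borel ((+) z))"
      using that by (simp add: lborel_distr_plus)
    also have "\<dots> = (\<integral>\<^sup>+y. indicator T (z + y) \<partial>lborel)" using that by (subst nn_integral_distr) auto
    finally show ?thesis by simp
  qed
  have reflect: "(\<integral>\<^sup>+y. indicator T (z - y) \<partial>lborel) = emeasure lborel T" if "T \<in> sets borel" for z :: 'a and T
  proof -
    have "lborel = distr lborel borel (\<lambda>y :: 'a. z + (- 1) *\<^sub>R y)"
      using lborel_affine[of "- 1" z] by (simp add: density_1)
    then have "emeasure lborel T = (\<integral>\<^sup>+y. indicator T y \<partial>distr lborel borel (\<lambda>y :: 'a. z + (- 1) *\<^sub>R y))"
      using that by simp
    also have "\<dots> = (\<integral>\<^sup>+y. indicator T (z + (- 1) *\<^sub>R y) \<partial>lborel)" using that by (subst nn_integral_distr) auto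
    finally show ?thesis by simp
  qed
  \<comment> \<open>The two sets are translates of each other by \<open>y\<close>; this is where
    invariance of \<mu> enters.\<close>
  have "mean_count {z. z \<in> A \<and> z + y \<in> B} = mean_count {z. z \<in> B \<and> z - y \<in> A}" for y
  proof -
    have "{z. z \<in> A \<and> z + y \<in> B} = (\<lambda>z. z - y) ` {z. z \<in> B \<and> z - y \<in> A}" by force
    moreover have "bounded_borel {z. z \<in> B \<and> z - y \<in> A}"
    proof -
      have "(\<lambda>z. z - y) -` A \<inter> space borel \<in> sets borel" by measurable
      moreover have "{z. z \<in> B \<and> z - y \<in> A} = B \<inter> ((\<lambda>z. z - y) -` A \<inter> space borel)" by auto
      ultimately show ?thesis using bounded_borel_Int[OF B] by simp
    qed
    ultimately show ?thesis using mean_count_translate by simp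
  qed
  moreover have "(\<integral>\<^sup>+y. mean_count {z. z \<in> A \<and> z + y \<in> B} \<partial>lborel) = mean_count A * emeasure lborel B"
    by (rule swap) (simp_all add: shift)
  moreover have "(\<integral>\<^sup>+y. mean_count {z. z \<in> B \<and> z - y \<in> A} \<partial>lborel) = mean_count B * emeasure lborel A"
    by (rule swap) (simp_all add: reflect)
  ultimately show ?thesis by simp
qed

text \<open>The symmetric identity is applied with the unit cube, whose volume is 1; its mean count
  is the intensity.\<close>

lemma intensity:
  obtains \<rho> where "0 \<le> \<rho>" "\<And>B. bounded_borel B \<Longrightarrow> mean_count B = ennreal (\<rho> * measure lborel B)"
proof -
  let ?Q = "cbox 0 (One :: 'a)"
  have Q: "bounded_borel ?Q" by (simp add: bounded_borel_def bounded_cbox)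
  have Q1: "emeasure lborel ?Q = 1" by (simp add: emeasure_lborel_cbox)
  show ?thesis
  proof (rule that[of "enn2real (mean_count ?Q)"])
    fix B :: "'a set" assume B: "bounded_borel B"
    have "mean_count B = mean_count ?Q * emeasure lborel B"
      using mean_count_symmetric[OF B Q] by (simp add: Q1)
    also have "\<dots> = ennreal (enn2real (mean_count ?Q)) * ennreal (measure lborel B)"
      using mean_count_finite[OF Q] by (simp add: emeasure_lborel_bounded_borel[OF B] ennreal_enn2real)
    finally show "mean_count B = ennreal (enn2real (mean_count ?Q) * measure lborel B)"
      by (simp add: ennreal_mult)
  qed simp
qed

end

section \<open>Comparing the two dynamics\<close>

text \<open>On a bounded set the left limit agrees with the path at some earlier time, and for
  \<open>s > 0\<close> this time can be taken positive, where the path is known to be a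
  configuration in \<Lambda>.\<close>

lemma left_limit_config:
  assumes lim: "has_left_limits \<xi>" and s: "0 < s"
    and config: "\<And>r. 0 \<le> r \<Longrightarrow> locally_finite (\<xi> r) \<and> \<xi> r \<subseteq> \<Lambda>"
  shows "locally_finite (left_limit \<xi> s)" "left_limit \<xi> s \<subseteq> \<Lambda>"
proof -
  have pos: "\<forall>\<^sub>F r in at_left s. r \<in> {0<..<s}"
    using s by (rule eventually_at_leftI[where a = 0, rotated]) auto
  show "locally_finite (left_limit \<xi> s)" unfolding locally_finite_def
  proof (intro allI impI)
    fix B :: "'a set" assume B: "bounded B"
    then have "\<forall>\<^sub>F r in at_left s. \<xi> r \<inter> B = left_limit \<xi> s \<inter> B"
      using lim s unfolding has_left_limits_def by blast
    with pos have "\<forall>\<^sub>F r in at_left s. r \<in> {0<..<s} \<and> \<xi> r \<inter> B = left_limit \<xi> s \<inter> B"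
      by (rule eventually_conj)
    then obtain r where "r \<in> {0<..<s}" "\<xi> r \<inter> B = left_limit \<xi> s \<inter> B"
      using eventually_happens'[OF trivial_limit_at_left_real] by blast
    with config[of r] B show "finite (left_limit \<xi> s \<inter> B)"
      unfolding locally_finite_def by (metis greaterThanLessThan_iff less_imp_le)
  qed
  show "left_limit \<xi> s \<subseteq> \<Lambda>"
  proof
    fix y assume "y \<in> left_limit \<xi> s"
    then have "\<forall>\<^sub>F r in at_left s. y \<in> \<xi> r" by (simp add: left_limit_def)
    with pos have "\<forall>\<^sub>F r in at_left s. r \<in> {0<..<s} \<and> y \<in> \<xi> r"
      by (rule eventually_conj)
    then obtain r where "r \<in> {0<..<s}" "y \<in> \<xi> r"
      using eventually_happens'[OF trivial_limit_at_left_real] by blast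
    then show "y \<in> \<Lambda>" using config[of r] by auto
  qed
qed

text \<open>Either \<open>w\<close> is at most \<open>1 / a\<close>, or it is at most
  \<open>a\<close> times its square. Integrated over an event, this replaces the Cauchy-Schwarz
  inequality, with \<open>a\<close> left to be chosen.\<close>

lemma ennreal_le_square_plus_inverse:
  fixes w :: ennreal
  assumes "0 < a"
  shows "w \<le> ennreal a * w\<^sup>2 + ennreal (1 / a)"
proof (cases w)
  case (real r)
  have "r \<le> a * r\<^sup>2 + 1 / a"
  proof (cases "r \<le> 1 / a")
    case True
    then show ?thesis using assms by (simp add: add_increasing)
  next
    case False
    then have "1 * r \<le> (a * r) * r" using assms real by (intro mult_right_mono) (auto simp: field_simps)
    moreover have "0 < 1 / a" using assms by simp
    moreover have "(a * r) * r = a * r\<^sup>2" by (simp add: power2_eq_square)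
    ultimately show ?thesis by linarith
  qed
  then have "ennreal r \<le> ennreal (a * r\<^sup>2 + 1 / a)" by (rule ennreal_leI)
  also have "\<dots> = ennreal a * (ennreal r)\<^sup>2 + ennreal (1 / a)"
    using assms real by (simp add: ennreal_plus ennreal_mult ennreal_power)
  finally show ?thesis by (simp add: real)
next
  case top
  then show ?thesis using assms by (simp add: ennreal_mult_top)
qed

locale local_coupling = driven M N K x \<tau> \<mu>
  for M :: "'w measure" and N :: "'w \<Rightarrow> ('a::euclidean_space \<times> real \<times> real \<times> real) set"
    and K :: "'w \<Rightarrow> enat" and x :: "nat \<Rightarrow> 'w \<Rightarrow> 'a" and \<tau> :: "nat \<Rightarrow> 'w \<Rightarrow> real" and \<mu> :: "'a set measure" +
  fixes R t :: real and \<nu> :: "'a set measure" and X :: "real \<Rightarrow> 'w \<Rightarrow> 'a set"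
    and \<kappa> :: "'a set \<Rightarrow> 'a set \<Rightarrow> 'a set measure" and Y :: "'a set \<Rightarrow> real \<Rightarrow> 'w \<Rightarrow> 'a set"
  assumes R: "0 < R" and t: "0 \<le> t"
    and X: "birth_death_process M N (marked_points K x \<tau>) UNIV (birth_rate R) X"
    and \<kappa>: "\<And>\<Lambda>. bounded_borel \<Lambda> \<Longrightarrow> conditional_law \<nu> \<Lambda> (\<kappa> \<Lambda>)"
    and Y: "\<And>\<Lambda>. bounded_borel \<Lambda> \<Longrightarrow>
      birth_death_process M N (marked_points K x \<tau>) \<Lambda> (local_birth_rate R (\<kappa> \<Lambda>)) (Y \<Lambda>)"
begin

lemma measurable_X: "0 \<le> s \<Longrightarrow> X s \<in> M \<rightarrow>\<^sub>M configs"
  using X by (auto simp: birth_death_process_def intro: measurable_configs_in)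

lemma measurable_Y: "bounded_borel \<Lambda> \<Longrightarrow> 0 \<le> s \<Longrightarrow> Y \<Lambda> s \<in> M \<rightarrow>\<^sub>M configs"
  using Y[of \<Lambda>] by (auto simp: birth_death_process_def intro: measurable_configs_in)

text \<open>Equality of the rates combines two facts about range: at a configuration in the window
  the local rate is \<open>birth_rate\<close> itself, and \<open>birth_rate\<close> only reads the
  ball on which the two left limits agree.\<close>

lemma AE_coupled:
  assumes L: "bounded_borel \<Lambda>'"
  shows "AE \<omega> in M. coupled_solutions (N \<omega>) (marked_points K x \<tau> \<omega>) \<Lambda>' (birth_rate R) (local_birth_rate R (\<kappa> \<Lambda>'))
    (\<lambda>s. X s \<omega>) (\<lambda>s. Y \<Lambda>' s \<omega>) R t"
  using birth_death_process_graphical[OF X] birth_death_process_graphical[OF Y[OF L]]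
    AE_birth_count_finite[OF poisson L t] AE_no_birth_at_0[OF poisson L] AE_space
proof eventually_elim
  case (elim \<omega>)
  have XC: "locally_finite (X r \<omega>) \<and> X r \<omega> \<subseteq> UNIV" if "0 \<le> r" for r
    using measurable_space[OF measurable_X[OF that] elim(5)] by (simp add: space_configs)
  have YC: "locally_finite (Y \<Lambda>' r \<omega>) \<and> Y \<Lambda>' r \<omega> \<subseteq> \<Lambda>'" if "0 \<le> r" for r
  proof -
    have "Y \<Lambda>' r \<in> M \<rightarrow>\<^sub>M configs_in \<Lambda>'" using Y[OF L] that by (simp add: birth_death_process_def)
    from measurable_space[OF this elim(5)] show ?thesis by (simp add: space_configs_in)
  qed
  have lX: "has_left_limits (\<lambda>s. X s \<omega>)" and lY: "has_left_limits (\<lambda>s. Y \<Lambda>' s \<omega>)"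
    using elim(1,2) unfolding graphical_solution_def by blast+
  note XL = left_limit_config(1)[OF lX _ XC]
  note YL = left_limit_config[OF lY _ YC]
  show ?case
  proof
    show "birth_rate R y (left_limit (\<lambda>s. X s \<omega>) s) \<le> 1" if "0 < s" for y s
      by (rule birth_rate_le_1[OF XL[OF that]])
    show "local_birth_rate R (\<kappa> \<Lambda>') y (left_limit (\<lambda>s. Y \<Lambda>' s \<omega>) s) \<le> 1" if "0 < s" for y s
      by (rule local_birth_rate_le_1[OF \<kappa>[OF L] YL[OF that]])
    show "birth_rate R y (left_limit (\<lambda>s. X s \<omega>) s) = local_birth_rate R (\<kappa> \<Lambda>') y (left_limit (\<lambda>s. Y \<Lambda>' s \<omega>) s)"
      if "0 < s" "ball y (2 * R) \<subseteq> \<Lambda>'"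
        "left_limit (\<lambda>s. X s \<omega>) s \<inter> ball y (2 * R) = left_limit (\<lambda>s. Y \<Lambda>' s \<omega>) s \<inter> ball y (2 * R)" for y s
      using local_birth_rate_eq[OF \<kappa>[OF L] YL[OF that(1)] that(2)]
        birth_rate_local[OF XL[OF that(1)] YL(1)[OF that(1)] that(3)] by (simp only:)
    show "finite (N \<omega> \<inter> birth_window \<Lambda>' t)"
      using elim(3) by (simp add: birth_count_def emeasure_count_space split: if_splits)
  qed (use elim R in auto)
qed

text \<open>One random variable dominates both counts: the possible births in \<Lambda> plus the
  initial points in \<Lambda>. The two summands are kept apart because they are estimated by
  different means.\<close>

lemma AE_count_le:
  assumes L: "bounded_borel \<Lambda>" "bounded_borel \<Lambda>'" "\<Lambda> \<subseteq> \<Lambda>'"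
  shows "AE \<omega> in M. of_nat (card (X t \<omega> \<inter> \<Lambda>)) \<le> birth_count \<Lambda> t (N \<omega>) + initial_count K x \<Lambda> \<omega>
    \<and> of_nat (card (Y \<Lambda>' t \<omega> \<inter> \<Lambda>)) \<le> birth_count \<Lambda> t (N \<omega>) + initial_count K x \<Lambda> \<omega>"
  using AE_coupled[OF L(2)] AE_space
proof eventually_elim
  case (elim \<omega>)
  interpret coupled_solutions "N \<omega>" "marked_points K x \<tau> \<omega>" \<Lambda>' "birth_rate R" "local_birth_rate R (\<kappa> \<Lambda>')"
    "\<lambda>s. X s \<omega>" "\<lambda>s. Y \<Lambda>' s \<omega>" R t by fact
  have B: "\<Lambda> \<in> sets borel" using L by (simp add: bounded_borel_def)
  have no0: "(y, u, r, 0) \<notin> N \<omega>" if "y \<in> \<Lambda>" "0 \<le> u" "0 \<le> r" for y u r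
    using no_birth_at_0 that L by blast
  have fin: "finite (X t \<omega> \<inter> \<Lambda>)" "finite (Y \<Lambda>' t \<omega> \<inter> \<Lambda>)"
    using measurable_space[OF measurable_X[OF t] elim(2)] measurable_space[OF measurable_Y[OF L(2) t] elim(2)]
    by (auto intro: finite_config_Int L)
  have "emeasure (count_space UNIV) (X t \<omega> \<inter> \<Lambda>)
      \<le> birth_count \<Lambda> t (N \<omega>) + emeasure (count_space UNIV) (marked_points K x \<tau> \<omega> \<inter> \<Lambda> \<times> UNIV)"
    by (rule graphical_solution_count_le[OF sol(1) B subset_UNIV t rate_le(1) no0])
  moreover have "emeasure (count_space UNIV) (Y \<Lambda>' t \<omega> \<inter> \<Lambda>)
      \<le> birth_count \<Lambda> t (N \<omega>) + emeasure (count_space UNIV) (marked_points K x \<tau> \<omega> \<inter> \<Lambda> \<times> UNIV)"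
    by (rule graphical_solution_count_le[OF sol(2) B L(3) t rate_le(2) no0])
  moreover have "birth_count \<Lambda> t (N \<omega>) + emeasure (count_space UNIV) (marked_points K x \<tau> \<omega> \<inter> \<Lambda> \<times> UNIV)
      \<le> birth_count \<Lambda> t (N \<omega>) + initial_count K x \<Lambda> \<omega>"
    by (intro add_left_mono marked_points_count_le)
  ultimately show ?case using fin by (auto intro: order_trans)
qed

lemma coupling:
  assumes "0 < \<theta>"
  obtains C where "0 < C"
    "\<And>\<Lambda> \<Lambda>'. bounded_borel \<Lambda> \<Longrightarrow> bounded_borel \<Lambda>' \<Longrightarrow> \<Lambda> \<subseteq> \<Lambda>' \<Longrightarrow>
      \<exists>D\<in>sets configs. measure M {\<omega> \<in> space M. N \<omega> \<in> D} \<le> C * measure lborel \<Lambda> * exp (- \<theta> * setdist \<Lambda> (- \<Lambda>')) \<and>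
        (AE \<omega> in M. N \<omega> \<notin> D \<longrightarrow> X t \<omega> \<inter> \<Lambda> = Y \<Lambda>' t \<omega> \<inter> \<Lambda>)"
proof (rule coupling_bound[OF poisson R assms t])
  fix C :: real
  assume C: "0 < C" "\<And>\<Lambda> \<Lambda>'. bounded_borel \<Lambda> \<Longrightarrow> bounded_borel \<Lambda>' \<Longrightarrow> \<Lambda> \<subseteq> \<Lambda>' \<Longrightarrow>
      \<exists>D\<in>sets configs. measure M {\<omega> \<in> space M. N \<omega> \<in> D} \<le> C * measure lborel \<Lambda> * exp (- \<theta> * setdist \<Lambda> (- \<Lambda>')) \<and>
        (\<forall>P H b b' \<xi> \<zeta>. P \<in> space configs \<longrightarrow> coupled_solutions P H \<Lambda>' b b' \<xi> \<zeta> R t \<longrightarrow> P \<notin> D \<longrightarrow>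
          \<xi> t \<inter> \<Lambda> = \<zeta> t \<inter> \<Lambda>)"
  show thesis
  proof (rule that[OF C(1)])
    fix \<Lambda> \<Lambda>' :: "'a set" assume L: "bounded_borel \<Lambda>" "bounded_borel \<Lambda>'" "\<Lambda> \<subseteq> \<Lambda>'"
    from C(2)[OF L] obtain D where D: "D \<in> sets configs"
      "measure M {\<omega> \<in> space M. N \<omega> \<in> D} \<le> C * measure lborel \<Lambda> * exp (- \<theta> * setdist \<Lambda> (- \<Lambda>'))"
      and coup: "\<forall>P H b b' \<xi> \<zeta>. P \<in> space configs \<longrightarrow> coupled_solutions P H \<Lambda>' b b' \<xi> \<zeta> R t \<longrightarrow> P \<notin> D \<longrightarrow>
          \<xi> t \<inter> \<Lambda> = \<zeta> t \<inter> \<Lambda>"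
      by blast
    have "AE \<omega> in M. N \<omega> \<notin> D \<longrightarrow> X t \<omega> \<inter> \<Lambda> = Y \<Lambda>' t \<omega> \<inter> \<Lambda>"
      using AE_coupled[OF L(2)] AE_space
    proof eventually_elim
      case (elim \<omega>)
      from coup[rule_format, OF measurable_space[OF measurable_noise(1) elim(2)] elim(1)] show ?case by blast
    qed
    with D show "\<exists>D\<in>sets configs. measure M {\<omega> \<in> space M. N \<omega> \<in> D} \<le> C * measure lborel \<Lambda> * exp (- \<theta> * setdist \<Lambda> (- \<Lambda>')) \<and>
        (AE \<omega> in M. N \<omega> \<notin> D \<longrightarrow> X t \<omega> \<inter> \<Lambda> = Y \<Lambda>' t \<omega> \<inter> \<Lambda>)"
      by blast
  qed
qed

lemma bad_event_sets: "D \<in> sets configs \<Longrightarrow> {\<omega> \<in> space M. N \<omega> \<in> D} \<in> sets M"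
  using measurable_sets[OF measurable_noise(1), of D] by (simp add: vimage_def Int_def conj_commute)

text \<open>Off the exceptional event the two integrands agree by locality of \<open>f\<close>; on
  it they differ by at most \<open>2 * F\<close>.\<close>

lemma bounded_difference:
  assumes L: "bounded_borel \<Lambda>'" and D: "D \<in> sets configs"
    and agree: "AE \<omega> in M. N \<omega> \<notin> D \<longrightarrow> X t \<omega> \<inter> \<Lambda> = Y \<Lambda>' t \<omega> \<inter> \<Lambda>"
    and f: "f \<in> configs \<rightarrow>\<^sub>M (borel :: real measure)" and F: "\<And>\<eta>. \<eta> \<in> space configs \<Longrightarrow> \<bar>f \<eta>\<bar> \<le> F"
    and loc: "\<And>\<eta>. \<eta> \<in> space configs \<Longrightarrow> f \<eta> = f (\<eta> \<inter> \<Lambda>)"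
  shows "\<bar>(\<integral>\<eta>. f \<eta> \<partial>distr M configs (X t)) - (\<integral>\<eta>. f \<eta> \<partial>distr M configs (Y \<Lambda>' t))\<bar>
    \<le> 2 * F * measure M {\<omega> \<in> space M. N \<omega> \<in> D}"
proof -
  note mX = measurable_X[OF t] and mY = measurable_Y[OF L t]
  have iX: "integrable M (\<lambda>\<omega>. f (X t \<omega>))"
    using measurable_space[OF mX] F by (intro integrable_const_bound[where B = F] measurable_compose[OF mX f]) auto
  have iY: "integrable M (\<lambda>\<omega>. f (Y \<Lambda>' t \<omega>))"
    using measurable_space[OF mY] F by (intro integrable_const_bound[where B = F] measurable_compose[OF mY f]) auto
  let ?E = "{\<omega> \<in> space M. N \<omega> \<in> D}"
  have E: "?E \<in> sets M" by (rule bad_event_sets[OF D])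
  have "\<bar>(\<integral>\<eta>. f \<eta> \<partial>distr M configs (X t)) - (\<integral>\<eta>. f \<eta> \<partial>distr M configs (Y \<Lambda>' t))\<bar>
      = \<bar>\<integral>\<omega>. f (X t \<omega>) - f (Y \<Lambda>' t \<omega>) \<partial>M\<bar>"
    by (simp add: integral_distr[OF mX f] integral_distr[OF mY f] Bochner_Integration.integral_diff[OF iX iY])
  also have "\<dots> \<le> (\<integral>\<omega>. \<bar>f (X t \<omega>) - f (Y \<Lambda>' t \<omega>)\<bar> \<partial>M)" by (rule integral_abs_bound)
  also have "\<dots> \<le> (\<integral>\<omega>. 2 * F * indicator ?E \<omega> \<partial>M)"
  proof (rule integral_mono_AE)
    show "integrable M (\<lambda>\<omega>. \<bar>f (X t \<omega>) - f (Y \<Lambda>' t \<omega>)\<bar>)" using iX iY by simp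
    show "integrable M (\<lambda>\<omega>. 2 * F * indicator ?E \<omega>)" using E by (simp add: emeasure_eq_measure)
    show "AE \<omega> in M. \<bar>f (X t \<omega>) - f (Y \<Lambda>' t \<omega>)\<bar> \<le> 2 * F * indicator ?E \<omega>"
      using agree AE_space
    proof eventually_elim
      case (elim \<omega>)
      have c: "X t \<omega> \<in> space configs" "Y \<Lambda>' t \<omega> \<in> space configs"
        using measurable_space[OF mX elim(2)] measurable_space[OF mY elim(2)] by auto
      show ?case
      proof (cases "N \<omega> \<in> D")
        case True
        then show ?thesis using F[OF c(1)] F[OF c(2)] elim(2) by (simp add: indicator_def)
      next
        case False
        then have "f (X t \<omega>) = f (Y \<Lambda>' t \<omega>)" using loc[OF c(1)] loc[OF c(2)] elim(1) by simp
        then show ?thesis using False by (simp add: indicator_def)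
      qed
    qed
  qed
  also have "\<dots> = 2 * F * measure M ?E" using E by simp
  finally show ?thesis .
qed

text \<open>The difference vanishes off the exceptional event and is at most \<open>2 * c\<close>
  times births plus initial points on it. The births are dependent on that event and are handled by
  their second moment, at the price of the free parameter \<open>a\<close>; the mean of the initial
  points factorises by independence.\<close>

lemma linear_difference:
  assumes L: "bounded_borel \<Lambda>" "bounded_borel \<Lambda>'" "\<Lambda> \<subseteq> \<Lambda>'" and D: "D \<in> sets configs"
    and agree: "AE \<omega> in M. N \<omega> \<notin> D \<longrightarrow> X t \<omega> \<inter> \<Lambda> = Y \<Lambda>' t \<omega> \<inter> \<Lambda>"
    and f: "f \<in> configs \<rightarrow>\<^sub>M (borel :: real measure)"
    and c: "0 \<le> c" "\<And>\<eta>. \<eta> \<in> space configs \<Longrightarrow> \<bar>f \<eta>\<bar> \<le> c * real (card (\<eta> \<inter> \<Lambda>))"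
    and loc: "\<And>\<eta>. \<eta> \<in> space configs \<Longrightarrow> f \<eta> = f (\<eta> \<inter> \<Lambda>)"
    and \<rho>: "0 \<le> \<rho>" "mean_count \<Lambda> = ennreal (\<rho> * measure lborel \<Lambda>)" and a: "0 < a"
    and \<beta>: "measure M {\<omega> \<in> space M. N \<omega> \<in> D} \<le> \<beta>"
  defines "l \<equiv> measure lborel \<Lambda>"
  shows "\<bar>(\<integral>\<eta>. f \<eta> \<partial>distr M configs (X t)) - (\<integral>\<eta>. f \<eta> \<partial>distr M configs (Y \<Lambda>' t))\<bar>
    \<le> 2 * c * (a * (l * t + (l * t)\<^sup>2) + \<beta> / a + \<beta> * (\<rho> * l))"
proof -
  note mX = measurable_X[OF t] and mY = measurable_Y[OF L(2) t]
  let ?W = "\<lambda>\<omega>. birth_count \<Lambda> t (N \<omega>)" and ?I = "initial_count K x \<Lambda>"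
  let ?E = "{\<omega> \<in> space M. N \<omega> \<in> D}"
  have E[measurable]: "?E \<in> sets M" by (rule bad_event_sets[OF D])
  have [measurable]: "?W \<in> borel_measurable M"
    by (rule measurable_compose[OF measurable_noise(1) measurable_birth_count[OF L(1)]])
  have [measurable]: "?I \<in> borel_measurable M"
    by (rule measurable_initial_count) (use L in \<open>simp add: bounded_borel_def\<close>)
  have b0: "0 \<le> \<beta>" using \<beta> measure_nonneg order_trans by blast
  have l0: "0 \<le> l" by (simp add: l_def)
  have EB: "emeasure M ?E \<le> ennreal \<beta>" using \<beta> by (simp add: emeasure_eq_measure ennreal_leI)
  have second: "(\<integral>\<^sup>+\<omega>. (?W \<omega>)\<^sup>2 \<partial>M) \<le> ennreal (l * t + (l * t)\<^sup>2)"
    unfolding l_def by (rule birth_count_second_moment[OF poisson L(1) t])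
  \<comment> \<open>Used twice: on the exceptional event with parameter \<open>a\<close>, and on the
    whole space with parameter 1 to obtain integrability.\<close>
  have WE: "(\<integral>\<^sup>+\<omega>. ?W \<omega> * indicator A \<omega> \<partial>M)
      \<le> ennreal s * ennreal (l * t + (l * t)\<^sup>2) + ennreal (1 / s) * emeasure M A"
    if [measurable]: "A \<in> sets M" and "0 < s" for A s
  proof -
    have "(\<integral>\<^sup>+\<omega>. ?W \<omega> * indicator A \<omega> \<partial>M) \<le> (\<integral>\<^sup>+\<omega>. ennreal s * (?W \<omega>)\<^sup>2 + ennreal (1 / s) * indicator A \<omega> \<partial>M)"
      using ennreal_le_square_plus_inverse[OF \<open>0 < s\<close>]
      by (intro nn_integral_mono) (auto simp: indicator_def)
    also have "\<dots> = ennreal s * (\<integral>\<^sup>+\<omega>. (?W \<omega>)\<^sup>2 \<partial>M) + ennreal (1 / s) * emeasure M A"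
      by (simp add: nn_integral_add nn_integral_cmult nn_integral_cmult_indicator)
    also have "\<dots> \<le> ennreal s * ennreal (l * t + (l * t)\<^sup>2) + ennreal (1 / s) * emeasure M A"
      by (intro add_right_mono mult_left_mono second) simp
    finally show ?thesis .
  qed
  have bnd: "AE \<omega> in M. ennreal \<bar>f (X t \<omega>)\<bar> \<le> ennreal c * (?W \<omega> + ?I \<omega>) \<and>
      ennreal \<bar>f (Y \<Lambda>' t \<omega>)\<bar> \<le> ennreal c * (?W \<omega> + ?I \<omega>)"
    using AE_count_le[OF L] AE_space
  proof eventually_elim
    case (elim \<omega>)
    have le: "ennreal \<bar>f \<eta>\<bar> \<le> ennreal c * of_nat (card (\<eta> \<inter> \<Lambda>))" if "\<eta> \<in> space configs" for \<eta>
      using ennreal_leI[OF c(2)[OF that]] c(1) by (simp add: ennreal_mult ennreal_of_nat_eq_real_of_nat)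
    have step: "ennreal c * u \<le> ennreal c * v" if "u \<le> v" for u v
      by (rule mult_left_mono[OF that]) simp
    show ?case
      by (rule conjI[OF order_trans[OF le[OF measurable_space[OF mX elim(2)]] step[OF conjunct1[OF elim(1)]]]
            order_trans[OF le[OF measurable_space[OF mY elim(2)]] step[OF conjunct2[OF elim(1)]]]])
  qed
  have finite: "(\<integral>\<^sup>+\<omega>. ennreal c * (?W \<omega> + ?I \<omega>) \<partial>M) < \<infinity>"
  proof -
    have "(\<integral>\<^sup>+\<omega>. ?W \<omega> * indicator (space M) \<omega> \<partial>M) < \<infinity>"
      by (rule order_le_less_trans[OF WE[OF sets.top zero_less_one]])
        (simp add: emeasure_space_1 ennreal_add_eq_top less_top[symmetric])
    moreover have "(\<integral>\<^sup>+\<omega>. ?W \<omega> * indicator (space M) \<omega> \<partial>M) = (\<integral>\<^sup>+\<omega>. ?W \<omega> \<partial>M)"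
      by (rule nn_integral_cong) simp
    ultimately have "(\<integral>\<^sup>+\<omega>. ?W \<omega> \<partial>M) < \<infinity>" by (simp only:)
    moreover have "(\<integral>\<^sup>+\<omega>. ?I \<omega> \<partial>M) < \<infinity>" using \<rho>(2) by (simp add: mean_count_def)
    ultimately show ?thesis by (simp add: nn_integral_cmult nn_integral_add ennreal_mult_less_top)
  qed
  have iX: "integrable M (\<lambda>\<omega>. f (X t \<omega>))"
  proof (rule integrableI_bounded)
    have "(\<integral>\<^sup>+\<omega>. ennreal (norm (f (X t \<omega>))) \<partial>M) \<le> (\<integral>\<^sup>+\<omega>. ennreal c * (?W \<omega> + ?I \<omega>) \<partial>M)"
      using bnd by (intro nn_integral_mono_AE) auto
    then show "(\<integral>\<^sup>+\<omega>. ennreal (norm (f (X t \<omega>))) \<partial>M) < \<infinity>" using finite by (rule order_le_less_trans)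
  qed (rule measurable_compose[OF mX f])
  have iY: "integrable M (\<lambda>\<omega>. f (Y \<Lambda>' t \<omega>))"
  proof (rule integrableI_bounded)
    have "(\<integral>\<^sup>+\<omega>. ennreal (norm (f (Y \<Lambda>' t \<omega>))) \<partial>M) \<le> (\<integral>\<^sup>+\<omega>. ennreal c * (?W \<omega> + ?I \<omega>) \<partial>M)"
      using bnd by (intro nn_integral_mono_AE) auto
    then show "(\<integral>\<^sup>+\<omega>. ennreal (norm (f (Y \<Lambda>' t \<omega>))) \<partial>M) < \<infinity>" using finite by (rule order_le_less_trans)
  qed (rule measurable_compose[OF mY f])
  have "ennreal \<bar>(\<integral>\<eta>. f \<eta> \<partial>distr M configs (X t)) - (\<integral>\<eta>. f \<eta> \<partial>distr M configs (Y \<Lambda>' t))\<bar>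
      = ennreal (norm (\<integral>\<omega>. f (X t \<omega>) - f (Y \<Lambda>' t \<omega>) \<partial>M))"
    by (simp add: integral_distr[OF mX f] integral_distr[OF mY f] Bochner_Integration.integral_diff[OF iX iY])
  also have "\<dots> \<le> (\<integral>\<^sup>+\<omega>. ennreal (norm (f (X t \<omega>) - f (Y \<Lambda>' t \<omega>))) \<partial>M)"
    using iX iY by (intro integral_norm_bound_ennreal) simp
  also have "\<dots> \<le> (\<integral>\<^sup>+\<omega>. ennreal (2 * c) * (?W \<omega> * indicator ?E \<omega> + ?I \<omega> * indicator D (N \<omega>)) \<partial>M)"
  proof (rule nn_integral_mono_AE)
    show "AE \<omega> in M. ennreal (norm (f (X t \<omega>) - f (Y \<Lambda>' t \<omega>)))
        \<le> ennreal (2 * c) * (?W \<omega> * indicator ?E \<omega> + ?I \<omega> * indicator D (N \<omega>))"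
      using agree bnd AE_space
    proof eventually_elim
      case (elim \<omega>)
      have cf: "X t \<omega> \<in> space configs" "Y \<Lambda>' t \<omega> \<in> space configs"
        using measurable_space[OF mX elim(3)] measurable_space[OF mY elim(3)] by auto
      show ?case
      proof (cases "N \<omega> \<in> D")
        case True
        have "ennreal (norm (f (X t \<omega>) - f (Y \<Lambda>' t \<omega>))) \<le> ennreal \<bar>f (X t \<omega>)\<bar> + ennreal \<bar>f (Y \<Lambda>' t \<omega>)\<bar>"
          unfolding real_norm_def by (simp flip: ennreal_plus add: ennreal_leI abs_triangle_ineq4)
        also have "\<dots> \<le> ennreal c * (?W \<omega> + ?I \<omega>) + ennreal c * (?W \<omega> + ?I \<omega>)"
          using elim(2) by (intro add_mono) auto
        also have "\<dots> = ennreal (2 * c) * (?W \<omega> + ?I \<omega>)"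
        proof -
          have "ennreal (2 * c) = ennreal c + ennreal c"
            using c(1) by (simp flip: ennreal_plus)
          then show ?thesis by (simp only: distrib_right)
        qed
        finally show ?thesis using True elim(3) by simp
      next
        case False
        then have "f (X t \<omega>) = f (Y \<Lambda>' t \<omega>)" using loc[OF cf(1)] loc[OF cf(2)] elim(1) by simp
        then show ?thesis by simp
      qed
    qed
  qed
  also have "\<dots> = ennreal (2 * c) * ((\<integral>\<^sup>+\<omega>. ?W \<omega> * indicator ?E \<omega> \<partial>M) + (\<integral>\<^sup>+\<omega>. ?I \<omega> * indicator D (N \<omega>) \<partial>M))"
  proof -
    have [measurable]: "(\<lambda>\<omega>. indicator D (N \<omega>) :: ennreal) \<in> borel_measurable M"
      by (rule measurable_compose[OF measurable_noise(1)]) (rule borel_measurable_indicator[OF D])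
    show ?thesis by (simp add: nn_integral_cmult nn_integral_add)
  qed
  also have "\<dots> \<le> ennreal (2 * c) * (ennreal (a * (l * t + (l * t)\<^sup>2) + \<beta> / a) + ennreal (\<beta> * (\<rho> * l)))"
  proof (intro mult_left_mono add_mono)
    have "(\<integral>\<^sup>+\<omega>. ?W \<omega> * indicator ?E \<omega> \<partial>M) \<le> ennreal a * ennreal (l * t + (l * t)\<^sup>2) + ennreal (1 / a) * ennreal \<beta>"
      by (rule order_trans[OF WE[OF E a]]) (intro add_left_mono mult_left_mono EB, simp)
    also have "\<dots> = ennreal (a * (l * t + (l * t)\<^sup>2) + \<beta> / a)"
      using a b0 l0 t by (simp flip: ennreal_plus ennreal_mult)
    finally show "(\<integral>\<^sup>+\<omega>. ?W \<omega> * indicator ?E \<omega> \<partial>M) \<le> ennreal (a * (l * t + (l * t)\<^sup>2) + \<beta> / a)" .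
    have "(\<integral>\<^sup>+\<omega>. ?I \<omega> * indicator D (N \<omega>) \<partial>M) = emeasure M ?E * mean_count \<Lambda>"
      unfolding mean_count_def by (rule initial_count_indep[OF D]) (use L in \<open>simp add: bounded_borel_def\<close>)
    also have "\<dots> \<le> ennreal \<beta> * ennreal (\<rho> * l)"
      unfolding \<rho>(2) l_def by (intro mult_right_mono EB) simp
    also have "\<dots> = ennreal (\<beta> * (\<rho> * l))" using b0 by (simp add: ennreal_mult')
    finally show "(\<integral>\<^sup>+\<omega>. ?I \<omega> * indicator D (N \<omega>) \<partial>M) \<le> ennreal (\<beta> * (\<rho> * l))" .
  qed simp
  also have "\<dots> = ennreal (2 * c * (a * (l * t + (l * t)\<^sup>2) + \<beta> / a + \<beta> * (\<rho> * l)))"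
    using a b0 l0 t c(1) \<rho>(1) by (simp flip: ennreal_plus ennreal_mult)
  finally show ?thesis
    using a b0 l0 t c(1) \<rho>(1) by (subst (asm) ennreal_le_iff) (auto intro!: mult_nonneg_nonneg add_nonneg_nonneg)
qed

end

lemma measure_incseq_at_top:
  fixes L :: "nat \<Rightarrow> 'a::euclidean_space set"
  assumes "\<And>n. bounded_borel (L n)" "incseq L" "(\<Union>n. L n) = UNIV"
  shows "filterlim (\<lambda>n. measure lborel (L n)) at_top sequentially"
proof -
  have "(\<lambda>n. emeasure lborel (L n)) \<longlonglongrightarrow> emeasure lborel (\<Union>n. L n)"
    using assms by (intro Lim_emeasure_incseq) (auto simp: bounded_borel_def)
  then have "(\<lambda>n. ennreal (measure lborel (L n))) \<longlonglongrightarrow> \<infinity>"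
    using assms by (simp add: emeasure_lborel_bounded_borel)
  then show ?thesis by (simp add: ennreal_tendsto_top_eq_at_top)
qed

section \<open>The two asymptotic statements\<close>

context local_coupling
begin

lemma bounded_local_convergence:
  "\<exists>C. \<forall>\<Lambda> \<Lambda>' f.
     bounded_borel \<Lambda> \<longrightarrow> bounded_borel \<Lambda>' \<longrightarrow> \<Lambda> \<subseteq> \<Lambda>' \<longrightarrow>
     f \<in> configs \<rightarrow>\<^sub>M (borel :: real measure) \<longrightarrow> bounded (f ` space configs) \<longrightarrow>
     (\<forall>\<eta>\<in>space configs. f \<eta> = f (\<eta> \<inter> \<Lambda>)) \<longrightarrow>
     \<bar>(\<integral>\<eta>. f \<eta> \<partial>distr M configs (X t)) - (\<integral>\<eta>. f \<eta> \<partial>distr M configs (Y \<Lambda>' t))\<bar>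
       \<le> C * measure lborel \<Lambda> * (SUP \<eta>\<in>space configs. \<bar>f \<eta>\<bar>) * exp (- setdist \<Lambda> (- \<Lambda>'))"
proof (rule coupling[OF zero_less_one])
  fix C :: real
  assume C: "\<And>\<Lambda> \<Lambda>'. bounded_borel \<Lambda> \<Longrightarrow> bounded_borel \<Lambda>' \<Longrightarrow> \<Lambda> \<subseteq> \<Lambda>' \<Longrightarrow>
      \<exists>D\<in>sets configs. measure M {\<omega> \<in> space M. N \<omega> \<in> D} \<le> C * measure lborel \<Lambda> * exp (- 1 * setdist \<Lambda> (- \<Lambda>')) \<and>
        (AE \<omega> in M. N \<omega> \<notin> D \<longrightarrow> X t \<omega> \<inter> \<Lambda> = Y \<Lambda>' t \<omega> \<inter> \<Lambda>)"
  show ?thesis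
  \<comment> \<open>The rate \<theta> is 1 here; the factor 2 bounds the difference of two values of
    \<open>f\<close>.\<close>
  proof (intro exI[of _ "2 * C"] allI impI)
    fix \<Lambda> \<Lambda>' and f :: "'a set \<Rightarrow> real"
    assume L: "bounded_borel \<Lambda>" "bounded_borel \<Lambda>'" "\<Lambda> \<subseteq> \<Lambda>'"
      and f: "f \<in> configs \<rightarrow>\<^sub>M borel" and bdd: "bounded (f ` space configs)"
      and loc: "\<forall>\<eta>\<in>space configs. f \<eta> = f (\<eta> \<inter> \<Lambda>)"
    let ?F = "SUP \<eta>\<in>space configs. \<bar>f \<eta>\<bar>"
    obtain D where D: "D \<in> sets configs"
      "measure M {\<omega> \<in> space M. N \<omega> \<in> D} \<le> C * measure lborel \<Lambda> * exp (- setdist \<Lambda> (- \<Lambda>'))"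
      "AE \<omega> in M. N \<omega> \<notin> D \<longrightarrow> X t \<omega> \<inter> \<Lambda> = Y \<Lambda>' t \<omega> \<inter> \<Lambda>"
      using C[OF L] by auto
    obtain b where b: "\<bar>f \<eta>\<bar> \<le> b" if "\<eta> \<in> space configs" for \<eta>
      using bdd by (auto simp: bounded_iff)
    then have "bdd_above ((\<lambda>\<eta>. \<bar>f \<eta>\<bar>) ` space configs)" by (auto simp: bdd_above_def)
    then have F: "\<bar>f \<eta>\<bar> \<le> ?F" if "\<eta> \<in> space configs" for \<eta>
      using that by (intro cSUP_upper)
    have "{} \<in> space configs" by (simp add: space_configs locally_finite_def)
    then have F0: "0 \<le> ?F" by (rule order_trans[OF abs_ge_zero F])
    have "\<bar>(\<integral>\<eta>. f \<eta> \<partial>distr M configs (X t)) - (\<integral>\<eta>. f \<eta> \<partial>distr M configs (Y \<Lambda>' t))\<bar>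
        \<le> 2 * ?F * measure M {\<omega> \<in> space M. N \<omega> \<in> D}"
      by (rule bounded_difference[OF L(2) D(1,3) f F]) (use loc in auto)
    also have "\<dots> \<le> 2 * ?F * (C * measure lborel \<Lambda> * exp (- setdist \<Lambda> (- \<Lambda>')))"
      using F0 D(2) by (intro mult_left_mono) auto
    finally show "\<bar>(\<integral>\<eta>. f \<eta> \<partial>distr M configs (X t)) - (\<integral>\<eta>. f \<eta> \<partial>distr M configs (Y \<Lambda>' t))\<bar>
       \<le> 2 * C * measure lborel \<Lambda> * ?F * exp (- setdist \<Lambda> (- \<Lambda>'))"
      by (simp add: mult_ac)
  qed
qed

text \<open>Write \<open>l\<close> for the volume and \<open>d\<close> for the distance. The ratio
  condition says that \<open>l\<close> is at most \<open>exp (a * d)\<close>, so decay at rate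
  \<open>a + 1\<close> beats the volume and leaves probability at most \<gamma> =
  \<open>C * exp (- d)\<close>. The births then contribute terms of order \<open>s * l\<close> and
  \<open>\<gamma> / (s * l)\<close> after division by \<open>l\<close>, with \<open>s\<close> the
  free parameter of the second moment estimate; \<open>s = sqrt \<gamma> / l\<close> balances them,
  both being of order \<open>sqrt \<gamma>\<close>.\<close>

lemma linear_local_convergence:
  fixes f :: "'a set \<Rightarrow> 'a set \<Rightarrow> real" and c :: real and L L' :: "nat \<Rightarrow> 'a set"
  assumes f: "\<forall>\<Lambda>. bounded_borel \<Lambda> \<longrightarrow> f \<Lambda> \<in> configs \<rightarrow>\<^sub>M borel \<and>
      (\<forall>\<eta>\<in>space configs. f \<Lambda> \<eta> = f \<Lambda> (\<eta> \<inter> \<Lambda>) \<and> \<bar>f \<Lambda> \<eta>\<bar> \<le> c * real (card (\<eta> \<inter> \<Lambda>)))"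
    and L: "\<forall>n. bounded_borel (L n) \<and> bounded_borel (L' n) \<and> L n \<subseteq> L' n" "incseq L" "(\<Union>n. L n) = UNIV"
    and ratio: "\<exists>a. eventually (\<lambda>n. setdist (L n) (- L' n) > 0 \<and>
               ln (measure lborel (L n)) / setdist (L n) (- L' n) \<le> a) sequentially"
  shows "(\<lambda>n. 1 / measure lborel (L n) *
               \<bar>(\<integral>\<eta>. f (L n) \<eta> \<partial>distr M configs (X t))
                 - (\<integral>\<eta>. f (L n) \<eta> \<partial>distr M configs (Y (L' n) t))\<bar>) \<longlonglongrightarrow> 0"
proof -
  let ?l = "\<lambda>n. measure lborel (L n)" and ?d = "\<lambda>n. setdist (L n) (- L' n)"
  let ?\<Delta> = "\<lambda>n. \<bar>(\<integral>\<eta>. f (L n) \<eta> \<partial>distr M configs (X t)) - (\<integral>\<eta>. f (L n) \<eta> \<partial>distr M configs (Y (L' n) t))\<bar>"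
  from ratio obtain a0 where a0: "\<forall>\<^sub>F n in sequentially. ?d n > 0 \<and> ln (?l n) / ?d n \<le> a0" by blast
  \<comment> \<open>The given bound may be zero or negative; enlarging it to at least 1 allows
    division by \<open>a\<close> and makes the rate \<open>a + 1\<close> positive.\<close>
  define a where "a = max a0 1"
  have a: "1 \<le> a" by (simp add: a_def)
  have top: "filterlim ?l at_top sequentially"
    by (rule measure_incseq_at_top) (use L in auto)
  have l1: "\<forall>\<^sub>F n in sequentially. 1 \<le> ?l n"
    using top unfolding filterlim_at_top by blast
  have la: "\<forall>\<^sub>F n in sequentially. ln (?l n) \<le> a * ?d n"
    using a0
  proof eventually_elim
    case (elim n)
    then have "ln (?l n) / ?d n \<le> a" by (auto simp: a_def)
    then show ?case using elim by (simp add: field_simps)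
  qed
  \<comment> \<open>The distance tends to infinity because the logarithm of the volume does and is
    at most \<open>a\<close> times the distance.\<close>
  have "filterlim (\<lambda>n. ln (?l n)) at_top sequentially"
    by (rule filterlim_compose[OF ln_at_top top])
  then have "filterlim (\<lambda>n. a * ?d n) at_top sequentially"
    by (rule filterlim_at_top_mono[OF _ la])
  then have "filterlim (\<lambda>n. inverse a * (a * ?d n)) at_top sequentially"
    by (rule filterlim_tendsto_pos_mult_at_top[OF tendsto_const, rotated]) (use a in simp)
  moreover have "inverse a * (a * ?d n) = ?d n" for n using a by (simp add: field_simps)
  ultimately have dtop: "filterlim ?d at_top sequentially" by (simp only:)
  obtain \<rho> where \<rho>: "0 \<le> \<rho>" "\<And>B. bounded_borel B \<Longrightarrow> mean_count B = ennreal (\<rho> * measure lborel B)"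
    using intensity by metis
  have "0 < a + 1" using a by simp
  then show ?thesis
  proof (rule coupling)
    fix C :: real
    assume C: "0 < C" and coup: "\<And>\<Lambda> \<Lambda>'. bounded_borel \<Lambda> \<Longrightarrow> bounded_borel \<Lambda>' \<Longrightarrow> \<Lambda> \<subseteq> \<Lambda>' \<Longrightarrow>
      \<exists>D\<in>sets configs. measure M {\<omega> \<in> space M. N \<omega> \<in> D} \<le> C * measure lborel \<Lambda> * exp (- (a + 1) * setdist \<Lambda> (- \<Lambda>')) \<and>
        (AE \<omega> in M. N \<omega> \<notin> D \<longrightarrow> X t \<omega> \<inter> \<Lambda> = Y \<Lambda>' t \<omega> \<inter> \<Lambda>)"
    define \<gamma> where "\<gamma> n = C * exp (- ?d n)" for n
    have \<gamma>0: "0 < \<gamma> n" for n using C by (simp add: \<gamma>_def)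
    have "((\<lambda>n. C * exp (- ?d n)) \<longlongrightarrow> C * 0) sequentially"
      by (intro tendsto_mult tendsto_const filterlim_compose[OF exp_at_bot] filterlim_compose[OF filterlim_uminus_at_bot_at_top dtop])
    then have \<gamma>_lim: "\<gamma> \<longlonglongrightarrow> 0" by (simp add: \<gamma>_def[abs_def])
    let ?b = "\<lambda>n. 2 * \<bar>c\<bar> * (sqrt (\<gamma> n) * (t + t\<^sup>2 + 1) + \<gamma> n * \<rho>)"
    have b_lim: "?b \<longlonglongrightarrow> 2 * \<bar>c\<bar> * (sqrt 0 * (t + t\<^sup>2 + 1) + 0 * \<rho>)"
      by (intro tendsto_intros \<gamma>_lim)
    have bound: "\<forall>\<^sub>F n in sequentially. 1 / ?l n * ?\<Delta> n \<le> ?b n"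
      using l1 la
    proof eventually_elim
      case (elim n)
      let ?s = "sqrt (\<gamma> n)"
      have s: "0 < ?s" using \<gamma>0 by simp
      have Ln: "bounded_borel (L n)" "bounded_borel (L' n)" "L n \<subseteq> L' n" using L(1) by auto
      obtain D where D: "D \<in> sets configs"
        "measure M {\<omega> \<in> space M. N \<omega> \<in> D} \<le> C * ?l n * exp (- (a + 1) * ?d n)"
        "AE \<omega> in M. N \<omega> \<notin> D \<longrightarrow> X t \<omega> \<inter> L n = Y (L' n) t \<omega> \<inter> L n"
        using coup[OF Ln] by auto
      \<comment> \<open>The part \<open>a\<close> of the rate pays for the volume factor; one unit
        of decay in the distance is left.\<close>
      have "?l n = exp (ln (?l n))" using elim by simp
      also have "\<dots> \<le> exp (a * ?d n)" using elim(2) by (simp only: exp_le_cancel_iff)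
      finally have "C * ?l n * exp (- (a + 1) * ?d n) \<le> C * exp (a * ?d n) * exp (- (a + 1) * ?d n)"
        using C by (intro mult_right_mono mult_left_mono) auto
      also have "\<dots> = \<gamma> n"
        by (simp add: \<gamma>_def mult.assoc flip: exp_add) (simp add: algebra_simps)
      finally have \<beta>: "measure M {\<omega> \<in> space M. N \<omega> \<in> D} \<le> \<gamma> n" using D(2) by linarith
      have fL: "f (L n) \<in> configs \<rightarrow>\<^sub>M borel"
        "\<And>\<eta>. \<eta> \<in> space configs \<Longrightarrow> f (L n) \<eta> = f (L n) (\<eta> \<inter> L n)"
        "\<And>\<eta>. \<eta> \<in> space configs \<Longrightarrow> \<bar>f (L n) \<eta>\<bar> \<le> c * real (card (\<eta> \<inter> L n))"
        using f Ln(1) by blast+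
      have fc: "\<bar>f (L n) \<eta>\<bar> \<le> \<bar>c\<bar> * real (card (\<eta> \<inter> L n))" if "\<eta> \<in> space configs" for \<eta>
        using fL(3)[OF that] by (rule order_trans) (intro mult_right_mono, auto)
      \<comment> \<open>The parameter is \<open>sqrt (\<gamma> n)\<close> divided by the volume: the
        division compensates the square of the volume in the second moment.\<close>
      have "?\<Delta> n \<le> 2 * \<bar>c\<bar> * (?s / ?l n * (?l n * t + (?l n * t)\<^sup>2) + \<gamma> n / (?s / ?l n) + \<gamma> n * (\<rho> * ?l n))"
        by (rule linear_difference[OF Ln D(1,3) fL(1) abs_ge_zero fc fL(2) \<rho>(1) \<rho>(2)[OF Ln(1)] _ \<beta>])
          (use s elim in auto)
      then have "1 / ?l n * ?\<Delta> n \<le> 1 / ?l n * (2 * \<bar>c\<bar> * (?s / ?l n * (?l n * t + (?l n * t)\<^sup>2) + \<gamma> n / (?s / ?l n) + \<gamma> n * (\<rho> * ?l n)))"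
        using elim by (intro mult_left_mono) auto
      also have "\<dots> = 2 * \<bar>c\<bar> * (?s * (t / ?l n + t\<^sup>2) + \<gamma> n / ?s + \<gamma> n * \<rho>)"
        using elim s by (simp add: field_simps power2_eq_square)
      also have "\<gamma> n / ?s = ?s"
        using \<gamma>0[of n] by (simp add: real_div_sqrt)
      also have "2 * \<bar>c\<bar> * (?s * (t / ?l n + t\<^sup>2) + ?s + \<gamma> n * \<rho>) \<le> ?b n"
      proof -
        \<comment> \<open>The volume is eventually at least 1, so the linear term of the second
          moment causes no trouble after the division.\<close>
        have "t / ?l n \<le> t" using divide_left_mono[of 1 "?l n" t] elim(1) t by simp
        then have "?s * (t / ?l n + t\<^sup>2) \<le> ?s * (t + t\<^sup>2)" using s by (intro mult_left_mono) auto
        then show ?thesis by (intro mult_left_mono) (auto simp: algebra_simps)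
      qed
      finally show ?case .
    qed
    have "(\<lambda>n. 1 / ?l n * ?\<Delta> n) \<longlonglongrightarrow> 0"
    proof (rule tendsto_sandwich)
      show "\<forall>\<^sub>F n in sequentially. 0 \<le> 1 / ?l n * ?\<Delta> n" by (intro always_eventually allI) simp
      show "\<forall>\<^sub>F n in sequentially. 1 / ?l n * ?\<Delta> n \<le> ?b n" by (rule bound)
      show "?b \<longlonglongrightarrow> 0" using b_lim by simp
    qed simp
    then show ?thesis .
  qed
qed

end

theorem lemma4p5:
  fixes R t :: real
    and \<pi> \<nu> \<mu> :: "'a::euclidean_space set measure"
    and M :: "'w measure"
    and N :: "'w \<Rightarrow> ('a \<times> real \<times> real \<times> real) set"
    and K :: "'w \<Rightarrow> enat" and x :: "nat \<Rightarrow> 'w \<Rightarrow> 'a" and \<tau> :: "nat \<Rightarrow> 'w \<Rightarrow> real"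
    and X :: "real \<Rightarrow> 'w \<Rightarrow> 'a set"
    and \<kappa> :: "'a set \<Rightarrow> 'a set \<Rightarrow> 'a set measure"
    and Y :: "'a set \<Rightarrow> real \<Rightarrow> 'w \<Rightarrow> 'a set"
  assumes "R > 0"
    and "sets \<pi> = sets configs" and "poisson_process \<pi> (\<lambda>\<eta>. \<eta>) lborel"
    and "gibbs_process R \<pi> \<nu>" and "translation_invariant \<nu>"
    and "\<mu> \<in> space (prob_algebra configs)" and "translation_invariant \<mu>"
    and "finite_first_moment \<mu>"
    and "driving_noise M N K x \<tau> \<mu>"
    and "birth_death_process M N (marked_points K x \<tau>) UNIV (birth_rate R) X"
    and "\<And>\<Lambda>. bounded_borel \<Lambda> \<Longrightarrow> conditional_law \<nu> \<Lambda> (\<kappa> \<Lambda>)"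
    and "\<And>\<Lambda>. bounded_borel \<Lambda> \<Longrightarrow>
           birth_death_process M N (marked_points K x \<tau>) \<Lambda> (local_birth_rate R (\<kappa> \<Lambda>)) (Y \<Lambda>)"
    and "t \<ge> 0"
  shows "(\<exists>C. \<forall>\<Lambda> \<Lambda>' f.
            bounded_borel \<Lambda> \<longrightarrow> bounded_borel \<Lambda>' \<longrightarrow> \<Lambda> \<subseteq> \<Lambda>' \<longrightarrow>
            f \<in> configs \<rightarrow>\<^sub>M (borel :: real measure) \<longrightarrow> bounded (f ` space configs) \<longrightarrow>
            (\<forall>\<eta>\<in>space configs. f \<eta> = f (\<eta> \<inter> \<Lambda>)) \<longrightarrow>
            \<bar>(\<integral>\<eta>. f \<eta> \<partial>distr M configs (X t)) - (\<integral>\<eta>. f \<eta> \<partial>distr M configs (Y \<Lambda>' t))\<bar>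
              \<le> C * measure lborel \<Lambda> * (SUP \<eta>\<in>space configs. \<bar>f \<eta>\<bar>) * exp (- setdist \<Lambda> (- \<Lambda>')))
       \<and> (\<forall>(f :: 'a set \<Rightarrow> 'a set \<Rightarrow> real) c L L'.
            (\<forall>\<Lambda>. bounded_borel \<Lambda> \<longrightarrow>
               f \<Lambda> \<in> configs \<rightarrow>\<^sub>M borel \<and>
               (\<forall>\<eta>\<in>space configs. f \<Lambda> \<eta> = f \<Lambda> (\<eta> \<inter> \<Lambda>) \<and>
                  \<bar>f \<Lambda> \<eta>\<bar> \<le> c * real (card (\<eta> \<inter> \<Lambda>)))) \<longrightarrow>
            (\<forall>n. bounded_borel (L n) \<and> bounded_borel (L' n) \<and> L n \<subseteq> L' n) \<longrightarrow>
            incseq L \<longrightarrow> (\<Union>n. L n) = UNIV \<longrightarrow> incseq L' \<longrightarrow> (\<Union>n. L' n) = UNIV \<longrightarrow>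
            (\<exists>a. eventually (\<lambda>n. setdist (L n) (- L' n) > 0 \<and>
               ln (measure lborel (L n)) / setdist (L n) (- L' n) \<le> a) sequentially) \<longrightarrow>
            (\<lambda>n. 1 / measure lborel (L n) *
               \<bar>(\<integral>\<eta>. f (L n) \<eta> \<partial>distr M configs (X t))
                 - (\<integral>\<eta>. f (L n) \<eta> \<partial>distr M configs (Y (L' n) t))\<bar>)
              \<longlonglongrightarrow> 0)"
proof -
  interpret local_coupling M N K x \<tau> \<mu> R t \<nu> X \<kappa> Y
    by unfold_locales (fact assms)+
  show ?thesis
    by (intro conjI bounded_local_convergence allI impI) (rule linear_local_convergence)
qed

end
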